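(* Let $f_{i,k}:\mathbb{R}^d\to\mathbb{R}$ ($i\in[N]$, $k\in[M]$) be differentiable, $F_k=\frac1N\sum_{i=1}^N f_{i,k}$, with each $F_k$ bounded below, and suppose assumptions (A1)-(A5) of the context hold with constants $L>0$, $\sigma^2$, $\sigma_g^2$, $B>0$, $q>0$. Run the algorithm of the context for $T$ rounds with $\tau$ local steps, $n$ selected clients per round, Gram-estimation client sets of size $n'$, and $$\eta_l=\frac{1}{L\tau\sqrt{\tau T}},\qquad \eta_g=\sqrt{\tau},\qquad \beta=\frac{1}{M\sqrt T},$$ where $\eta_l\le\frac1{2L\tau}$ (i.e. $\tau T\ge4$). Let $$C_1=\mathcal{O}\Big(\frac{q+1}{n'}\sigma^2+\frac{q B^2}{n'}+\frac{N-n'}{n'(N-1)}\sigma_g^2+B^2\Big)$$ (a numerical constant times the displayed expression, so a constant independent of $T$ and $M$). Then $$\frac1T\sum_{t=0}^{T-1}\mathbb{E}\Big\|\sum_{k=1}^M w_k^{(t)}\nabla F_k(x^{(t)})\Big\|^2\le\mathcal{O}\Big(\frac{B^2+C_1^2}{\sqrt T}\Big)+\mathcal{O}\Big(\frac{\sigma^2}{\tau\sqrt T}\Big(\frac1n+\frac1\tau\Big)\Big),$$ where $\mathcal{O}(\cdot)$ in this bound hides only numerical constants, the smoothness constant $L$ and the initial optimization gap $\delta=\frac1M\sum_{k=1}^M\big(F_k(x^{(0)})-\inf_xF_k(x)\big)$.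
   Context: Setting: $N\ge2$ clients, $M$ objectives, model dimension $d$, $[m]=\{1,\dots,m\}$. $\mathbf F(x)=[F_1(x),\dots,F_M(x)]^\top$ and $\nabla\mathbf F(x)=[\nabla F_1(x),\dots,\nabla F_M(x)]\in\mathbb{R}^{d\times M}$. $\mathcal{W}_M$ is the probability simplex in $\mathbb{R}^M$ and $\mathrm{proj}_{\mathcal{W}_M}$ the Euclidean projection onto it. $\widetilde\nabla f_{i,k}(x)$ denotes a stochastic gradient of $f_{i,k}$ at $x$; $Q$ is a random compression operator on $\mathbb{R}^d$. $\|\cdot\|$ is the Euclidean norm. Assumptions: (A1) $\|\nabla f_{i,k}(x)-\nabla f_{i,k}(x')\|\le L\|x-x'\|$ for all $i,k,x,x'$. (A2) $\mathbb{E}[\widetilde\nabla f_{i,k}(x)]=\nabla f_{i,k}(x)$ and $\mathbb{E}\|\widetilde\nabla f_{i,k}(x)-\nabla f_{i,k}(x)\|^2\le\sigma^2$ for all $i,k,x$. (A3) $\frac1N\sum_{i=1}^N\|\nabla f_{i,k}(x)-\nabla F_k(x)\|^2\le\sigma_g^2$ for all $k,x$. (A4) $\|\nabla f_{i,k}(x)\|\le B$ for all $i,k,x$. (A5) $\mathbb{E}[Q(x)]=x$ and $\mathbb{E}\|Q(x)-x\|^2\le q\|x\|^2$ for all $x\in\mathbb{R}^d$. Algorithm (FedCMOO, in the form analysed). Start from $x^{(0)}\in\mathbb{R}^d$ and $w^{(0)}=(1/M,\dots,1/M)$. In round $t=0,\dots,T-1$: 1. Select a set $\mathcal{B}^{(t)}$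 of $n$ clients uniformly at random (without replacement) from $[N]$. 2. For $j=1,2$, sample independently a set $\mathcal{A}^{(t)}_j$ of $n'$ clients uniformly at random (without replacement); each $i\in\mathcal{A}_j^{(t)}$ draws fresh stochastic gradients $\widetilde\nabla f_{i,k}(x^{(t)},\xi_j)$, $k\in[M]$, and sends $Q(\widetilde\nabla f_{i,k}(x^{(t)},\xi_j))$. Put $Y_j^{(t)}=\frac1{n'}\sum_{i\in\mathcal{A}^{(t)}_j}[Q(\widetilde\nabla f_{i,1}(x^{(t)},\xi_j)),\dots,Q(\widetilde\nabla f_{i,M}(x^{(t)},\xi_j))]\in\mathbb{R}^{d\times M}$ and $G^{(t)}=(Y_1^{(t)})^\top Y_2^{(t)}$. 3. $w^{(t+1)}=\mathrm{proj}_{\mathcal{W}_M}\big(w^{(t)}-\beta G^{(t)}w^{(t)}\big)$. 4. Each $i\in\mathcal{B}^{(t)}$ sets $x_i^{(t,0)}=x^{(t)}$ and, for $r=0,\dots,\tau-1$, $x_i^{(t,r+1)}=x_i^{(t,r)}-\eta_l\sum_{k=1}^M w_k^{(t+1)}\widetilde\nabla f_{i,k}(x_i^{(t,r)})$; then $\Delta_i^{(t)}=\frac{1}{\tau\eta_l}(x^{(t)}-x_i^{(t,\tau)})$. 5. $x^{(t+1)}=x^{(t)}-\eta_g\eta_l\tau\frac1n\sum_{i\in\mathcal{B}^{(t)}}\Delta_i^{(t)}$. The client samplings, the stochastic gradient draws (across clients, local steps, rounds, and between the two Gram-estimation sets and local training) and the compression randomness are mutually independent; conditional on the past, (A2) and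 (A5) hold at the (random) points where they are applied.
   Formalization: The hidden dependence on L and δ is an added term: the first O is proved as 10(B²+C₁²+Lδ)/√T. A mere factor depending on L and δ fails when B is small (noiseless Huber function, B²=1/(2√T)). *)

theory Defs
  imports "HOL-Probability.Probability"
begin

text \<open>
  The index types \<open>'c\<close>, \<open>'m\<close> and \<open>'d\<close> stand for the clients, the objectives and the coordinates
  of the model, so that \<open>N = CARD('c)\<close>, \<open>M = CARD('m)\<close> and \<open>d = CARD('d)\<close>.
\<close>

definition grad :: "(real^'d \<Rightarrow> real) \<Rightarrow> real^'d \<Rightarrow> real^'d" where
  "grad f x = (THE g. gderiv f x g)"

definition avg_obj :: "('c::finite \<Rightarrow> 'm \<Rightarrow> real^'d \<Rightarrow> real) \<Rightarrow> 'm \<Rightarrow> real^'d \<Rightarrow> real" where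
  "avg_obj f k x = (\<Sum>i\<in>UNIV. f i k x) / real CARD('c)"

definition prob_simplex :: "(real^'m) set" where
  "prob_simplex = {w. (\<forall>k. 0 \<le> w $ k) \<and> (\<Sum>k\<in>UNIV. w $ k) = 1}"

definition initial_gap :: "('c::finite \<Rightarrow> 'm::finite \<Rightarrow> real^'d \<Rightarrow> real) \<Rightarrow> real^'d \<Rightarrow> real" where
  "initial_gap f x0 =
     (\<Sum>k\<in>UNIV. avg_obj f k x0 - (INF x. avg_obj f k x)) / real CARD('m)"

text \<open>
  Convergence bounds stated as \<open>O(\<dots>)\<close> are rendered with explicit numerals: \<open>N\<close>, \<open>M\<close> and \<open>d\<close> are
  cardinalities of types, so an existentially quantified constant could depend on them. When such
  an \<open>O(B\<^sup>2 + \<dots>)\<close> hides the smoothness constant \<open>L\<close> and the initial gap \<open>\<delta>\<close>, they appear as a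
  summand \<open>L * \<delta>\<close>. A factor depending only on \<open>L\<close> and \<open>\<delta>\<close> cannot absorb it, because the gradient
  bound \<open>B\<close> can be arbitrarily small for fixed \<open>L\<close> and \<open>\<delta>\<close>.
\<close>


subsection \<open>Stochastic gradients and compression\<close>

text \<open>
  A stochastic gradient of \<open>f i k\<close> at \<open>x\<close> is \<open>sg i k s x\<close> for a sample \<open>s\<close> drawn from the law \<open>D i\<close>.
  The sample is shared by all objectives \<open>k\<close>, so nothing is assumed about the dependence between
  objectives. Similarly, \<open>Q z x\<close> is the compression of \<open>x\<close> for a seed \<open>z\<close> drawn from the law \<open>Z\<close>.
  Joint measurability makes the iterates of the algorithm random variables. Since samples and
  seeds are drawn independently of the past, the moment conditions below hold conditionally on
  the past at the random points at which the oracles are evaluated. The second moments are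
  Lebesgue integrals in \<^typ>\<open>ennreal\<close>, so the bounds include their finiteness.
\<close>

definition stochastic_gradients ::
  "('c::finite \<Rightarrow> 's measure) \<Rightarrow> ('c \<Rightarrow> 'm::finite \<Rightarrow> 's \<Rightarrow> real^'d \<Rightarrow> real^'d)
   \<Rightarrow> ('c \<Rightarrow> 'm \<Rightarrow> real^'d \<Rightarrow> real) \<Rightarrow> real \<Rightarrow> bool" where
  "stochastic_gradients D sg f \<sigma> \<longleftrightarrow>
     (\<forall>i. prob_space (D i)) \<and>
     (\<forall>i k. (\<lambda>(s, x). sg i k s x) \<in> borel_measurable (D i \<Otimes>\<^sub>M borel)) \<and>
     (\<forall>i k x. integrable (D i) (\<lambda>s. sg i k s x) \<and>
        (\<integral>s. sg i k s x \<partial>D i) = grad (f i k) x \<and>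
        (\<integral>\<^sup>+s. ennreal ((norm (sg i k s x - grad (f i k) x))\<^sup>2) \<partial>D i) \<le> ennreal (\<sigma>\<^sup>2))"

definition compressor ::
  "'z measure \<Rightarrow> ('z \<Rightarrow> real^'d \<Rightarrow> real^'d) \<Rightarrow> real \<Rightarrow> bool" where
  "compressor Z Q q \<longleftrightarrow>
     prob_space Z \<and>
     (\<lambda>(z, x). Q z x) \<in> borel_measurable (Z \<Otimes>\<^sub>M borel) \<and>
     (\<forall>x. integrable Z (\<lambda>z. Q z x) \<and>
        (\<integral>z. Q z x \<partial>Z) = x \<and>
        (\<integral>\<^sup>+z. ennreal ((norm (Q z x - x))\<^sup>2) \<partial>Z) \<le> ennreal (q * (norm x)\<^sup>2))"


subsection \<open>The random draws of a run\<close>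

datatype gram_set = Gram1 | Gram2

text \<open>
  Samples and seeds are indexed by all clients; the algorithm uses only those of the
  selected clients.
\<close>

record ('w, 'c, 'm, 's, 'z) draws =
  round_clients :: "nat \<Rightarrow> 'w \<Rightarrow> 'c set"
  gram_clients :: "nat \<Rightarrow> gram_set \<Rightarrow> 'w \<Rightarrow> 'c set"
  gram_sample :: "nat \<Rightarrow> gram_set \<Rightarrow> 'c \<Rightarrow> 'w \<Rightarrow> 's"
  gram_seed :: "nat \<Rightarrow> gram_set \<Rightarrow> 'c \<Rightarrow> 'm \<Rightarrow> 'w \<Rightarrow> 'z"
  local_sample :: "nat \<Rightarrow> 'c \<Rightarrow> nat \<Rightarrow> 'w \<Rightarrow> 's"

datatype ('c, 'm) draw =
    Round_Clients nat
  | Gram_Clients nat gram_set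
  | Gram_Sample nat gram_set 'c
  | Gram_Seed nat gram_set 'c 'm
  | Local_Sample nat 'c nat

primrec in_run :: "nat \<Rightarrow> nat \<Rightarrow> ('c, 'm) draw \<Rightarrow> bool" where
  "in_run T \<tau> (Round_Clients t) \<longleftrightarrow> t < T"
| "in_run T \<tau> (Gram_Clients t j) \<longleftrightarrow> t < T"
| "in_run T \<tau> (Gram_Sample t j i) \<longleftrightarrow> t < T"
| "in_run T \<tau> (Gram_Seed t j i k) \<longleftrightarrow> t < T"
| "in_run T \<tau> (Local_Sample t i r) \<longleftrightarrow> t < T \<and> r < \<tau>"

text \<open>
  The draws take values in different types, so their mutual independence is stated for the
  \<open>\<sigma>\<close>-algebras that they generate.
\<close>

primrec generated_algebra ::
  "'w measure \<Rightarrow> ('c \<Rightarrow> 's measure) \<Rightarrow> 'z measure \<Rightarrow> ('w, 'c, 'm, 's, 'z) draws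
   \<Rightarrow> ('c, 'm) draw \<Rightarrow> 'w measure" where
  "generated_algebra P D Z R (Round_Clients t) =
     vimage_algebra (space P) (round_clients R t) (count_space UNIV)"
| "generated_algebra P D Z R (Gram_Clients t j) =
     vimage_algebra (space P) (gram_clients R t j) (count_space UNIV)"
| "generated_algebra P D Z R (Gram_Sample t j i) =
     vimage_algebra (space P) (gram_sample R t j i) (D i)"
| "generated_algebra P D Z R (Gram_Seed t j i k) =
     vimage_algebra (space P) (gram_seed R t j i k) Z"
| "generated_algebra P D Z R (Local_Sample t i r) =
     vimage_algebra (space P) (local_sample R t i r) (D i)"

definition has_law :: "'w measure \<Rightarrow> ('w \<Rightarrow> 'a) \<Rightarrow> 'a measure \<Rightarrow> bool" where
  "has_law P X \<mu> \<longleftrightarrow> X \<in> measurable P \<mu> \<and> distr P \<mu> X = \<mu>"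

definition uniform_clients :: "nat \<Rightarrow> 'c::finite set measure" where
  "uniform_clients n = measure_pmf (pmf_of_set {S. card S = n})"

definition run_draws ::
  "'w measure \<Rightarrow> ('c::finite \<Rightarrow> 's measure) \<Rightarrow> 'z measure \<Rightarrow> nat \<Rightarrow> nat \<Rightarrow> nat \<Rightarrow> nat
   \<Rightarrow> ('w, 'c, 'm::finite, 's, 'z) draws \<Rightarrow> bool" where
  "run_draws P D Z T \<tau> n n' R \<longleftrightarrow>
     prob_space P \<and>
     (\<forall>t<T.
        has_law P (round_clients R t) (uniform_clients n) \<and>
        (\<forall>j. has_law P (gram_clients R t j) (uniform_clients n')) \<and>
        (\<forall>j i. has_law P (gram_sample R t j i) (D i)) \<and>
        (\<forall>j i k. has_law P (gram_seed R t j i k) Z) \<and>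
        (\<forall>i. \<forall>r<\<tau>. has_law P (local_sample R t i r) (D i))) \<and>
     prob_space.indep_sets P (\<lambda>e. sets (generated_algebra P D Z R e)) {e. in_run T \<tau> e}"


subsection \<open>The algorithm\<close>

definition gram_factor ::
  "nat \<Rightarrow> 'c set \<Rightarrow> ('c \<Rightarrow> 'm::finite \<Rightarrow> real^'d) \<Rightarrow> real^'m^'d" where
  "gram_factor n' A msg = (\<chi> a k. (\<Sum>i\<in>A. msg i k $ a) / real n')"

definition weight_step :: "real \<Rightarrow> real^'m^'m \<Rightarrow> real^'m \<Rightarrow> real^'m" where
  "weight_step \<beta> G w = closest_point prob_simplex (w - \<beta> *\<^sub>R (G *v w))"

text \<open>Below, \<open>g r k y\<close> is the stochastic gradient of the \<open>k\<close>-th local objective at \<open>y\<close> in step \<open>r\<close>.\<close>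

primrec local_iter ::
  "real \<Rightarrow> (nat \<Rightarrow> 'm::finite \<Rightarrow> real^'d \<Rightarrow> real^'d) \<Rightarrow> real^'m \<Rightarrow> real^'d \<Rightarrow> nat \<Rightarrow> real^'d"
where
  "local_iter \<eta>l g w x 0 = x"
| "local_iter \<eta>l g w x (Suc r) =
     (let y = local_iter \<eta>l g w x r in y - \<eta>l *\<^sub>R (\<Sum>k\<in>UNIV. w $ k *\<^sub>R g r k y))"

definition local_update ::
  "real \<Rightarrow> nat \<Rightarrow> (nat \<Rightarrow> 'm::finite \<Rightarrow> real^'d \<Rightarrow> real^'d) \<Rightarrow> real^'m \<Rightarrow> real^'d \<Rightarrow> real^'d"
where
  "local_update \<eta>l \<tau> g w x = (1 / (real \<tau> * \<eta>l)) *\<^sub>R (x - local_iter \<eta>l g w x \<tau>)"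

definition fedcmoo_round ::
  "real \<Rightarrow> real \<Rightarrow> real \<Rightarrow> nat \<Rightarrow> nat \<Rightarrow> nat
   \<Rightarrow> ('c \<Rightarrow> 'm::finite \<Rightarrow> 's \<Rightarrow> real^'d \<Rightarrow> real^'d) \<Rightarrow> ('z \<Rightarrow> real^'d \<Rightarrow> real^'d)
   \<Rightarrow> ('w, 'c, 'm, 's, 'z) draws \<Rightarrow> 'w \<Rightarrow> nat \<Rightarrow> (real^'d) \<times> (real^'m) \<Rightarrow> (real^'d) \<times> (real^'m)" where
  "fedcmoo_round \<eta>l \<eta>g \<beta> \<tau> n n' sg Q R \<omega> t = (\<lambda>(x, w).
     let msg = (\<lambda>j i k. Q (gram_seed R t j i k \<omega>) (sg i k (gram_sample R t j i \<omega>) x));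
         Y = (\<lambda>j. gram_factor n' (gram_clients R t j \<omega>) (msg j));
         G = transpose (Y Gram1) ** Y Gram2;
         w' = weight_step \<beta> G w;
         \<Delta> = (\<lambda>i. local_update \<eta>l \<tau> (\<lambda>r k y. sg i k (local_sample R t i r \<omega>) y) w' x)
     in (x - (\<eta>g * \<eta>l * real \<tau>) *\<^sub>R ((1 / real n) *\<^sub>R (\<Sum>i\<in>round_clients R t \<omega>. \<Delta> i)), w'))"

primrec fedcmoo ::
  "real \<Rightarrow> real \<Rightarrow> real \<Rightarrow> nat \<Rightarrow> nat \<Rightarrow> nat
   \<Rightarrow> ('c \<Rightarrow> 'm::finite \<Rightarrow> 's \<Rightarrow> real^'d \<Rightarrow> real^'d) \<Rightarrow> ('z \<Rightarrow> real^'d \<Rightarrow> real^'d)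
   \<Rightarrow> ('w, 'c, 'm, 's, 'z) draws \<Rightarrow> real^'d \<Rightarrow> 'w \<Rightarrow> nat \<Rightarrow> (real^'d) \<times> (real^'m)" where
  "fedcmoo \<eta>l \<eta>g \<beta> \<tau> n n' sg Q R x0 \<omega> 0 = (x0, \<chi> k. 1 / real CARD('m))"
| "fedcmoo \<eta>l \<eta>g \<beta> \<tau> n n' sg Q R x0 \<omega> (Suc t) =
     fedcmoo_round \<eta>l \<eta>g \<beta> \<tau> n n' sg Q R \<omega> t (fedcmoo \<eta>l \<eta>g \<beta> \<tau> n n' sg Q R x0 \<omega> t)"

end

theory Submission
  imports Defs
begin

text \<open>
  Write \<open>w\<^sub>0\<close> for the uniform weights, \<open>F\<close> for the average of the \<open>F\<^sub>k\<close>, and \<open>\<gamma> = \<eta>\<^sub>g \<eta>\<^sub>l \<tau> = 1 / (L \<surd>T)\<close>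
  for the step taken along the averaged client updates. The potential
  \<open>F(x) - avg\<^sub>k inf F\<^sub>k + \<gamma> / (2 \<beta>) \<parallel>w - w\<^sub>0\<parallel>\<^sup>2\<close> drops in expectation by \<open>\<gamma> \<parallel>\<nabla>F(x) w\<parallel>\<^sup>2\<close> in each
  round, up to an error of \<open>\<gamma> O(1 / \<surd>T)\<close>: the descent lemma contributes
  \<open>- \<gamma> \<langle>\<nabla>F(x) w\<^sub>0, \<nabla>F(x) w'\<rangle>\<close> with the updated weights \<open>w'\<close>, which are within \<open>\<beta> \<parallel>G w\<parallel>\<close> of \<open>w\<close>, and
  the projected step on \<open>w\<close> contributes \<open>- \<gamma> \<langle>w - w\<^sub>0, G w\<rangle>\<close>, where the unbiased Gram estimate turns \<open>G\<close>
  into \<open>\<nabla>F(x)\<^sup>\<top> \<nabla>F(x)\<close>. Summing over the rounds gives the bound, since the weights start at \<open>w\<^sub>0\<close>.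

  Each round is analysed at a deterministic \<open>(x, w)\<close>; independence of its draws from the past transfers
  the one-round estimate to the random state.
\<close>

subsection \<open>Independence of families of \<open>\<sigma>\<close>-algebras\<close>

text \<open>The obstacle is that the weights, and with them the scalarised objective that the
  clients decrease, change in every round, so no single objective need decrease along the update.
  The average objective is a fixed reference, but its descent produces an inner product of two
  weighted gradients, whose sign is unknown. The projected step compared with the uniform weights
  produces, in expectation, almost the same inner product with the opposite sign, together with
  minus the square to be bounded. This is why the comparator is the uniform vector and not an
  optimal weight vector. Two errors of order \<beta> survive the cancellation: the lag between the
  old and the new weights, and the quadratic term of the projected step. Each carries a factor M,
  which the choice of \<beta> removes. Expectations of the potential are taken as Lebesgue integrals
  of nonnegative functions. Its integrability along the run then need not be known beforehand, but
  nothing may be subtracted: terms that decrease the potential are kept on the left of the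
  inequalities.\<close>

locale indep_algebras = prob_space M for M :: "'w measure" +
  fixes F :: "'e \<Rightarrow> 'w measure" and I :: "'e set"
  assumes indep: "indep_sets (\<lambda>e. sets (F e)) I"
    and space_F: "\<And>e. space (F e) = space M"
begin

text \<open>Measurability with respect to \<open>alg K\<close> expresses that a quantity depends
  only on the draws labelled by \<open>K\<close>. Past, Gram estimation and local training thereby
  become disjoint sets of labels.\<close>

definition alg :: "'e set \<Rightarrow> 'w measure" where
  "alg K = sigma (space M) (\<Union>e\<in>K. sets (F e))"

lemma space_alg [simp]: "space (alg K) = space M"
  unfolding alg_def using space_F sets.sets_into_space by (intro space_measure_of) fastforce

lemma sets_alg: "sets (alg K) = sigma_sets (space M) (\<Union>e\<in>K. sets (F e))"
  unfolding alg_def using space_F sets.sets_into_space by (intro sets_measure_of) fastforce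

lemma alg_mono: "K \<subseteq> K' \<Longrightarrow> sets (alg K) \<subseteq> sets (alg K')"
  unfolding sets_alg by (intro sigma_sets_mono') auto

lemma sets_F_subset_alg: "e \<in> K \<Longrightarrow> sets (F e) \<subseteq> sets (alg K)"
  unfolding sets_alg by auto

lemma sets_alg_subset: "K \<subseteq> I \<Longrightarrow> sets (alg K) \<subseteq> sets M"
  unfolding sets_alg using indep by (intro sets.sigma_sets_subset) (auto simp: indep_sets_def)

lemma measurable_alg_mono: "X \<in> measurable (alg K) N \<Longrightarrow> K \<subseteq> K' \<Longrightarrow> X \<in> measurable (alg K') N"
  using measurable_mono[OF order_refl refl alg_mono, of K K' N] by auto

lemma measurable_alg_imp: "X \<in> measurable (alg K) N \<Longrightarrow> K \<subseteq> I \<Longrightarrow> X \<in> measurable M N"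
  using measurable_mono[OF order_refl refl sets_alg_subset, of K N] by auto

lemma measurable_F_imp_alg: "X \<in> measurable (F e) N \<Longrightarrow> e \<in> K \<Longrightarrow> X \<in> measurable (alg K) N"
  using measurable_mono[OF order_refl refl sets_F_subset_alg, of e K N] by (auto simp: space_F)

text \<open>Grouping an independent family into disjoint blocks preserves independence when its
  members are stable under intersection, as every \<open>sets (F e)\<close> is. The two blocks are
  indexed by booleans.\<close>

lemma indep_set_alg:
  assumes "K \<inter> K' = {}" "K \<union> K' \<subseteq> I"
  shows "indep_set (sets (alg K)) (sets (alg K'))"
proof -
  have *: "indep_sets (\<lambda>j. sigma_sets (space M) (\<Union>i\<in>case_bool K K' j. sets (F i))) UNIV"
  proof (rule indep_sets_collect_sigma)
    show "indep_sets (\<lambda>i. sets (F i)) (\<Union>j\<in>UNIV. case_bool K K' j)"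
      using assms by (intro indep_sets_mono_index[OF _ indep]) (auto split: bool.splits)
    show "Int_stable (sets (F i))" for i
      by (auto simp: Int_stable_def)
    show "disjoint_family_on (case_bool K K') UNIV"
      using assms by (auto simp: disjoint_family_on_def split: bool.splits)
  qed
  show ?thesis
    unfolding indep_set_def sets_alg
    by (rule indep_sets_mono_sets[OF *]) (auto split: bool.splits)
qed

lemma measurable_id_alg: "K \<subseteq> I \<Longrightarrow> (\<lambda>\<omega>. \<omega>) \<in> measurable M (alg K)"
  by (rule measurable_alg_imp[OF measurable_ident_sets]) auto

lemma vimage_in_alg: "X \<in> measurable (alg K) S \<Longrightarrow> A \<in> sets S \<Longrightarrow> X -` A \<inter> space M \<in> sets (alg K)"
  using measurable_sets[of X "alg K" S A] by simp

lemma indep_var_alg: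
  assumes K: "K \<inter> K' = {}" "K \<union> K' \<subseteq> I"
    and X: "X \<in> measurable (alg K) S" and Y: "Y \<in> measurable (alg K') S'"
  shows "indep_var S X S' Y"
proof -
  have *: "sigma_sets (space M) {X -` A \<inter> space M |A. A \<in> sets S} \<subseteq> sets (alg K)"
    using sets.sigma_sets_subset[of "{X -` A \<inter> space M |A. A \<in> sets S}" "alg K"] vimage_in_alg[OF X]
    by auto
  have **: "sigma_sets (space M) {Y -` A \<inter> space M |A. A \<in> sets S'} \<subseteq> sets (alg K')"
    using sets.sigma_sets_subset[of "{Y -` A \<inter> space M |A. A \<in> sets S'}" "alg K'"] vimage_in_alg[OF Y]
    by auto
  have "indep_set (sigma_sets (space M) {X -` A \<inter> space M |A. A \<in> sets S})
      (sigma_sets (space M) {Y -` A \<inter> space M |A. A \<in> sets S'})"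
    using indep_setD[OF indep_set_alg[OF K] subsetD[OF *] subsetD[OF **]]
      sets_alg_subset[of K] sets_alg_subset[of K'] * ** K
    unfolding indep_sets2_eq by (meson le_sup_iff subset_trans)
  then show ?thesis
    unfolding indep_var_eq using measurable_alg_imp[OF X] measurable_alg_imp[OF Y] K by simp
qed

text \<open>
  Independence of \<^term>\<open>X\<close> from the whole \<open>\<sigma>\<close>-algebra of the remaining draws, with the identity as
  the second variable, so that those draws need not be packed into one type.
\<close>

lemma distr_alg_pair:
  assumes K: "K \<inter> K' = {}" "K \<union> K' \<subseteq> I" and X: "X \<in> measurable (alg K) S"
  shows "distr M S X \<Otimes>\<^sub>M distr M (alg K') (\<lambda>\<omega>. \<omega>) = distr M (S \<Otimes>\<^sub>M alg K') (\<lambda>\<omega>. (X \<omega>, \<omega>))"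
proof (rule pair_measure_eqI)
  have X' [measurable]: "X \<in> measurable M S" and id [measurable]: "(\<lambda>\<omega>. \<omega>) \<in> measurable M (alg K')"
    using K X measurable_alg_imp measurable_id_alg by auto
  interpret H: prob_space "distr M (alg K') (\<lambda>\<omega>. \<omega>)"
    by (rule prob_space_distr) (rule id)
  interpret X: prob_space "distr M S X"
    by (rule prob_space_distr) (rule X')
  show "sigma_finite_measure (distr M S X)" "sigma_finite_measure (distr M (alg K') (\<lambda>\<omega>. \<omega>))" ..
  show "sets (distr M S X \<Otimes>\<^sub>M distr M (alg K') (\<lambda>\<omega>. \<omega>))
      = sets (distr M (S \<Otimes>\<^sub>M alg K') (\<lambda>\<omega>. (X \<omega>, \<omega>)))"
    using sets_pair_measure_cong[of "distr M S X" S "distr M (alg K') (\<lambda>\<omega>. \<omega>)" "alg K'"] by simp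
  fix A B assume "A \<in> sets (distr M S X)" "B \<in> sets (distr M (alg K') (\<lambda>\<omega>. \<omega>))"
  then have A [measurable]: "A \<in> sets S" and B [measurable]: "B \<in> sets (alg K')" by auto
  have BM: "B \<in> events" using B K sets_alg_subset by blast
  have B': "B \<inter> space M = B" using sets.sets_into_space[OF B] by auto
  have "emeasure (distr M S X) A * emeasure (distr M (alg K') (\<lambda>\<omega>. \<omega>)) B
      = ennreal (prob (X -` A \<inter> space M) * prob B)"
    using B' by (simp add: emeasure_distr emeasure_eq_measure ennreal_mult)
  also have "prob (X -` A \<inter> space M) * prob B = prob ((X -` A \<inter> space M) \<inter> B)"
    using indep_setD[OF indep_set_alg[OF K] vimage_in_alg[OF X A] B] by simp
  also have "ennreal (prob ((X -` A \<inter> space M) \<inter> B))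
      = emeasure (distr M (S \<Otimes>\<^sub>M alg K') (\<lambda>\<omega>. (X \<omega>, \<omega>))) (A \<times> B)"
    by (subst emeasure_distr)
       (auto simp: emeasure_eq_measure[symmetric] intro!: arg_cong[where f = "emeasure M"])
  finally show "emeasure (distr M S X) A * emeasure (distr M (alg K') (\<lambda>\<omega>. \<omega>)) B
      = emeasure (distr M (S \<Otimes>\<^sub>M alg K') (\<lambda>\<omega>. (X \<omega>, \<omega>))) (A \<times> B)" .
qed

text \<open>Fubini for the pair of \<open>X\<close> and the identity, whose joint law is a product.
  It stands in for conditioning on the draws in \<open>K\<close>: the value
  \<open>X \<omega>\<close> is held fixed while the draws in \<open>K'\<close> are integrated out,
  because \<open>h s\<close> sees \<omega> only through \<open>alg K'\<close>.\<close>

lemma nn_integral_freeze: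
  assumes K: "K \<inter> K' = {}" "K \<union> K' \<subseteq> I" and X: "X \<in> measurable (alg K) S"
    and h: "(\<lambda>(s, \<omega>). h s \<omega>) \<in> borel_measurable (S \<Otimes>\<^sub>M alg K')"
  shows "(\<integral>\<^sup>+\<omega>. h (X \<omega>) \<omega> \<partial>M) = (\<integral>\<^sup>+\<omega>. (\<integral>\<^sup>+\<omega>'. h (X \<omega>) \<omega>' \<partial>M) \<partial>M)"
proof -
  have X': "X \<in> measurable M S" and id: "(\<lambda>\<omega>. \<omega>) \<in> measurable M (alg K')"
    using K X measurable_alg_imp measurable_id_alg by auto
  note X' [measurable] id [measurable] h [measurable]
  let ?H = "distr M (alg K') (\<lambda>\<omega>. \<omega>)"
  interpret H: prob_space ?H
    by (rule prob_space_distr) (rule id)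
  have "(\<integral>\<^sup>+\<omega>. h (X \<omega>) \<omega> \<partial>M)
      = (\<integral>\<^sup>+p. (\<lambda>(s, \<omega>). h s \<omega>) p \<partial>distr M (S \<Otimes>\<^sub>M alg K') (\<lambda>\<omega>. (X \<omega>, \<omega>)))"
    by (subst nn_integral_distr) auto
  also have "\<dots> = (\<integral>\<^sup>+s. (\<integral>\<^sup>+\<omega>'. h s \<omega>' \<partial>?H) \<partial>distr M S X)"
    unfolding distr_alg_pair[OF K X, symmetric]
    by (subst H.nn_integral_fst[symmetric]) auto
  also have "\<dots> = (\<integral>\<^sup>+\<omega>. (\<integral>\<^sup>+\<omega>'. h (X \<omega>) \<omega>' \<partial>?H) \<partial>M)"
    by (rule nn_integral_distr[OF X']) measurable
  also have "\<dots> = (\<integral>\<^sup>+\<omega>. (\<integral>\<^sup>+\<omega>'. h (X \<omega>) \<omega>' \<partial>M) \<partial>M)"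
  proof (rule nn_integral_cong)
    fix \<omega> assume "\<omega> \<in> space M"
    then have "X \<omega> \<in> space S" using X' by (rule measurable_space[rotated])
    then show "(\<integral>\<^sup>+\<omega>'. h (X \<omega>) \<omega>' \<partial>?H) = (\<integral>\<^sup>+\<omega>'. h (X \<omega>) \<omega>' \<partial>M)"
      using measurable_Pair2[OF h] by (intro nn_integral_distr[OF id]) simp
  qed
  finally show ?thesis .
qed

text \<open>The counterpart for means, where Fubini asks for integrability of the composed variable;
  it is supplied by a second-moment bound obtained from the nonnegative version or by
  domination.\<close>

lemma integral_freeze:
  fixes h :: "'s \<Rightarrow> 'w \<Rightarrow> 'b :: {banach, second_countable_topology}"
  assumes K: "K \<inter> K' = {}" "K \<union> K' \<subseteq> I" and X: "X \<in> measurable (alg K) S"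
    and h: "(\<lambda>(s, \<omega>). h s \<omega>) \<in> borel_measurable (S \<Otimes>\<^sub>M alg K')"
    and int: "integrable M (\<lambda>\<omega>. h (X \<omega>) \<omega>)"
  shows "(\<integral>\<omega>. h (X \<omega>) \<omega> \<partial>M) = (\<integral>\<omega>. (\<integral>\<omega>'. h (X \<omega>) \<omega>' \<partial>M) \<partial>M)"
proof -
  have X': "X \<in> measurable M S" and id: "(\<lambda>\<omega>. \<omega>) \<in> measurable M (alg K')"
    using K X measurable_alg_imp measurable_id_alg by auto
  note X' [measurable] id [measurable] h [measurable]
  let ?H = "distr M (alg K') (\<lambda>\<omega>. \<omega>)"
  interpret H: prob_space ?H
    by (rule prob_space_distr) (rule id)
  interpret X: prob_space "distr M S X"
    by (rule prob_space_distr) (rule X')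
  interpret XH: pair_prob_space "distr M S X" ?H ..
  have "(\<integral>\<omega>. h (X \<omega>) \<omega> \<partial>M)
      = (\<integral>p. (\<lambda>(s, \<omega>). h s \<omega>) p \<partial>distr M (S \<Otimes>\<^sub>M alg K') (\<lambda>\<omega>. (X \<omega>, \<omega>)))"
    by (subst integral_distr) auto
  also have "\<dots> = (\<integral>s. (\<integral>\<omega>'. h s \<omega>' \<partial>?H) \<partial>distr M S X)"
  proof -
    have "integrable (distr M (S \<Otimes>\<^sub>M alg K') (\<lambda>\<omega>. (X \<omega>, \<omega>))) (\<lambda>(s, \<omega>). h s \<omega>)"
      using int by (subst integrable_distr_eq) auto
    from XH.integral_fst[OF this[folded distr_alg_pair[OF K X]]] show ?thesis
      unfolding distr_alg_pair[OF K X] by simp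
  qed
  also have "\<dots> = (\<integral>\<omega>. (\<integral>\<omega>'. h (X \<omega>) \<omega>' \<partial>?H) \<partial>M)"
    by (rule integral_distr[OF X']) measurable
  also have "\<dots> = (\<integral>\<omega>. (\<integral>\<omega>'. h (X \<omega>) \<omega>' \<partial>M) \<partial>M)"
  proof (rule Bochner_Integration.integral_cong[OF refl])
    fix \<omega> assume "\<omega> \<in> space M"
    then have "X \<omega> \<in> space S" using X' by (rule measurable_space[rotated])
    then show "(\<integral>\<omega>'. h (X \<omega>) \<omega>' \<partial>?H) = (\<integral>\<omega>'. h (X \<omega>) \<omega>' \<partial>M)"
      using measurable_Pair2[OF h] by (intro integral_distr[OF id]) simp
  qed
  finally show ?thesis .
qed

text \<open>Coordinatewise reduction to products of independent real variables.\<close>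

lemma
  fixes X Y :: "'w \<Rightarrow> 'a :: euclidean_space"
  assumes K: "K \<inter> K' = {}" "K \<union> K' \<subseteq> I"
    and X: "X \<in> borel_measurable (alg K)" "integrable M X"
    and Y: "Y \<in> borel_measurable (alg K')" "integrable M Y"
  shows integrable_inner_indep: "integrable M (\<lambda>\<omega>. X \<omega> \<bullet> Y \<omega>)"
    and expectation_inner_indep: "expectation (\<lambda>\<omega>. X \<omega> \<bullet> Y \<omega>) = expectation X \<bullet> expectation Y"
proof -
  note [measurable] = X(1) Y(1)
  have ind: "indep_var borel (\<lambda>\<omega>. X \<omega> \<bullet> b) borel (\<lambda>\<omega>. Y \<omega> \<bullet> b)" for b
    by (rule indep_var_alg[OF K]) measurable
  have *: "(\<lambda>\<omega>. X \<omega> \<bullet> Y \<omega>) = (\<lambda>\<omega>. \<Sum>b\<in>Basis. (X \<omega> \<bullet> b) * (Y \<omega> \<bullet> b))"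
    by (intro ext euclidean_inner)
  show "integrable M (\<lambda>\<omega>. X \<omega> \<bullet> Y \<omega>)"
    unfolding * using X Y by (intro Bochner_Integration.integrable_sum indep_var_integrable[OF ind]) auto
  show "expectation (\<lambda>\<omega>. X \<omega> \<bullet> Y \<omega>) = expectation X \<bullet> expectation Y"
    unfolding * euclidean_inner[of "expectation X" "expectation Y"]
    using X Y indep_var_integrable[OF ind] indep_var_lebesgue_integral[OF ind]
    by (simp add: Bochner_Integration.integral_sum)
qed

end

section \<open>Second moments of random vectors\<close>

lemma (in prob_space)
  fixes X :: "'a \<Rightarrow> 'b :: euclidean_space"
  assumes [measurable]: "X \<in> borel_measurable M"
    and v: "(\<integral>\<^sup>+\<omega>. ennreal ((norm (X \<omega> - c))\<^sup>2) \<partial>M) \<le> ennreal v"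
  shows integrable_sq_norm_diff: "integrable M (\<lambda>\<omega>. (norm (X \<omega> - c))\<^sup>2)"
    and integrable_of_sq_norm: "integrable M X"
proof -
  show sq: "integrable M (\<lambda>\<omega>. (norm (X \<omega> - c))\<^sup>2)"
    using v by (intro integrableI_bounded) (auto intro: le_less_trans)
  have "integrable M (\<lambda>\<omega>. X \<omega> - c)"
  proof (rule Bochner_Integration.integrable_bound)
    show "integrable M (\<lambda>\<omega>. 1 + (norm (X \<omega> - c))\<^sup>2)"
      using sq by simp
    \<comment> \<open>On a probability space \<open>1 + t^2\<close> is an integrable majorant of
      \<open>t\<close> once the square is integrable.\<close>
    have "x \<le> 1 + x\<^sup>2" if "x \<ge> 0" for x :: real
      using sum_squares_bound[of 1 x] that by simp
    then show "AE \<omega> in M. norm (X \<omega> - c) \<le> norm (1 + (norm (X \<omega> - c))\<^sup>2)"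
      by (intro AE_I2) simp
  qed auto
  then have "integrable M (\<lambda>\<omega>. (X \<omega> - c) + c)"
    by (intro Bochner_Integration.integrable_add) auto
  then show "integrable M X" by simp
qed

text \<open>Bias-variance decomposition: the cross term vanishes because \<open>m\<close> is the
  mean. The centre \<open>c\<close> is arbitrary so that it can be a frozen function of earlier
  draws, which turns the lemma into orthogonality of a fresh error to the past.\<close>

lemma (in prob_space) second_moment_shift:
  fixes X :: "'a \<Rightarrow> 'b :: euclidean_space"
  assumes X: "integrable M X" "expectation X = m" and "v \<ge> 0"
    and v: "(\<integral>\<^sup>+\<omega>. ennreal ((norm (X \<omega> - m))\<^sup>2) \<partial>M) \<le> ennreal v"
  shows "(\<integral>\<^sup>+\<omega>. ennreal ((norm (X \<omega> - c))\<^sup>2) \<partial>M) \<le> ennreal (v + (norm (m - c))\<^sup>2)"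
proof -
  have sq: "integrable M (\<lambda>\<omega>. (norm (X \<omega> - m))\<^sup>2)"
    using X v by (intro integrable_sq_norm_diff) auto
  have sq_eq: "(norm (x - c))\<^sup>2 = (norm (x - m))\<^sup>2 + (2 * ((x - m) \<bullet> (m - c)) + (norm (m - c))\<^sup>2)" for x
    using dot_norm[of "x - m" "m - c"] by (simp add: field_simps)
  have eq: "(\<lambda>\<omega>. (norm (X \<omega> - c))\<^sup>2)
    = (\<lambda>\<omega>. (norm (X \<omega> - m))\<^sup>2 + (2 * ((X \<omega> - m) \<bullet> (m - c)) + (norm (m - c))\<^sup>2))"
    by (rule ext) (rule sq_eq)
  have int: "integrable M (\<lambda>\<omega>. (norm (X \<omega> - c))\<^sup>2)"
    unfolding eq using sq X by auto
  have "(\<integral>\<^sup>+\<omega>. ennreal ((norm (X \<omega> - m))\<^sup>2) \<partial>M) = ennreal (expectation (\<lambda>\<omega>. (norm (X \<omega> - m))\<^sup>2))"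
    using sq by (intro nn_integral_eq_integral) auto
  then have "expectation (\<lambda>\<omega>. (norm (X \<omega> - m))\<^sup>2) \<le> v"
    using v \<open>v \<ge> 0\<close> by simp
  moreover have "expectation (\<lambda>\<omega>. (X \<omega> - m) \<bullet> (m - c)) = 0"
    using X by (subst integral_inner_left) (auto simp: prob_space)
  ultimately have "expectation (\<lambda>\<omega>. (norm (X \<omega> - c))\<^sup>2) \<le> v + (norm (m - c))\<^sup>2"
    unfolding eq using sq X by (simp add: prob_space)
  then show ?thesis
    using int by (subst nn_integral_eq_integral) (auto intro: ennreal_leI)
qed

text \<open>Variances add by induction: the partial sum is frozen and, up to sign, becomes the
  centre around which the second moment of the next summand is taken. No cross terms have to be
  expanded.\<close>

lemma (in indep_algebras) second_moment_sum_indep: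
  fixes V :: "'i \<Rightarrow> 'w \<Rightarrow> 'b :: euclidean_space"
  assumes "finite S"
    and "\<And>i. i \<in> S \<Longrightarrow> V i \<in> borel_measurable (alg (K i))"
    and "\<And>i. i \<in> S \<Longrightarrow> K i \<subseteq> I" and "disjoint_family_on K S"
    and "\<And>i. i \<in> S \<Longrightarrow> expectation (V i) = 0" and "\<And>i. v i \<ge> 0"
    and "\<And>i. i \<in> S \<Longrightarrow> (\<integral>\<^sup>+\<omega>. ennreal ((norm (V i \<omega>))\<^sup>2) \<partial>M) \<le> ennreal (v i)"
  shows "(\<integral>\<^sup>+\<omega>. ennreal ((norm (\<Sum>i\<in>S. V i \<omega>))\<^sup>2) \<partial>M) \<le> ennreal (\<Sum>i\<in>S. v i)"
  using assms
proof (induction S rule: finite_induct)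
  case (insert j S)
  let ?K = "\<Union>i\<in>S. K i"
  let ?X = "\<lambda>\<omega>. \<Sum>i\<in>S. V i \<omega>"
  have K: "?K \<inter> K j = {}" "?K \<union> K j \<subseteq> I"
    using insert.prems(2,3) insert.hyps by (auto simp: disjoint_family_on_def)
  have X [measurable]: "?X \<in> borel_measurable (alg ?K)"
    by (intro borel_measurable_sum measurable_alg_mono[OF insert.prems(1)]) auto
  have Vj [measurable]: "V j \<in> borel_measurable (alg (K j))"
    by (rule insert.prems) simp
  have VjM: "V j \<in> borel_measurable M"
    using measurable_alg_imp[OF Vj] K by auto
  have vj: "(\<integral>\<^sup>+\<omega>. ennreal ((norm (V j \<omega> - 0))\<^sup>2) \<partial>M) \<le> ennreal (v j)"
    using insert.prems(6)[of j] by simp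
  have "(\<integral>\<^sup>+\<omega>. ennreal ((norm (\<Sum>i\<in>insert j S. V i \<omega>))\<^sup>2) \<partial>M)
      = (\<integral>\<^sup>+\<omega>. ennreal ((norm (V j \<omega> - (- ?X \<omega>)))\<^sup>2) \<partial>M)"
    using insert.hyps by simp
  also have "\<dots> = (\<integral>\<^sup>+\<omega>. (\<integral>\<^sup>+\<omega>'. ennreal ((norm (V j \<omega>' - (- ?X \<omega>)))\<^sup>2) \<partial>M) \<partial>M)"
    by (rule nn_integral_freeze[OF K X]) measurable
  also have "\<dots> \<le> (\<integral>\<^sup>+\<omega>. ennreal (v j + (norm (0 - (- ?X \<omega>)))\<^sup>2) \<partial>M)"
    using insert.prems(4)[of j] insert.prems(5)[of j] vj integrable_of_sq_norm[OF VjM vj]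
    by (intro nn_integral_mono second_moment_shift) auto
  also have "\<dots> = ennreal (v j) + (\<integral>\<^sup>+\<omega>. ennreal ((norm (?X \<omega>))\<^sup>2) \<partial>M)"
  proof -
    have [measurable]: "?X \<in> borel_measurable M"
      using measurable_alg_imp[OF X] K by auto
    show ?thesis
      using insert.prems(5)[of j] by (simp add: nn_integral_add emeasure_space_1)
  qed
  also have "\<dots> \<le> ennreal (v j) + ennreal (\<Sum>i\<in>S. v i)"
    using insert.prems by (intro add_left_mono insert.IH) (auto simp: disjoint_family_on_def)
  also have "\<dots> = ennreal (\<Sum>i\<in>insert j S. v i)"
    using insert.prems(5) insert.hyps by (simp add: sum_nonneg)
  finally show ?case .
qed simp

subsection \<open>Uniformly random subsets\<close>

text \<open>Deleting \<open>i\<close> matches the sets containing it with the sets of size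
  \<open>n - 1\<close> in the complement of \<open>i\<close>. The multiplied form covers
  \<open>n = 0\<close> and avoids dividing by a cardinality that may vanish.\<close>

lemma card_subsets_containing:
  "real CARD('c::finite) * real (card {S :: 'c set. card S = n \<and> i \<in> S})
    = real n * real (card {S :: 'c set. card S = n})"
proof (cases "n = 0")
  case False
  let ?A = "UNIV - {i}"
  have "bij_betw (insert i) {S. S \<subseteq> ?A \<and> card S = n - 1} {S. card S = n \<and> i \<in> S}"
    using False
    by (intro bij_betwI[where g = "\<lambda>S. S - {i}"]) (auto simp: card_insert_if)
  then have "card {S. card S = n \<and> i \<in> S} = (CARD('c) - 1) choose (n - 1)"
    by (simp add: bij_betw_same_card[symmetric] n_subsets)
  moreover have "card {S :: 'c set. card S = n} = CARD('c) choose n"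
    using n_subsets[of "UNIV :: 'c set" n] by simp
  ultimately show ?thesis
    using times_binomial_minus1_eq[of n "CARD('c)"] False
    by (simp flip: of_nat_mult)
next
  case True
  have "{S :: 'c set. card S = 0 \<and> i \<in> S} = {}" by auto
  then show ?thesis using True by simp
qed

lemma nonempty_subsets_of_card: "n \<le> CARD('c::finite) \<Longrightarrow> {S :: 'c set. card S = n} \<noteq> {}"
  using obtain_subset_with_card_n[of n "UNIV :: 'c set"] by auto

lemma prob_mem_uniform_clients:
  assumes "n \<le> CARD('c::finite)"
  shows "measure (uniform_clients n :: 'c set measure) {S. i \<in> S} = real n / real CARD('c)"
proof -
  have "measure (uniform_clients n :: 'c set measure) {S. i \<in> S}
      = real (card {S :: 'c set. card S = n \<and> i \<in> S}) / real (card {S :: 'c set. card S = n})"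
    unfolding uniform_clients_def using nonempty_subsets_of_card[OF assms]
    by (subst measure_pmf_of_set) (auto simp: Int_def)
  moreover have "real (card {S :: 'c set. card S = n}) \<noteq> 0"
    using nonempty_subsets_of_card[OF assms] by (simp add: card_eq_0_iff)
  then have "real (card {S :: 'c set. card S = n \<and> i \<in> S}) / real (card {S :: 'c set. card S = n})
      = real n / real CARD('c)"
    using card_subsets_containing[of n i] by (subst frac_eq_eq) (auto simp: mult.commute)
  ultimately show ?thesis by simp
qed

lemma AE_card_uniform_clients:
  assumes "n \<le> CARD('c::finite)"
  shows "AE S in (uniform_clients n :: 'c set measure). card S = n"
  unfolding uniform_clients_def using nonempty_subsets_of_card[OF assms]
  by (auto simp: AE_measure_pmf_iff)

context indep_algebras
begin

text \<open>By linearity only the probability \<open>n / N\<close> that a given client is selected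
  enters; the dependence between selections is irrelevant to the mean.\<close>

lemma
  fixes V :: "'c::finite \<Rightarrow> 'w \<Rightarrow> 'b :: euclidean_space"
  assumes n: "1 \<le> n" "n \<le> CARD('c)" and K: "K \<inter> K' = {}" "K \<union> K' \<subseteq> I"
    and A: "A \<in> measurable (alg K) (count_space UNIV)" "distr M (count_space UNIV) A = uniform_clients n"
    and V: "\<And>i. V i \<in> borel_measurable (alg K')" "\<And>i. integrable M (V i)"
  shows integrable_sample_mean: "integrable M (\<lambda>\<omega>. (1 / real n) *\<^sub>R (\<Sum>i\<in>A \<omega>. V i \<omega>))"
    and expectation_sample_mean: "expectation (\<lambda>\<omega>. (1 / real n) *\<^sub>R (\<Sum>i\<in>A \<omega>. V i \<omega>))
        = (1 / real CARD('c)) *\<^sub>R (\<Sum>i\<in>UNIV. expectation (V i))"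
proof -
  have AM [measurable]: "A \<in> measurable M (count_space UNIV)"
    using measurable_alg_imp[OF A(1)] K by auto
  have VM [measurable]: "V i \<in> borel_measurable M" for i
    using measurable_alg_imp[OF V(1)] K by auto
  have mem: "prob {\<omega>\<in>space M. i \<in> A \<omega>} = real n / real CARD('c)" for i
  proof -
    have "measure (distr M (count_space UNIV) A) {S. i \<in> S} = prob (A -` {S. i \<in> S} \<inter> space M)"
      by (rule measure_distr) auto
    then show ?thesis
      using prob_mem_uniform_clients[OF n(2), of i] unfolding A(2)
      by (simp add: vimage_def Int_def conj_commute)
  qed
  have [measurable]: "(\<lambda>\<omega>. \<Sum>i\<in>A \<omega>. V i \<omega>) \<in> borel_measurable M"
    by (rule measurable_compose_countable'[OF _ AM]) auto
  have int: "integrable M (\<lambda>\<omega>. \<Sum>i\<in>A \<omega>. V i \<omega>)"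
  proof (rule Bochner_Integration.integrable_bound)
    show "integrable M (\<lambda>\<omega>. \<Sum>i\<in>UNIV. norm (V i \<omega>))"
      using V by auto
    show "AE \<omega> in M. norm (\<Sum>i\<in>A \<omega>. V i \<omega>) \<le> norm (\<Sum>i\<in>UNIV. norm (V i \<omega>))"
    proof (intro AE_I2)
      fix \<omega>
      have "norm (\<Sum>i\<in>A \<omega>. V i \<omega>) \<le> (\<Sum>i\<in>A \<omega>. norm (V i \<omega>))"
        by (rule norm_sum)
      also have "\<dots> \<le> (\<Sum>i\<in>UNIV. norm (V i \<omega>))"
        by (intro sum_mono2) auto
      finally show "norm (\<Sum>i\<in>A \<omega>. V i \<omega>) \<le> norm (\<Sum>i\<in>UNIV. norm (V i \<omega>))"
        by (simp add: sum_nonneg)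
    qed
  qed measurable
  then show "integrable M (\<lambda>\<omega>. (1 / real n) *\<^sub>R (\<Sum>i\<in>A \<omega>. V i \<omega>))"
    by simp
  have "expectation (\<lambda>\<omega>. \<Sum>i\<in>A \<omega>. V i \<omega>) = (\<integral>\<omega>. (\<integral>\<omega>'. (\<Sum>i\<in>A \<omega>. V i \<omega>') \<partial>M) \<partial>M)"
    using V(1) int
    by (intro integral_freeze[OF K A(1), where h = "\<lambda>S \<omega>. \<Sum>i\<in>S. V i \<omega>"])
       (auto intro!: measurable_pair_measure_countable1)
  \<comment> \<open>The random index set is traded for membership indicators over all clients, whose
    means are the inclusion probabilities.\<close>
  also have "\<dots> = (\<integral>\<omega>. (\<Sum>i\<in>UNIV. indicator {\<omega>\<in>space M. i \<in> A \<omega>} \<omega> *\<^sub>R expectation (V i)) \<partial>M)"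
  proof (rule Bochner_Integration.integral_cong[OF refl])
    fix \<omega> assume "\<omega> \<in> space M"
    have "(\<integral>\<omega>'. (\<Sum>i\<in>A \<omega>. V i \<omega>') \<partial>M) = (\<Sum>i\<in>A \<omega>. expectation (V i))"
      by (intro Bochner_Integration.integral_sum V)
    also have "\<dots> = (\<Sum>i\<in>UNIV. indicator {\<omega>\<in>space M. i \<in> A \<omega>} \<omega> *\<^sub>R expectation (V i))"
      using \<open>\<omega> \<in> space M\<close> by (intro sum.mono_neutral_cong_left) auto
    finally show "(\<integral>\<omega>'. (\<Sum>i\<in>A \<omega>. V i \<omega>') \<partial>M)
      = (\<Sum>i\<in>UNIV. indicator {\<omega>\<in>space M. i \<in> A \<omega>} \<omega> *\<^sub>R expectation (V i))" .
  qed
  also have "\<dots> = (\<Sum>i\<in>UNIV. prob {\<omega>\<in>space M. i \<in> A \<omega>} *\<^sub>R expectation (V i))"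
    by (subst Bochner_Integration.integral_sum)
       (auto intro!: integrable_real_indicator simp: less_top[symmetric])
  finally have "expectation (\<lambda>\<omega>. \<Sum>i\<in>A \<omega>. V i \<omega>)
      = (real n / real CARD('c)) *\<^sub>R (\<Sum>i\<in>UNIV. expectation (V i))"
    by (simp add: mem scaleR_sum_right)
  then show "expectation (\<lambda>\<omega>. (1 / real n) *\<^sub>R (\<Sum>i\<in>A \<omega>. V i \<omega>))
        = (1 / real CARD('c)) *\<^sub>R (\<Sum>i\<in>UNIV. expectation (V i))"
    using n by simp
qed

text \<open>Freezing the selected set leaves a bound over deterministic sets of size
  \<open>n\<close>. As \<open>c\<close> is uniform in the set, averaging over the selection costs
  nothing.\<close>

lemma nn_integral_sample_le:
  fixes h :: "'c::finite set \<Rightarrow> 'w \<Rightarrow> ennreal"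
  assumes n: "n \<le> CARD('c)" and K: "K \<inter> K' = {}" "K \<union> K' \<subseteq> I"
    and A: "A \<in> measurable (alg K) (count_space UNIV)" "distr M (count_space UNIV) A = uniform_clients n"
    and h: "\<And>S. h S \<in> borel_measurable (alg K')"
    and le: "\<And>S. card S = n \<Longrightarrow> (\<integral>\<^sup>+\<omega>. h S \<omega> \<partial>M) \<le> c"
  shows "(\<integral>\<^sup>+\<omega>. h (A \<omega>) \<omega> \<partial>M) \<le> c"
proof -
  have AM: "A \<in> measurable M (count_space UNIV)"
    using measurable_alg_imp[OF A(1)] K by auto
  have "AE S in distr M (count_space UNIV) A. card S = n"
    unfolding A(2) by (rule AE_card_uniform_clients[OF n])
  then have card: "AE \<omega> in M. card (A \<omega>) = n"
    using AM by (subst (asm) AE_distr_iff) auto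
  have "(\<integral>\<^sup>+\<omega>. h (A \<omega>) \<omega> \<partial>M) = (\<integral>\<^sup>+\<omega>. (\<integral>\<^sup>+\<omega>'. h (A \<omega>) \<omega>' \<partial>M) \<partial>M)"
    using h by (intro nn_integral_freeze[OF K A(1)]) (auto intro!: measurable_pair_measure_countable1)
  also have "\<dots> \<le> (\<integral>\<^sup>+\<omega>. c \<partial>M)"
    using card by (intro nn_integral_mono_AE) (auto intro: le)
  also have "\<dots> = c"
    by (simp add: emeasure_space_1)
  finally show ?thesis .
qed

end

subsection \<open>Gradients and smoothness\<close>

lemma gderiv_unique:
  assumes "GDERIV \<phi> x :> g" "GDERIV \<phi> x :> g'"
  shows "g = g'"
proof -
  have "(\<lambda>h. h \<bullet> g) = (\<lambda>h. h \<bullet> g')"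
    using assms unfolding gderiv_def by (rule has_derivative_unique)
  from fun_cong[OF this, of "g - g'"] have "(g - g') \<bullet> (g - g') = 0"
    by (simp add: inner_diff_right)
  then show ?thesis by simp
qed

lemma gderiv_grad:
  fixes \<phi> :: "real^'d \<Rightarrow> real"
  assumes "\<phi> differentiable (at x)"
  shows "GDERIV \<phi> x :> grad \<phi> x"
proof -
  obtain D where D: "(\<phi> has_derivative D) (at x)"
    using assms by (auto simp: differentiable_def)
  interpret D: linear D using has_derivative_linear[OF D] .
  \<comment> \<open>The Riesz representative of the derivative, written out in the standard
    basis.\<close>
  have "D = (\<lambda>h. h \<bullet> (\<Sum>b\<in>Basis. D b *\<^sub>R b))"
  proof
    fix h
    have "D h = D (\<Sum>b\<in>Basis. (h \<bullet> b) *\<^sub>R b)" by (simp add: euclidean_representation)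
    also have "\<dots> = h \<bullet> (\<Sum>b\<in>Basis. D b *\<^sub>R b)"
      by (simp add: D.sum D.scaleR inner_sum_right mult.commute)
    finally show "D h = h \<bullet> (\<Sum>b\<in>Basis. D b *\<^sub>R b)" .
  qed
  then have *: "GDERIV \<phi> x :> (\<Sum>b\<in>Basis. D b *\<^sub>R b)"
    using D by (simp add: gderiv_def)
  then show ?thesis
    unfolding grad_def by (rule theI) (rule gderiv_unique[OF _ *])
qed

lemma grad_eqI:
  fixes \<phi> :: "real^'d \<Rightarrow> real"
  assumes "GDERIV \<phi> x :> g"
  shows "grad \<phi> x = g"
  using gderiv_unique[OF gderiv_grad assms] assms by (auto simp: gderiv_def differentiable_def)

lemma GDERIV_mean:
  assumes "\<And>i. i \<in> S \<Longrightarrow> GDERIV (\<phi> i) x :> g i"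
  shows "GDERIV (\<lambda>x. (\<Sum>i\<in>S. \<phi> i x) / c) x :> (1 / c) *\<^sub>R (\<Sum>i\<in>S. g i)"
proof -
  have "((\<lambda>x. (1 / c) *\<^sub>R (\<Sum>i\<in>S. \<phi> i x)) has_derivative (\<lambda>h. (1 / c) *\<^sub>R (\<Sum>i\<in>S. h \<bullet> g i))) (at x)"
    using assms unfolding gderiv_def by (intro has_derivative_scaleR_right has_derivative_sum)
  then show ?thesis
    by (simp add: gderiv_def inner_sum_right)
qed

text \<open>Up to a constant, \<psi> is the gap between \<phi> and its quadratic upper model along
  the segment from \<open>x\<close> to \<open>y\<close>. The Lipschitz bound makes its derivative
  nonpositive, so monotonicity replaces integrating the gradient.\<close>

lemma smooth_descent:
  fixes \<phi> :: "real^'d \<Rightarrow> real"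
  assumes \<phi>: "\<And>x. GDERIV \<phi> x :> g x" and g: "\<And>x y. norm (g x - g y) \<le> L * norm (x - y)"
  shows "\<phi> y \<le> \<phi> x + g x \<bullet> (y - x) + L / 2 * (norm (y - x))\<^sup>2"
proof -
  define \<psi> where "\<psi> s = \<phi> (x + s *\<^sub>R (y - x)) - s * (g x \<bullet> (y - x)) - L / 2 * s\<^sup>2 * (norm (y - x))\<^sup>2" for s
  have "\<psi> 1 \<le> \<psi> 0"
  proof (rule DERIV_nonpos_imp_nonincreasing[of 0 1 \<psi>])
    fix s :: real assume s: "0 \<le> s"
    let ?D = "g (x + s *\<^sub>R (y - x)) \<bullet> (y - x) - g x \<bullet> (y - x) - L * s * (norm (y - x))\<^sup>2"
    have line: "((\<lambda>s. x + s *\<^sub>R (y - x)) has_derivative (\<lambda>h. h *\<^sub>R (y - x))) (at s)"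
      by (auto intro!: derivative_eq_intros)
    have "((\<lambda>s. \<phi> (x + s *\<^sub>R (y - x))) has_derivative
        (\<lambda>h. (h *\<^sub>R (y - x)) \<bullet> g (x + s *\<^sub>R (y - x)))) (at s)"
      using has_derivative_compose[OF line \<phi>[unfolded gderiv_def]] .
    moreover have "(\<lambda>h. (h *\<^sub>R (y - x)) \<bullet> g (x + s *\<^sub>R (y - x))) = (*) (g (x + s *\<^sub>R (y - x)) \<bullet> (y - x))"
      by (auto simp: inner_commute)
    ultimately have "((\<lambda>s. \<phi> (x + s *\<^sub>R (y - x))) has_real_derivative g (x + s *\<^sub>R (y - x)) \<bullet> (y - x)) (at s)"
      unfolding has_field_derivative_def by simp
    then have deriv: "DERIV \<psi> s :> ?D"
      unfolding \<psi>_def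
    proof (intro DERIV_diff)
      show "((\<lambda>s. s * (g x \<bullet> (y - x))) has_real_derivative g x \<bullet> (y - x)) (at s)"
        by (auto intro!: derivative_eq_intros)
      show "((\<lambda>s. L / 2 * s\<^sup>2 * (norm (y - x))\<^sup>2) has_real_derivative L * s * (norm (y - x))\<^sup>2) (at s)"
        by (auto intro!: derivative_eq_intros)
    qed
    have "(g (x + s *\<^sub>R (y - x)) - g x) \<bullet> (y - x)
        \<le> norm (g (x + s *\<^sub>R (y - x)) - g x) * norm (y - x)"
      by (rule norm_cauchy_schwarz)
    also have "\<dots> \<le> (L * norm (s *\<^sub>R (y - x))) * norm (y - x)"
      using g[of "x + s *\<^sub>R (y - x)" x] by (intro mult_right_mono) auto
    finally have "?D \<le> 0"
      using s by (simp add: inner_diff_left power2_eq_square mult.assoc)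
    with deriv show "\<exists>D. DERIV \<psi> s :> D \<and> D \<le> 0" by blast
  qed simp
  then show ?thesis by (simp add: \<psi>_def)
qed

subsection \<open>The probability simplex\<close>

lemma closed_prob_simplex: "closed (prob_simplex :: (real^'m::finite) set)"
proof -
  have "prob_simplex = (\<Inter>k. {w :: real^'m. 0 \<le> w $ k}) \<inter> {w. (\<Sum>k\<in>UNIV. w $ k) = 1}"
    by (auto simp: prob_simplex_def)
  moreover have "closed ((\<Inter>k. {w :: real^'m. 0 \<le> w $ k}) \<inter> {w. (\<Sum>k\<in>UNIV. w $ k) = 1})"
    by (intro closed_Int closed_INT ballI closed_Collect_le closed_Collect_eq continuous_intros)
  ultimately show ?thesis by simp
qed

lemma convex_prob_simplex: "convex (prob_simplex :: (real^'m::finite) set)"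
  unfolding convex_def prob_simplex_def
  by (auto simp: sum.distrib simp flip: sum_distrib_left)

definition uniform_weights :: "real^'m::finite" where
  "uniform_weights = (\<chi> k. 1 / real CARD('m))"

lemma uniform_weights_in_simplex: "uniform_weights \<in> prob_simplex"
  by (simp add: uniform_weights_def prob_simplex_def)

lemma weight_step_in_simplex: "weight_step \<beta> G w \<in> prob_simplex"
  unfolding weight_step_def using uniform_weights_in_simplex
  by (intro closest_point_in_set closed_prob_simplex) auto

text \<open>The projection onto a closed convex set is 1-Lipschitz, and \<open>u\<close> is its own
  projection.\<close>

lemma norm_weight_step_diff_le:
  assumes "u \<in> prob_simplex"
  shows "norm (weight_step \<beta> G w - u) \<le> norm (w - \<beta> *\<^sub>R (G *v w) - u)"
  using closest_point_lipschitz[OF convex_prob_simplex closed_prob_simplex, of "w - \<beta> *\<^sub>R (G *v w)" u]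
    assms closest_point_self[OF assms]
  unfolding weight_step_def dist_norm by auto

text \<open>The basic inequality of projected gradient descent. Its cross term is the source of
  progress, and the quadratic term is an error of second order in \<beta>.\<close>

lemma norm_weight_step_sq_le:
  assumes "u \<in> prob_simplex"
  shows "(norm (weight_step \<beta> G w - u))\<^sup>2
    \<le> (norm (w - u))\<^sup>2 - 2 * \<beta> * ((w - u) \<bullet> (G *v w)) + \<beta>\<^sup>2 * (norm (G *v w))\<^sup>2"
proof -
  have "(norm (weight_step \<beta> G w - u))\<^sup>2 \<le> (norm ((w - u) - \<beta> *\<^sub>R (G *v w)))\<^sup>2"
    using norm_weight_step_diff_le[OF assms, of \<beta> G w]
    by (intro power_mono) (auto simp: algebra_simps)
  also have "\<dots> = (norm (w - u))\<^sup>2 - 2 * \<beta> * ((w - u) \<bullet> (G *v w)) + \<beta>\<^sup>2 * (norm (G *v w))\<^sup>2"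
    unfolding power2_norm_eq_inner
    by (simp add: inner_diff_left inner_diff_right inner_commute power2_eq_square)
  finally show ?thesis .
qed

lemma norm_weight_step_move_le:
  assumes "w \<in> prob_simplex" "\<beta> \<ge> 0"
  shows "norm (weight_step \<beta> G w - w) \<le> \<beta> * norm (G *v w)"
  using norm_weight_step_diff_le[OF assms(1), of \<beta> G w] assms(2) by simp

lemma borel_measurable_proj_simplex [measurable]:
  "closest_point (prob_simplex :: (real^'m::finite) set) \<in> borel_measurable borel"
  using uniform_weights_in_simplex
  by (intro borel_measurable_continuous_onI continuous_on_closest_point convex_prob_simplex closed_prob_simplex) auto

lemma prob_simplexD:
  assumes "w \<in> prob_simplex"
  shows "0 \<le> w $ k" "(\<Sum>k\<in>UNIV. w $ k) = 1"
  using assms by (auto simp: prob_simplex_def)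

lemma norm_simplex_sum_le:
  fixes v :: "'m::finite \<Rightarrow> 'a :: real_normed_vector"
  assumes w: "w \<in> prob_simplex" and "\<And>k. norm (v k) \<le> b"
  shows "norm (\<Sum>k\<in>UNIV. w $ k *\<^sub>R v k) \<le> b"
proof -
  have "norm (\<Sum>k\<in>UNIV. w $ k *\<^sub>R v k) \<le> (\<Sum>k\<in>UNIV. w $ k * b)"
    using prob_simplexD[OF w] assms(2) by (intro sum_norm_le) (auto intro: mult_left_mono)
  then show ?thesis using prob_simplexD[OF w] by (simp flip: sum_distrib_right)
qed

text \<open>Jensen for the squared norm, via Cauchy-Schwarz with each weight split into two square
  roots.\<close>

lemma norm_simplex_sum_sq_le:
  fixes v :: "'m::finite \<Rightarrow> 'a :: real_normed_vector"
  assumes w: "w \<in> prob_simplex"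
  shows "(norm (\<Sum>k\<in>UNIV. w $ k *\<^sub>R v k))\<^sup>2 \<le> (\<Sum>k\<in>UNIV. w $ k * (norm (v k))\<^sup>2)"
proof -
  have "norm (\<Sum>k\<in>UNIV. w $ k *\<^sub>R v k) \<le> (\<Sum>k\<in>UNIV. sqrt (w $ k) * (sqrt (w $ k) * norm (v k)))"
    using prob_simplexD[OF w] by (intro sum_norm_le) (simp add: mult.assoc[symmetric])
  then have "(norm (\<Sum>k\<in>UNIV. w $ k *\<^sub>R v k))\<^sup>2 \<le> (\<Sum>k\<in>UNIV. sqrt (w $ k) * (sqrt (w $ k) * norm (v k)))\<^sup>2"
    by (intro power_mono) auto
  also have "\<dots> \<le> (\<Sum>k\<in>UNIV. (sqrt (w $ k))\<^sup>2) * (\<Sum>k\<in>UNIV. (sqrt (w $ k) * norm (v k))\<^sup>2)"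
    by (rule Cauchy_Schwarz_ineq_sum)
  also have "\<dots> = (\<Sum>k\<in>UNIV. w $ k * (norm (v k))\<^sup>2)"
    using prob_simplexD[OF w] by (simp add: power_mult_distrib)
  finally show ?thesis .
qed

lemma norm_sq_vec: "(norm (v :: real^'m::finite))\<^sup>2 = (\<Sum>k\<in>UNIV. (v $ k)\<^sup>2)"
  by (simp add: norm_vec_def L2_set_def sum_nonneg)

text \<open>Comparison of the 1-norm and the 2-norm of \<open>u\<close>, at the price of
  \<open>sqrt M\<close>. The norm of the Gram step contributes another \<open>sqrt M\<close>, and
  the two make up the factor M in the lag error.\<close>

lemma norm_vec_sum_le:
  fixes v :: "'m::finite \<Rightarrow> 'a :: real_normed_vector"
  assumes "\<And>k. norm (v k) \<le> b"
  shows "norm (\<Sum>k\<in>UNIV. u $ k *\<^sub>R v k) \<le> b * (sqrt (real CARD('m)) * norm u)"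
proof -
  have b: "0 \<le> b" using assms order_trans norm_ge_zero by blast
  have "norm (\<Sum>k\<in>UNIV. u $ k *\<^sub>R v k) \<le> (\<Sum>k\<in>UNIV. b * (1 * \<bar>u $ k\<bar>))"
    using assms by (intro sum_norm_le) (auto simp: mult.commute intro: mult_right_mono)
  also have "\<dots> = b * (\<Sum>k\<in>UNIV. 1 * \<bar>u $ k\<bar>)"
    by (simp add: sum_distrib_left)
  also have "(\<Sum>k\<in>UNIV. 1 * \<bar>u $ k\<bar>) \<le> sqrt (real CARD('m)) * norm u"
  proof (rule power2_le_imp_le)
    have "(\<Sum>k\<in>UNIV. 1 * \<bar>u $ k\<bar>)\<^sup>2 \<le> (\<Sum>k\<in>(UNIV :: 'm set). 1\<^sup>2) * (\<Sum>k\<in>UNIV. \<bar>u $ k\<bar>\<^sup>2)"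
      by (rule Cauchy_Schwarz_ineq_sum)
    also have "\<dots> = real CARD('m) * (norm u)\<^sup>2"
      by (simp add: norm_sq_vec)
    also have "\<dots> = (sqrt (real CARD('m)) * norm u)\<^sup>2"
      by (simp add: power_mult_distrib)
    finally show "(\<Sum>k\<in>UNIV. 1 * \<bar>u $ k\<bar>)\<^sup>2 \<le> (sqrt (real CARD('m)) * norm u)\<^sup>2" .
  qed simp
  finally show ?thesis using b by (simp add: mult_left_mono)
qed

section \<open>The Gram matrix acting on weights\<close>

definition gram_column :: "nat \<Rightarrow> 'c set \<Rightarrow> ('c \<Rightarrow> 'm \<Rightarrow> real^'d) \<Rightarrow> 'm \<Rightarrow> real^'d" where
  "gram_column n' A msg k = (1 / real n') *\<^sub>R (\<Sum>i\<in>A. msg i k)"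

text \<open>Associativity, applying the second factor to \<open>w\<close> before the transposed
  first one. The matrix itself then disappears from the analysis: each entry pairs a vector from one
  Gram sample with a vector from the other.\<close>

lemma gram_mult_vec:
  fixes msg1 msg2 :: "'c \<Rightarrow> 'm::finite \<Rightarrow> real^'d"
  shows "(transpose (gram_factor n' A1 msg1) ** gram_factor n' A2 msg2) *v w
    = (\<chi> k. gram_column n' A1 msg1 k \<bullet> (\<Sum>l\<in>UNIV. w $ l *\<^sub>R gram_column n' A2 msg2 l))"
proof -
  have nth: "gram_factor n' A msg $ a $ k = gram_column n' A msg k $ a"
    for A a k and msg :: "'c \<Rightarrow> 'm \<Rightarrow> real^'d"
    by (simp add: gram_factor_def gram_column_def)
  have "gram_factor n' A2 msg2 *v w = (\<Sum>l\<in>UNIV. w $ l *\<^sub>R gram_column n' A2 msg2 l)"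
    by (simp add: matrix_vector_mult_def nth vec_eq_iff mult.commute)
  then show ?thesis
    by (simp only: matrix_vector_mul_assoc[symmetric])
       (simp add: matrix_vector_mult_def transpose_def nth inner_vec_def vec_eq_iff)
qed

text \<open>Cauchy-Schwarz in each entry, then Jensen. The right side is arranged as products of a
  quantity from the first factor and one from the second, so that its expectation factorises under
  independence.\<close>

lemma gram_vec_sq_le:
  fixes y1 y2 :: "'m::finite \<Rightarrow> real^'d"
  assumes w: "w \<in> prob_simplex"
  shows "(norm (\<chi> k. y1 k \<bullet> (\<Sum>l\<in>UNIV. w $ l *\<^sub>R y2 l)))\<^sup>2
    \<le> (\<Sum>k\<in>UNIV. \<Sum>l\<in>UNIV. w $ l * ((norm (y1 k))\<^sup>2 * (norm (y2 l))\<^sup>2))"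
proof -
  let ?u = "\<Sum>l\<in>UNIV. w $ l *\<^sub>R y2 l"
  have "(norm (\<chi> k. y1 k \<bullet> ?u))\<^sup>2 = (\<Sum>k\<in>UNIV. (y1 k \<bullet> ?u)\<^sup>2)"
    by (simp only: norm_sq_vec vec_lambda_beta)
  also have "\<dots> \<le> (\<Sum>k\<in>UNIV. (norm (y1 k))\<^sup>2 * (norm ?u)\<^sup>2)"
    by (intro sum_mono) (auto simp: power2_norm_eq_inner Cauchy_Schwarz_ineq)
  also have "\<dots> \<le> (\<Sum>k\<in>UNIV. (norm (y1 k))\<^sup>2 * (\<Sum>l\<in>UNIV. w $ l * (norm (y2 l))\<^sup>2))"
    by (intro sum_mono mult_left_mono norm_simplex_sum_sq_le w) auto
  also have "\<dots> = (\<Sum>k\<in>UNIV. \<Sum>l\<in>UNIV. w $ l * ((norm (y1 k))\<^sup>2 * (norm (y2 l))\<^sup>2))"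
    by (simp add: sum_distrib_left mult.left_commute)
  finally show ?thesis .
qed

subsection \<open>Sample means over random client sets\<close>

text \<open>For a fixed set of \<open>n\<close> clients independence gives the variance
  \<open>v / n\<close>, and the mean of the sum is controlled by \<open>b\<close>. The moment is
  taken about zero, so the variation of the means \<open>m i\<close> between clients is already
  covered by \<open>b^2\<close>.\<close>

lemma (in indep_algebras) second_moment_sample_mean:
  fixes V :: "'c::finite \<Rightarrow> 'w \<Rightarrow> 'b :: euclidean_space"
  assumes n: "1 \<le> n" "n \<le> CARD('c)"
    and K: "K \<inter> (\<Union>i. K' i) = {}" "K \<union> (\<Union>i. K' i) \<subseteq> I" "disjoint_family K'"
    and A: "A \<in> measurable (alg K) (count_space UNIV)" "distr M (count_space UNIV) A = uniform_clients n"
    and V: "\<And>i. V i \<in> borel_measurable (alg (K' i))"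
    and m: "\<And>i. expectation (V i) = m i" "\<And>i. norm (m i) \<le> b"
    and v: "\<And>i. (\<integral>\<^sup>+\<omega>. ennreal ((norm (V i \<omega> - m i))\<^sup>2) \<partial>M) \<le> ennreal v" "v \<ge> 0"
  shows "(\<integral>\<^sup>+\<omega>. ennreal ((norm ((1 / real n) *\<^sub>R (\<Sum>i\<in>A \<omega>. V i \<omega>)))\<^sup>2) \<partial>M) \<le> ennreal (v / real n + b\<^sup>2)"
proof (rule nn_integral_sample_le[OF n(2) K(1,2) A])
  have VK [measurable]: "V i \<in> borel_measurable (alg (\<Union>i. K' i))" for i
    using V by (rule measurable_alg_mono) auto
  have VM [measurable]: "V i \<in> borel_measurable M" for i
    using measurable_alg_imp[OF VK] K by auto
  show "(\<lambda>\<omega>. ennreal ((norm ((1 / real n) *\<^sub>R (\<Sum>i\<in>S. V i \<omega>)))\<^sup>2)) \<in> borel_measurable (alg (\<Union>i. K' i))" for S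
    by measurable
  have int: "integrable M (V i)" for i
    using VM v(1) by (rule integrable_of_sq_norm)
  fix S :: "'c set" assume S: "card S = n"
  let ?X = "\<lambda>\<omega>. (1 / real n) *\<^sub>R (\<Sum>i\<in>S. V i \<omega>)"
  let ?m = "(1 / real n) *\<^sub>R (\<Sum>i\<in>S. m i)"
  have "(\<integral>\<^sup>+\<omega>. ennreal ((norm (?X \<omega> - ?m))\<^sup>2) \<partial>M)
      = (\<integral>\<^sup>+\<omega>. ennreal ((1 / real n)\<^sup>2) * ennreal ((norm (\<Sum>i\<in>S. V i \<omega> - m i))\<^sup>2) \<partial>M)"
  proof (rule nn_integral_cong)
    fix \<omega>
    have "?X \<omega> - ?m = (1 / real n) *\<^sub>R (\<Sum>i\<in>S. V i \<omega> - m i)"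
      by (simp add: sum_subtractf scaleR_diff_right)
    then show "ennreal ((norm (?X \<omega> - ?m))\<^sup>2)
        = ennreal ((1 / real n)\<^sup>2) * ennreal ((norm (\<Sum>i\<in>S. V i \<omega> - m i))\<^sup>2)"
      by (simp only: norm_scaleR power_mult_distrib) (simp add: ennreal_mult)
  qed
  also have "\<dots> = ennreal ((1 / real n)\<^sup>2) * (\<integral>\<^sup>+\<omega>. ennreal ((norm (\<Sum>i\<in>S. V i \<omega> - m i))\<^sup>2) \<partial>M)"
    by (intro nn_integral_cmult) measurable
  also have "\<dots> \<le> ennreal ((1 / real n)\<^sup>2) * ennreal (\<Sum>i\<in>S. v)"
  proof (intro mult_left_mono second_moment_sum_indep[where K = K'])
    show "(\<lambda>\<omega>. V i \<omega> - m i) \<in> borel_measurable (alg (K' i))" for i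
      using V[of i] by measurable
    show "disjoint_family_on K' S"
      using K(3) by (auto simp: disjoint_family_on_def)
    show "expectation (\<lambda>\<omega>. V i \<omega> - m i) = 0" for i
      using int[of i] m(1)[of i] by (simp add: prob_space)
    show "K' i \<subseteq> I" for i
      using K(2) by blast
  qed (use v in auto)
  also have "\<dots> = ennreal (v / real n)"
    using n v(2) S by (simp add: ennreal_mult'[symmetric] power2_eq_square)
  finally have "(\<integral>\<^sup>+\<omega>. ennreal ((norm (?X \<omega> - ?m))\<^sup>2) \<partial>M) \<le> ennreal (v / real n)" .
  moreover have "integrable M ?X" "expectation ?X = ?m"
    using int m(1) by (simp_all add: Bochner_Integration.integral_sum)
  ultimately have "(\<integral>\<^sup>+\<omega>. ennreal ((norm (?X \<omega> - 0))\<^sup>2) \<partial>M) \<le> ennreal (v / real n + (norm (?m - 0))\<^sup>2)"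
    using v(2) by (intro second_moment_shift) auto
  also have "\<dots> \<le> ennreal (v / real n + b\<^sup>2)"
  proof (intro ennreal_leI add_left_mono power_mono)
    have "norm (\<Sum>i\<in>S. m i) \<le> real n * b"
      using sum_norm_le[of S m "\<lambda>_. b"] m(2) S by simp
    then show "norm (?m - 0) \<le> b"
      using n by (simp add: field_simps)
  qed simp
  finally show "(\<integral>\<^sup>+\<omega>. ennreal ((norm (?X \<omega>))\<^sup>2) \<partial>M) \<le> ennreal (v / real n + b\<^sup>2)"
    by simp
qed

section \<open>Integrals of functions of a variable with known law\<close>

lemma
  assumes "has_law P X \<mu>"
  shows has_law_measurable: "X \<in> measurable P \<mu>"
    and nn_integral_has_law: "h \<in> borel_measurable \<mu> \<Longrightarrow> (\<integral>\<^sup>+\<omega>. h (X \<omega>) \<partial>P) = (\<integral>\<^sup>+s. h s \<partial>\<mu>)"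
  using assms nn_integral_distr[of X P \<mu> h] by (auto simp: has_law_def)

lemma
  fixes h :: "_ \<Rightarrow> 'b :: {banach, second_countable_topology}"
  assumes "has_law P X \<mu>" "h \<in> borel_measurable \<mu>"
  shows integrable_has_law: "integrable P (\<lambda>\<omega>. h (X \<omega>)) \<longleftrightarrow> integrable \<mu> h"
    and integral_has_law: "(\<integral>\<omega>. h (X \<omega>) \<partial>P) = (\<integral>s. h s \<partial>\<mu>)"
  using assms integrable_distr_eq[of X P \<mu> h] integral_distr[of X P \<mu> h] by (auto simp: has_law_def)

lemma has_law_uniform_clients:
  assumes "has_law P A (uniform_clients n)"
  shows "distr P (count_space UNIV) A = uniform_clients n"
proof -
  have "distr P (count_space UNIV) A = distr P (uniform_clients n) A"
    by (rule distr_cong) (auto simp: uniform_clients_def)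
  then show ?thesis using assms by (simp add: has_law_def)
qed

subsection \<open>The draws of a run and the stochastic oracles\<close>

text \<open>The step sizes are not fixed here: the one-round estimates hold for all positive values,
  and the particular choices enter only at the end.\<close>

locale fedcmoo_run =
  fixes f :: "'c::finite \<Rightarrow> 'm::finite \<Rightarrow> real^'d \<Rightarrow> real"
    and L B q \<sigma> :: real
    and T \<tau> n n' :: nat
    and P :: "'w measure" and D :: "'c \<Rightarrow> 's measure" and Z :: "'z measure"
    and sg :: "'c \<Rightarrow> 'm \<Rightarrow> 's \<Rightarrow> real^'d \<Rightarrow> real^'d" and Q :: "'z \<Rightarrow> real^'d \<Rightarrow> real^'d"
    and R :: "('w, 'c, 'm, 's, 'z) draws"
  assumes L_pos: "L > 0" and B_pos: "B > 0" and q_pos: "q > 0"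
    and \<tau>_pos: "\<tau> \<ge> 1"
    and n: "1 \<le> n" "n \<le> CARD('c)"
    and n': "1 \<le> n'" "n' \<le> CARD('c)"
    and differentiable: "\<And>i k x. f i k differentiable (at x)"
    and bounded_below: "\<And>k. bdd_below (range (avg_obj f k))"
    and A1: "\<And>i k x x'. norm (grad (f i k) x - grad (f i k) x') \<le> L * norm (x - x')"
    and A2: "stochastic_gradients D sg f \<sigma>"
    and A4: "\<And>i k x. norm (grad (f i k) x) \<le> B"
    and A5: "compressor Z Q q"
    and draws: "run_draws P D Z T \<tau> n n' R"

sublocale fedcmoo_run \<subseteq> indep_algebras P "generated_algebra P D Z R" "{e. in_run T \<tau> e}"
proof -
  interpret prob_space P using draws by (simp add: run_draws_def)
  show "indep_algebras P (generated_algebra P D Z R) {e. in_run T \<tau> e}"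
  proof
    show "indep_sets (\<lambda>e. sets (generated_algebra P D Z R e)) {e. in_run T \<tau> e}"
      using draws by (simp add: run_draws_def)
    show "space (generated_algebra P D Z R e) = space P" for e
      by (cases e) auto
  qed
qed

context fedcmoo_run
begin

lemma
  assumes "t < T"
  shows round_clients_law: "has_law P (round_clients R t) (uniform_clients n)"
    and gram_clients_law: "has_law P (gram_clients R t j) (uniform_clients n')"
    and gram_sample_law: "has_law P (gram_sample R t j i) (D i)"
    and gram_seed_law: "has_law P (gram_seed R t j i k) Z"
    and local_sample_law: "r < \<tau> \<Longrightarrow> has_law P (local_sample R t i r) (D i)"
  using draws assms by (auto simp: run_draws_def)

lemma measurable_draw:
  "X \<in> space P \<rightarrow> space N \<Longrightarrow> generated_algebra P D Z R e = vimage_algebra (space P) X N \<Longrightarrow> e \<in> K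
    \<Longrightarrow> X \<in> measurable (alg K) N"
  by (rule measurable_F_imp_alg[of X e]) (auto intro: measurable_vimage_algebra1)

lemma round_clients_measurable:
  "Round_Clients t \<in> K \<Longrightarrow> round_clients R t \<in> measurable (alg K) (count_space UNIV)"
  by (rule measurable_draw[where e = "Round_Clients t"]) auto

lemma gram_clients_measurable:
  "Gram_Clients t j \<in> K \<Longrightarrow> gram_clients R t j \<in> measurable (alg K) (count_space UNIV)"
  by (rule measurable_draw[where e = "Gram_Clients t j"]) auto

lemma gram_sample_measurable:
  "t < T \<Longrightarrow> Gram_Sample t j i \<in> K \<Longrightarrow> gram_sample R t j i \<in> measurable (alg K) (D i)"
  using has_law_measurable[OF gram_sample_law, of t j i]
  by (intro measurable_draw[where e = "Gram_Sample t j i"]) (auto dest: measurable_space)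

lemma gram_seed_measurable:
  "t < T \<Longrightarrow> Gram_Seed t j i k \<in> K \<Longrightarrow> gram_seed R t j i k \<in> measurable (alg K) Z"
  using has_law_measurable[OF gram_seed_law, of t j i k]
  by (intro measurable_draw[where e = "Gram_Seed t j i k"]) (auto dest: measurable_space)

lemma local_sample_measurable:
  "t < T \<Longrightarrow> r < \<tau> \<Longrightarrow> Local_Sample t i r \<in> K \<Longrightarrow> local_sample R t i r \<in> measurable (alg K) (D i)"
  using has_law_measurable[OF local_sample_law, of t r i]
  by (intro measurable_draw[where e = "Local_Sample t i r"]) (auto dest: measurable_space)

lemma grad_measurable [measurable]: "grad (f i k) \<in> borel_measurable borel"
proof (intro borel_measurable_continuous_onI)
  have "L-lipschitz_on UNIV (grad (f i k))"
    using A1 L_pos by (intro lipschitz_onI) (auto simp: dist_norm)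
  then show "continuous_on UNIV (grad (f i k))"
    by (rule lipschitz_on_continuous_on)
qed

lemma sg_measurable:
  assumes "S \<in> measurable N (D i)" "X \<in> borel_measurable N"
  shows "(\<lambda>a. sg i k (S a) (X a)) \<in> borel_measurable N"
proof -
  have "(\<lambda>(s, x). sg i k s x) \<in> borel_measurable (D i \<Otimes>\<^sub>M borel)"
    using A2 by (simp add: stochastic_gradients_def)
  from measurable_compose[OF measurable_Pair[OF assms] this] show ?thesis by simp
qed

lemma Q_measurable:
  assumes "S \<in> measurable N Z" "X \<in> borel_measurable N"
  shows "(\<lambda>a. Q (S a) (X a)) \<in> borel_measurable N"
proof -
  have "(\<lambda>(s, x). Q s x) \<in> borel_measurable (Z \<Otimes>\<^sub>M borel)"
    using A5 by (simp add: compressor_def)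
  from measurable_compose[OF measurable_Pair[OF assms] this] show ?thesis by simp
qed

lemma
  assumes S: "has_law P S (D i)"
  shows sg_integrable: "integrable P (\<lambda>\<omega>. sg i k (S \<omega>) x)"
    and sg_expectation: "expectation (\<lambda>\<omega>. sg i k (S \<omega>) x) = grad (f i k) x"
    and sg_variance: "(\<integral>\<^sup>+\<omega>. ennreal ((norm (sg i k (S \<omega>) x - grad (f i k) x))\<^sup>2) \<partial>P) \<le> ennreal (\<sigma>\<^sup>2)"
proof -
  have [measurable]: "(\<lambda>s. sg i k s x) \<in> borel_measurable (D i)"
    by (rule sg_measurable) auto
  show "integrable P (\<lambda>\<omega>. sg i k (S \<omega>) x)"
    by (subst integrable_has_law[OF S]) (use A2 in \<open>auto simp: stochastic_gradients_def\<close>)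
  show "expectation (\<lambda>\<omega>. sg i k (S \<omega>) x) = grad (f i k) x"
    by (subst integral_has_law[OF S]) (use A2 in \<open>auto simp: stochastic_gradients_def\<close>)
  show "(\<integral>\<^sup>+\<omega>. ennreal ((norm (sg i k (S \<omega>) x - grad (f i k) x))\<^sup>2) \<partial>P) \<le> ennreal (\<sigma>\<^sup>2)"
    by (subst nn_integral_has_law[OF S]) (use A2 in \<open>auto simp: stochastic_gradients_def\<close>)
qed

lemma
  assumes S: "has_law P S Z"
  shows Q_integrable: "integrable P (\<lambda>\<omega>. Q (S \<omega>) x)"
    and Q_expectation: "expectation (\<lambda>\<omega>. Q (S \<omega>) x) = x"
    and Q_variance: "(\<integral>\<^sup>+\<omega>. ennreal ((norm (Q (S \<omega>) x - x))\<^sup>2) \<partial>P) \<le> ennreal (q * (norm x)\<^sup>2)"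
proof -
  have [measurable]: "(\<lambda>s. Q s x) \<in> borel_measurable Z"
    by (rule Q_measurable) auto
  show "integrable P (\<lambda>\<omega>. Q (S \<omega>) x)"
    by (subst integrable_has_law[OF S]) (use A5 in \<open>auto simp: compressor_def\<close>)
  show "expectation (\<lambda>\<omega>. Q (S \<omega>) x) = x"
    by (subst integral_has_law[OF S]) (use A5 in \<open>auto simp: compressor_def\<close>)
  show "(\<integral>\<^sup>+\<omega>. ennreal ((norm (Q (S \<omega>) x - x))\<^sup>2) \<partial>P) \<le> ennreal (q * (norm x)\<^sup>2)"
    by (subst nn_integral_has_law[OF S]) (use A5 in \<open>auto simp: compressor_def\<close>)
qed

lemma GDERIV_avg_obj: "GDERIV (avg_obj f k) x :> (1 / real CARD('c)) *\<^sub>R (\<Sum>i\<in>UNIV. grad (f i k) x)"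
proof -
  have "avg_obj f k = (\<lambda>x. (\<Sum>i\<in>UNIV. f i k x) / real CARD('c))"
    by (simp add: avg_obj_def fun_eq_iff)
  then show ?thesis
    using GDERIV_mean[where S = UNIV and \<phi> = "\<lambda>i. f i k", OF gderiv_grad[OF differentiable]] by simp
qed

lemma grad_avg_obj: "grad (avg_obj f k) x = (1 / real CARD('c)) *\<^sub>R (\<Sum>i\<in>UNIV. grad (f i k) x)"
  by (rule grad_eqI) (rule GDERIV_avg_obj)

lemma norm_grad_avg_le: "norm (grad (avg_obj f k) x) \<le> B"
proof -
  have "norm (\<Sum>i\<in>UNIV. grad (f i k) x) \<le> real CARD('c) * B"
    using sum_norm_le[of UNIV "\<lambda>i. grad (f i k) x" "\<lambda>_. B"] A4 by simp
  then show ?thesis by (simp add: grad_avg_obj field_simps)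
qed

lemma grad_avg_measurable [measurable]: "grad (avg_obj f k) \<in> borel_measurable borel"
  by (subst grad_avg_obj[abs_def]) measurable

subsection \<open>The Gram estimator at a fixed point\<close>

definition msg :: "nat \<Rightarrow> gram_set \<Rightarrow> real^'d \<Rightarrow> 'w \<Rightarrow> 'c \<Rightarrow> 'm \<Rightarrow> real^'d" where
  "msg t j x \<omega> i k = Q (gram_seed R t j i k \<omega>) (sg i k (gram_sample R t j i \<omega>) x)"

definition col :: "nat \<Rightarrow> gram_set \<Rightarrow> 'm \<Rightarrow> real^'d \<Rightarrow> 'w \<Rightarrow> real^'d" where
  "col t j k x \<omega> = gram_column n' (gram_clients R t j \<omega>) (msg t j x \<omega>) k"

definition gram_vec :: "nat \<Rightarrow> real^'d \<Rightarrow> real^'m \<Rightarrow> 'w \<Rightarrow> real^'m" where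
  "gram_vec t x w \<omega> = (\<chi> k. col t Gram1 k x \<omega> \<bullet> (\<Sum>l\<in>UNIV. w $ l *\<^sub>R col t Gram2 l x \<omega>))"

definition msg_draws :: "nat \<Rightarrow> gram_set \<Rightarrow> 'm \<Rightarrow> 'c \<Rightarrow> ('c, 'm) draw set" where
  "msg_draws t j k i = {Gram_Sample t j i, Gram_Seed t j i k}"

definition gram_draws :: "nat \<Rightarrow> gram_set \<Rightarrow> ('c, 'm) draw set" where
  "gram_draws t j = insert (Gram_Clients t j) (\<Union>k i. msg_draws t j k i)"

text \<open>\<open>N\<close> and \<open>U\<close> are arbitrary so that one statement serves two
  purposes: with \<open>U\<close> the identity it is measurability in the draws alone, and with
  \<open>U\<close> the second projection of a product it is the joint measurability in state and
  draws that freezing requires. The later measurability lemmas have the same shape.\<close>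

lemma msg_measurable:
  assumes t: "t < T" and X: "X \<in> borel_measurable N" and U: "U \<in> measurable N (alg K)"
    and K: "msg_draws t j k i \<subseteq> K"
  shows "(\<lambda>a. msg t j (X a) (U a) i k) \<in> borel_measurable N"
  unfolding msg_def using K
  by (intro Q_measurable sg_measurable X measurable_compose[OF U] gram_seed_measurable
      gram_sample_measurable t) (auto simp: msg_draws_def)

text \<open>The sample is frozen first. Compression is unbiased, so its error
  \<open>q * norm^2\<close> adds to the squared sampling error. The second moment of the
  uncompressed gradient is at most \<open>\<sigma>^2 + B^2\<close>, which gives
  \<open>q * (\<sigma>^2 + B^2) + \<sigma>^2\<close>.\<close>

lemma
  assumes t: "t < T"
  shows msg_integrable: "integrable P (\<lambda>\<omega>. msg t j x \<omega> i k)"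
    and msg_expectation: "expectation (\<lambda>\<omega>. msg t j x \<omega> i k) = grad (f i k) x"
    and msg_variance: "(\<integral>\<^sup>+\<omega>. ennreal ((norm (msg t j x \<omega> i k - grad (f i k) x))\<^sup>2) \<partial>P)
      \<le> ennreal ((q + 1) * \<sigma>\<^sup>2 + q * B\<^sup>2)"
proof -
  let ?g = "grad (f i k) x"
  let ?Y = "\<lambda>\<omega>. sg i k (gram_sample R t j i \<omega>) x"
  let ?K = "{Gram_Sample t j i} :: ('c, 'm) draw set" and ?K' = "{Gram_Seed t j i k} :: ('c, 'm) draw set"
  have K: "?K \<inter> ?K' = {}" "?K \<union> ?K' \<subseteq> {e. in_run T \<tau> e}" using t by auto
  have Y: "?Y \<in> borel_measurable (alg ?K)"
    by (intro sg_measurable gram_sample_measurable t) auto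
  have YM [measurable]: "?Y \<in> borel_measurable P"
    using measurable_alg_imp[OF Y] K by auto
  have msgM [measurable]: "(\<lambda>\<omega>. msg t j x \<omega> i k) \<in> borel_measurable P"
    using K by (intro measurable_alg_imp[where K = "?K \<union> ?K'"] msg_measurable[where K = "?K \<union> ?K'"] t)
      (auto simp: msg_draws_def)
  have QM [measurable]: "(\<lambda>(y, \<omega>). Q (gram_seed R t j i k \<omega>) y) \<in> borel_measurable (borel \<Otimes>\<^sub>M alg ?K')"
    using gram_seed_measurable[of t j i k ?K'] t
    unfolding case_prod_beta' by (intro Q_measurable) auto
  have QM' [measurable]: "(\<lambda>\<omega>. Q (gram_seed R t j i k \<omega>) y) \<in> borel_measurable P" for y
    by (intro Q_measurable has_law_measurable[OF gram_seed_law] t) auto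
  note seed = gram_seed_law[OF t] and smp = gram_sample_law[OF t]
  have "(\<integral>\<^sup>+\<omega>. ennreal ((norm (msg t j x \<omega> i k - ?g))\<^sup>2) \<partial>P)
      = (\<integral>\<^sup>+\<omega>. (\<integral>\<^sup>+\<omega>'. ennreal ((norm (Q (gram_seed R t j i k \<omega>') (?Y \<omega>) - ?g))\<^sup>2) \<partial>P) \<partial>P)"
    unfolding msg_def
    by (rule nn_integral_freeze[OF K Y, where h = "\<lambda>y \<omega>. ennreal ((norm (Q (gram_seed R t j i k \<omega>) y - ?g))\<^sup>2)"])
      measurable
  also have "\<dots> \<le> (\<integral>\<^sup>+\<omega>. ennreal (q * (norm (?Y \<omega>))\<^sup>2 + (norm (?Y \<omega> - ?g))\<^sup>2) \<partial>P)"
    using q_pos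
    by (intro nn_integral_mono second_moment_shift Q_integrable[OF seed] Q_expectation[OF seed]
        Q_variance[OF seed]) auto
  also have "\<dots> = ennreal q * (\<integral>\<^sup>+\<omega>. ennreal ((norm (?Y \<omega> - 0))\<^sup>2) \<partial>P)
      + (\<integral>\<^sup>+\<omega>. ennreal ((norm (?Y \<omega> - ?g))\<^sup>2) \<partial>P)"
    using q_pos by (simp add: nn_integral_add nn_integral_cmult ennreal_mult')
  also have "\<dots> \<le> ennreal q * ennreal (\<sigma>\<^sup>2 + (norm (?g - 0))\<^sup>2) + ennreal (\<sigma>\<^sup>2)"
    by (intro add_mono mult_left_mono second_moment_shift sg_integrable[OF smp] sg_expectation[OF smp]
        sg_variance[OF smp]) auto
  also have "\<dots> \<le> ennreal q * ennreal (\<sigma>\<^sup>2 + B\<^sup>2) + ennreal (\<sigma>\<^sup>2)"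
    using A4 by (intro add_mono mult_left_mono ennreal_leI power_mono order_refl) auto
  also have "\<dots> = ennreal ((q + 1) * \<sigma>\<^sup>2 + q * B\<^sup>2)"
    using q_pos by (simp add: ennreal_mult'[symmetric] ennreal_plus[symmetric] field_simps del: ennreal_plus)
  finally show var: "(\<integral>\<^sup>+\<omega>. ennreal ((norm (msg t j x \<omega> i k - ?g))\<^sup>2) \<partial>P)
      \<le> ennreal ((q + 1) * \<sigma>\<^sup>2 + q * B\<^sup>2)" .
  show int: "integrable P (\<lambda>\<omega>. msg t j x \<omega> i k)"
    using msgM var by (rule integrable_of_sq_norm)
  have "expectation (\<lambda>\<omega>. msg t j x \<omega> i k) = (\<integral>\<omega>. (\<integral>\<omega>'. Q (gram_seed R t j i k \<omega>') (?Y \<omega>) \<partial>P) \<partial>P)"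
    using int unfolding msg_def
    by (intro integral_freeze[OF K Y, where h = "\<lambda>y \<omega>. Q (gram_seed R t j i k \<omega>) y"] QM)
  also have "\<dots> = ?g"
    by (simp add: Q_expectation[OF seed] sg_expectation[OF smp])
  finally show "expectation (\<lambda>\<omega>. msg t j x \<omega> i k) = ?g" .
qed

text \<open>Bounds the second moment of one estimated column: the variance of a message divided by
  \<open>n'\<close>, plus \<open>B^2\<close> for the means. The constant \<open>C1\<close> dominates
  it.\<close>

definition gram_bound :: real where
  "gram_bound = ((q + 1) * \<sigma>\<^sup>2 + q * B\<^sup>2) / real n' + B\<^sup>2"

lemma gram_bound_nonneg: "gram_bound \<ge> 0"
  using q_pos by (simp add: gram_bound_def)

lemma B_sq_le_gram_bound: "B\<^sup>2 \<le> gram_bound"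
  using q_pos by (simp add: gram_bound_def)

lemma col_measurable:
  assumes t: "t < T" and X: "X \<in> borel_measurable N" and U: "U \<in> measurable N (alg K)"
    and K: "gram_draws t j \<subseteq> K"
  shows "(\<lambda>a. col t j k (X a) (U a)) \<in> borel_measurable N"
proof -
  have A: "(\<lambda>a. gram_clients R t j (U a)) \<in> measurable N (count_space UNIV)"
    using K by (intro measurable_compose[OF U] gram_clients_measurable) (auto simp: gram_draws_def)
  have "(\<lambda>a. \<Sum>i\<in>S. msg t j (X a) (U a) i k) \<in> borel_measurable N" for S
    using K by (intro borel_measurable_sum msg_measurable[OF t X U]) (auto simp: gram_draws_def)
  then have "(\<lambda>a. \<Sum>i\<in>gram_clients R t j (U a). msg t j (X a) (U a) i k) \<in> borel_measurable N"
    by (rule measurable_compose_countable'[OF _ A]) simp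
  then show ?thesis
    unfolding col_def gram_column_def by measurable
qed

lemma col_measurable_alg: "t < T \<Longrightarrow> col t j k x \<in> borel_measurable (alg (gram_draws t j))"
  using col_measurable[of t "\<lambda>_. x" "alg (gram_draws t j)" "\<lambda>\<omega>. \<omega>" "gram_draws t j" j k] by simp

lemma gram_draws_in_run: "t < T \<Longrightarrow> gram_draws t j \<subseteq> {e. in_run T \<tau> e}"
  by (auto simp: gram_draws_def msg_draws_def)

lemma
  assumes t: "t < T"
  shows col_integrable: "integrable P (col t j k x)"
    and col_expectation: "expectation (col t j k x) = grad (avg_obj f k) x"
    and col_sq_integrable: "integrable P (\<lambda>\<omega>. (norm (col t j k x \<omega>))\<^sup>2)"
    and col_second_moment: "expectation (\<lambda>\<omega>. (norm (col t j k x \<omega>))\<^sup>2) \<le> gram_bound"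
proof -
  let ?K = "{Gram_Clients t j} :: ('c, 'm) draw set" and ?K' = "msg_draws t j k"
  have K: "?K \<inter> (\<Union>i. ?K' i) = {}" "?K \<union> (\<Union>i. ?K' i) \<subseteq> {e. in_run T \<tau> e}" "disjoint_family ?K'"
    using t by (auto simp: msg_draws_def disjoint_family_on_def)
  have V: "(\<lambda>\<omega>. msg t j x \<omega> i k) \<in> borel_measurable (alg (?K' i))" for i
    by (intro msg_measurable[where K = "?K' i"] t) auto
  have V': "(\<lambda>\<omega>. msg t j x \<omega> i k) \<in> borel_measurable (alg (\<Union>i. ?K' i))" for i
    using V by (rule measurable_alg_mono) auto
  note A = gram_clients_measurable[of t j ?K, OF insertI1] has_law_uniform_clients[OF gram_clients_law[OF t]]
  have col: "col t j k x = (\<lambda>\<omega>. (1 / real n') *\<^sub>R (\<Sum>i\<in>gram_clients R t j \<omega>. msg t j x \<omega> i k))"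
    by (simp add: col_def gram_column_def fun_eq_iff)
  show "integrable P (col t j k x)"
    unfolding col by (rule integrable_sample_mean[OF n' K(1,2) A V' msg_integrable[OF t]])
  have "expectation (col t j k x)
      = (1 / real CARD('c)) *\<^sub>R (\<Sum>i\<in>UNIV. expectation (\<lambda>\<omega>. msg t j x \<omega> i k))"
    unfolding col by (rule expectation_sample_mean[OF n' K(1,2) A V' msg_integrable[OF t]])
  then show "expectation (col t j k x) = grad (avg_obj f k) x"
    by (simp add: msg_expectation[OF t] grad_avg_obj)
  have colM: "col t j k x \<in> borel_measurable P"
    using col_measurable_alg[OF t] gram_draws_in_run[OF t] by (rule measurable_alg_imp)
  have "(\<integral>\<^sup>+\<omega>. ennreal ((norm (col t j k x \<omega>))\<^sup>2) \<partial>P) \<le> ennreal gram_bound"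
    unfolding col gram_bound_def
    by (rule second_moment_sample_mean[OF n' K A V msg_expectation[OF t] A4 msg_variance[OF t]])
       (use q_pos in auto)
  then have nn: "(\<integral>\<^sup>+\<omega>. ennreal ((norm (col t j k x \<omega> - 0))\<^sup>2) \<partial>P) \<le> ennreal gram_bound" by simp
  show int: "integrable P (\<lambda>\<omega>. (norm (col t j k x \<omega>))\<^sup>2)"
    using integrable_sq_norm_diff[OF colM nn] by simp
  have "ennreal (expectation (\<lambda>\<omega>. (norm (col t j k x \<omega>))\<^sup>2)) \<le> ennreal gram_bound"
    using nn int by (subst nn_integral_eq_integral[symmetric]) auto
  then show "expectation (\<lambda>\<omega>. (norm (col t j k x \<omega>))\<^sup>2) \<le> gram_bound"
    using gram_bound_nonneg by simp
qed

lemma gram_draws_disjoint: "gram_draws t Gram1 \<inter> gram_draws t Gram2 = {}"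
  by (auto simp: gram_draws_def msg_draws_def)

text \<open>The two client sets and their oracles are independent, so the mean of a product of
  columns is the product of the means. With a single set the covariance of its columns would appear
  as a bias.\<close>

lemma
  assumes t: "t < T"
  shows inner_gram_vec_integrable: "integrable P (\<lambda>\<omega>. u \<bullet> gram_vec t x w \<omega>)"
    and inner_gram_vec_expectation: "expectation (\<lambda>\<omega>. u \<bullet> gram_vec t x w \<omega>)
      = (\<Sum>k\<in>UNIV. u $ k *\<^sub>R grad (avg_obj f k) x) \<bullet> (\<Sum>k\<in>UNIV. w $ k *\<^sub>R grad (avg_obj f k) x)"
proof -
  have K: "gram_draws t Gram1 \<inter> gram_draws t Gram2 = {}"
      "gram_draws t Gram1 \<union> gram_draws t Gram2 \<subseteq> {e. in_run T \<tau> e}"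
    using gram_draws_disjoint gram_draws_in_run[OF t] by auto
  note ind = K col_measurable_alg[OF t] col_integrable[OF t] col_measurable_alg[OF t] col_integrable[OF t]
  have eq: "u \<bullet> gram_vec t x w \<omega>
      = (\<Sum>k\<in>UNIV. \<Sum>l\<in>UNIV. u $ k * w $ l * (col t Gram1 k x \<omega> \<bullet> col t Gram2 l x \<omega>))" for \<omega>
    by (simp add: gram_vec_def inner_vec_def[of u] inner_sum_right sum_distrib_left mult.assoc)
  show "integrable P (\<lambda>\<omega>. u \<bullet> gram_vec t x w \<omega>)"
    unfolding eq by (intro Bochner_Integration.integrable_sum integrable_mult_right integrable_inner_indep[OF ind])
  show "expectation (\<lambda>\<omega>. u \<bullet> gram_vec t x w \<omega>)
      = (\<Sum>k\<in>UNIV. u $ k *\<^sub>R grad (avg_obj f k) x) \<bullet> (\<Sum>k\<in>UNIV. w $ k *\<^sub>R grad (avg_obj f k) x)"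
    unfolding eq
    by (simp add: Bochner_Integration.integral_sum Bochner_Integration.integrable_sum
        integrable_inner_indep[OF ind] expectation_inner_indep[OF ind] col_expectation[OF t]
        inner_sum_left inner_sum_right sum_distrib_left mult.assoc)
       (subst sum.swap, simp add: mult.left_commute)
qed

text \<open>Independence again: a product of two squared norms is integrable although the oracles
  have only second moments. The factor M counts the rows; the sum over columns costs nothing because
  the weights add up to one.\<close>

lemma
  assumes t: "t < T" and w: "w \<in> prob_simplex"
  shows gram_vec_sq_integrable: "integrable P (\<lambda>\<omega>. (norm (gram_vec t x w \<omega>))\<^sup>2)"
    and gram_vec_second_moment:
      "expectation (\<lambda>\<omega>. (norm (gram_vec t x w \<omega>))\<^sup>2) \<le> real CARD('m) * gram_bound\<^sup>2"
proof -
  have K: "gram_draws t Gram1 \<inter> gram_draws t Gram2 = {}"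
      "gram_draws t Gram1 \<union> gram_draws t Gram2 \<subseteq> {e. in_run T \<tau> e}"
    using gram_draws_disjoint gram_draws_in_run[OF t] by auto
  have colM [measurable]: "col t j k x \<in> borel_measurable P" for j k
    using col_measurable_alg[OF t] gram_draws_in_run[OF t] by (rule measurable_alg_imp)
  let ?N = "\<lambda>j k \<omega>. (norm (col t j k x \<omega>))\<^sup>2"
  have N: "?N j k \<in> borel_measurable (alg (gram_draws t j))" for j k
    using col_measurable_alg[OF t, of j k x] by measurable
  note ind = K N col_sq_integrable[OF t] N col_sq_integrable[OF t]
  have int: "integrable P (\<lambda>\<omega>. ?N Gram1 k \<omega> * ?N Gram2 l \<omega>)" for k l
  proof -
    have "integrable P (\<lambda>\<omega>. ?N Gram1 k \<omega> \<bullet> ?N Gram2 l \<omega>)"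
      by (rule integrable_inner_indep[OF ind])
    then show ?thesis by simp
  qed
  have le: "expectation (\<lambda>\<omega>. ?N Gram1 k \<omega> * ?N Gram2 l \<omega>) \<le> gram_bound\<^sup>2" for k l
  proof -
    have "expectation (\<lambda>\<omega>. ?N Gram1 k \<omega> \<bullet> ?N Gram2 l \<omega>) = expectation (?N Gram1 k) \<bullet> expectation (?N Gram2 l)"
      by (rule expectation_inner_indep[OF ind])
    then have "expectation (\<lambda>\<omega>. ?N Gram1 k \<omega> * ?N Gram2 l \<omega>) = expectation (?N Gram1 k) * expectation (?N Gram2 l)"
      by simp
    also have "\<dots> \<le> gram_bound * gram_bound"
      using col_second_moment[OF t] gram_bound_nonneg by (intro mult_mono) auto
    finally show ?thesis by (simp add: power2_eq_square)
  qed
  let ?S = "\<lambda>\<omega>. \<Sum>k\<in>UNIV. \<Sum>l\<in>UNIV. w $ l * (?N Gram1 k \<omega> * ?N Gram2 l \<omega>)"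
  have S: "integrable P ?S"
    using int by auto
  have bound: "(norm (gram_vec t x w \<omega>))\<^sup>2 \<le> ?S \<omega>" for \<omega>
    unfolding gram_vec_def by (rule gram_vec_sq_le[OF w])
  have "(\<lambda>\<omega>. (norm (gram_vec t x w \<omega>))\<^sup>2) \<in> borel_measurable P"
    unfolding norm_sq_vec gram_vec_def vec_lambda_beta by measurable
  with S show I: "integrable P (\<lambda>\<omega>. (norm (gram_vec t x w \<omega>))\<^sup>2)"
    by (rule Bochner_Integration.integrable_bound) (simp add: order_trans[OF bound abs_ge_self])
  have "expectation (\<lambda>\<omega>. (norm (gram_vec t x w \<omega>))\<^sup>2) \<le> expectation ?S"
    using I S bound by (rule integral_mono)
  also have "\<dots> = (\<Sum>k\<in>(UNIV::'m set). \<Sum>l\<in>UNIV. w $ l * expectation (\<lambda>\<omega>. ?N Gram1 k \<omega> * ?N Gram2 l \<omega>))"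
    using int by (simp add: Bochner_Integration.integral_sum)
  also have "\<dots> \<le> (\<Sum>k\<in>(UNIV::'m set). \<Sum>l\<in>UNIV. w $ l * gram_bound\<^sup>2)"
    using le prob_simplexD[OF w] by (intro sum_mono mult_left_mono) auto
  also have "\<dots> = real CARD('m) * gram_bound\<^sup>2"
    using prob_simplexD(2)[OF w] by (simp flip: sum_distrib_right)
  finally show "expectation (\<lambda>\<omega>. (norm (gram_vec t x w \<omega>))\<^sup>2) \<le> real CARD('m) * gram_bound\<^sup>2" .
qed

end

text \<open>Jensen, in the form that the variance of the norm is nonnegative.\<close>

lemma (in prob_space) expectation_norm_le_sqrt:
  fixes X :: "'a \<Rightarrow> 'b :: euclidean_space"
  assumes X: "X \<in> borel_measurable M" and "v \<ge> 0"
    and v: "(\<integral>\<^sup>+\<omega>. ennreal ((norm (X \<omega>))\<^sup>2) \<partial>M) \<le> ennreal v"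
  shows "expectation (\<lambda>\<omega>. norm (X \<omega>)) \<le> sqrt v"
proof -
  have v': "(\<integral>\<^sup>+\<omega>. ennreal ((norm (X \<omega> - 0))\<^sup>2) \<partial>M) \<le> ennreal v" using v by simp
  have sq: "integrable M (\<lambda>\<omega>. (norm (X \<omega>))\<^sup>2)" and int: "integrable M (\<lambda>\<omega>. norm (X \<omega>))"
    using integrable_sq_norm_diff[OF X v'] integrable_of_sq_norm[OF X v'] by auto
  have "(expectation (\<lambda>\<omega>. norm (X \<omega>)))\<^sup>2 \<le> expectation (\<lambda>\<omega>. (norm (X \<omega>))\<^sup>2)"
    using variance_eq[OF int sq] variance_positive[of "\<lambda>\<omega>. norm (X \<omega>)"] by simp
  also have "ennreal (expectation (\<lambda>\<omega>. (norm (X \<omega>))\<^sup>2)) \<le> ennreal v"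
    using v sq by (subst nn_integral_eq_integral[symmetric]) auto
  then have "expectation (\<lambda>\<omega>. (norm (X \<omega>))\<^sup>2) \<le> v"
    using \<open>v \<ge> 0\<close> by simp
  finally show ?thesis by (rule real_le_rsqrt)
qed

lemma borel_measurable_vec_component [measurable]: "(\<lambda>w :: real^'m::finite. w $ k) \<in> borel_measurable borel"
  by (intro borel_measurable_continuous_onI continuous_intros)

lemma norm_add_sq_le: "(norm (a + b))\<^sup>2 \<le> 2 * (norm a)\<^sup>2 + 2 * (norm (b :: 'a :: real_normed_vector))\<^sup>2"
proof -
  have "(norm (a + b))\<^sup>2 \<le> (norm a + norm b)\<^sup>2"
    by (intro power_mono norm_triangle_ineq) auto
  also have "\<dots> \<le> 2 * (norm a)\<^sup>2 + 2 * (norm b)\<^sup>2"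
    using sum_squares_bound[of "norm a" "norm b"] by (simp add: power2_sum)
  finally show ?thesis .
qed

context fedcmoo_run
begin

subsection \<open>The local phase from a fixed point with fixed weights\<close>

definition local_grad :: "'c \<Rightarrow> real^'m \<Rightarrow> real^'d \<Rightarrow> real^'d" where
  "local_grad i w y = (\<Sum>k\<in>UNIV. w $ k *\<^sub>R grad (f i k) y)"

definition global_grad :: "real^'m \<Rightarrow> real^'d \<Rightarrow> real^'d" where
  "global_grad w y = (\<Sum>k\<in>UNIV. w $ k *\<^sub>R grad (avg_obj f k) y)"

text \<open>The error at a deterministic point \<open>y\<close> is kept apart from the error along
  the trajectory: its moments follow from the oracle assumptions and are carried over to the random
  iterate by freezing.\<close>

definition sample_noise :: "nat \<Rightarrow> 'c \<Rightarrow> real^'m \<Rightarrow> nat \<Rightarrow> real^'d \<Rightarrow> 'w \<Rightarrow> real^'d" where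
  "sample_noise t i w r y \<omega> = (\<Sum>k\<in>UNIV. w $ k *\<^sub>R (sg i k (local_sample R t i r \<omega>) y - grad (f i k) y))"

definition iter :: "real \<Rightarrow> nat \<Rightarrow> 'c \<Rightarrow> real^'d \<Rightarrow> real^'m \<Rightarrow> nat \<Rightarrow> 'w \<Rightarrow> real^'d" where
  "iter \<eta> t i x w r \<omega> = local_iter \<eta> (\<lambda>r k y. sg i k (local_sample R t i r \<omega>) y) w x r"

definition noise :: "real \<Rightarrow> nat \<Rightarrow> 'c \<Rightarrow> real^'d \<Rightarrow> real^'m \<Rightarrow> nat \<Rightarrow> 'w \<Rightarrow> real^'d" where
  "noise \<eta> t i x w r \<omega> = sample_noise t i w r (iter \<eta> t i x w r \<omega>) \<omega>"

text \<open>The strict bound matters: iterate \<open>r\<close> uses only samples of steps before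
  \<open>r\<close>, hence is independent of \<open>Local_Sample t i r\<close>.\<close>

definition local_draws :: "nat \<Rightarrow> 'c \<Rightarrow> nat \<Rightarrow> ('c, 'm) draw set" where
  "local_draws t i r = Local_Sample t i ` {..<r}"

lemma iter_Suc:
  "iter \<eta> t i x w (Suc r) \<omega> = iter \<eta> t i x w r \<omega>
    - \<eta> *\<^sub>R (local_grad i w (iter \<eta> t i x w r \<omega>) + noise \<eta> t i x w r \<omega>)"
  by (simp add: iter_def noise_def sample_noise_def local_grad_def Let_def
      flip: sum.distrib scaleR_add_right)

lemma iter_eq:
  "iter \<eta> t i x w r \<omega>
    = x - \<eta> *\<^sub>R (\<Sum>s<r. local_grad i w (iter \<eta> t i x w s \<omega>) + noise \<eta> t i x w s \<omega>)"
proof (induction r)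
  case 0
  then show ?case by (simp add: iter_def)
next
  case (Suc r)
  then show ?case
    unfolding iter_Suc by (simp add: scaleR_add_right)
qed

lemma norm_local_grad_le: "w \<in> prob_simplex \<Longrightarrow> norm (local_grad i w y) \<le> B"
  unfolding local_grad_def by (rule norm_simplex_sum_le) (auto simp: A4)

lemma norm_global_grad_le: "w \<in> prob_simplex \<Longrightarrow> norm (global_grad w y) \<le> B"
  unfolding global_grad_def by (rule norm_simplex_sum_le) (auto simp: norm_grad_avg_le)

lemma local_grad_lipschitz:
  assumes "w \<in> prob_simplex"
  shows "norm (local_grad i w y - local_grad i w y') \<le> L * norm (y - y')"
proof -
  have "local_grad i w y - local_grad i w y' = (\<Sum>k\<in>UNIV. w $ k *\<^sub>R (grad (f i k) y - grad (f i k) y'))"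
    by (simp add: local_grad_def sum_subtractf scaleR_diff_right)
  then show ?thesis
    using norm_simplex_sum_le[OF assms A1] by simp
qed

lemma mean_local_grad: "(1 / real CARD('c)) *\<^sub>R (\<Sum>i\<in>UNIV. local_grad i w y) = global_grad w y"
  unfolding local_grad_def global_grad_def grad_avg_obj
  by (subst sum.swap) (simp add: scaleR_sum_right mult.commute)

lemma local_grad_measurable [measurable]: "local_grad i w \<in> borel_measurable borel"
  unfolding local_grad_def by measurable

lemma iter_measurable:
  assumes t: "t < T" and X: "X \<in> borel_measurable N" and W: "W \<in> borel_measurable N"
    and U: "U \<in> measurable N (alg K)"
  shows "r \<le> \<tau> \<Longrightarrow> local_draws t i r \<subseteq> K \<Longrightarrow> (\<lambda>a. iter \<eta> t i (X a) (W a) r (U a)) \<in> borel_measurable N"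
proof (induction r)
  case 0
  then show ?case using X by (simp add: iter_def)
next
  case (Suc r)
  have IH [measurable]: "(\<lambda>a. iter \<eta> t i (X a) (W a) r (U a)) \<in> borel_measurable N"
    using Suc by (intro Suc.IH) (auto simp: local_draws_def)
  have [measurable]: "(\<lambda>a. sg i k (local_sample R t i r (U a)) (iter \<eta> t i (X a) (W a) r (U a))) \<in> borel_measurable N" for k
    using Suc.prems
    by (intro sg_measurable IH measurable_compose[OF U] local_sample_measurable t) (auto simp: local_draws_def)
  note W [measurable]
  have "(\<lambda>a. iter \<eta> t i (X a) (W a) (Suc r) (U a)) = (\<lambda>a. iter \<eta> t i (X a) (W a) r (U a)
      - \<eta> *\<^sub>R (\<Sum>k\<in>UNIV. W a $ k *\<^sub>R sg i k (local_sample R t i r (U a)) (iter \<eta> t i (X a) (W a) r (U a))))"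
    by (simp add: iter_def Let_def fun_eq_iff)
  also have "\<dots> \<in> borel_measurable N" by measurable
  finally show ?case .
qed

lemma iter_measurable_alg:
  "t < T \<Longrightarrow> r \<le> \<tau> \<Longrightarrow> local_draws t i r \<subseteq> K \<Longrightarrow> iter \<eta> t i x w r \<in> borel_measurable (alg K)"
  using iter_measurable[of t "\<lambda>_. x" "alg K" "\<lambda>_. w" "\<lambda>\<omega>. \<omega>" K r i \<eta>] by simp

lemma sample_noise_measurable:
  assumes t: "t < T" "r < \<tau>" and Y: "Y \<in> borel_measurable N" and U: "U \<in> measurable N (alg K)"
    and K: "Local_Sample t i r \<in> K"
  shows "(\<lambda>a. sample_noise t i w r (Y a) (U a)) \<in> borel_measurable N"
proof -
  have [measurable]: "(\<lambda>a. sg i k (local_sample R t i r (U a)) (Y a)) \<in> borel_measurable N" for k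
    using t K by (intro sg_measurable Y measurable_compose[OF U] local_sample_measurable) auto
  note Y [measurable]
  show ?thesis unfolding sample_noise_def by measurable
qed

lemma noise_measurable_alg:
  assumes "t < T" "r < \<tau>" "local_draws t i (Suc r) \<subseteq> K"
  shows "noise \<eta> t i x w r \<in> borel_measurable (alg K)"
proof -
  have "(\<lambda>\<omega>. sample_noise t i w r (iter \<eta> t i x w r \<omega>) \<omega>) \<in> borel_measurable (alg K)"
    using assms
    by (intro sample_noise_measurable[where K = K] iter_measurable_alg) (auto simp: local_draws_def)
  then show ?thesis by (simp add: noise_def[abs_def])
qed

lemma local_draws_in_run: "t < T \<Longrightarrow> r \<le> \<tau> \<Longrightarrow> local_draws t i r \<subseteq> {e. in_run T \<tau> e}"
  by (auto simp: local_draws_def)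

text \<open>All objectives share one sample, so their errors may be arbitrarily correlated.
  Convexity of the squared norm over the simplex still gives \<sigma>^2 without a factor M.\<close>

lemma
  assumes t: "t < T" "r < \<tau>" and w: "w \<in> prob_simplex"
  shows sample_noise_integrable: "integrable P (sample_noise t i w r y)"
    and sample_noise_expectation: "expectation (sample_noise t i w r y) = 0"
    and sample_noise_variance: "(\<integral>\<^sup>+\<omega>. ennreal ((norm (sample_noise t i w r y \<omega>))\<^sup>2) \<partial>P) \<le> ennreal (\<sigma>\<^sup>2)"
proof -
  note smp = local_sample_law[OF t]
  let ?e = "\<lambda>k \<omega>. sg i k (local_sample R t i r \<omega>) y - grad (f i k) y"
  have int: "integrable P (?e k)" for k
    using sg_integrable[OF smp] by auto
  have mean: "expectation (?e k) = 0" for k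
    using sg_integrable[OF smp] sg_expectation[OF smp] by (simp add: prob_space)
  have [measurable]: "?e k \<in> borel_measurable P" for k
    using int by auto
  show "integrable P (sample_noise t i w r y)"
    unfolding sample_noise_def[abs_def] using int by auto
  show "expectation (sample_noise t i w r y) = 0"
    unfolding sample_noise_def[abs_def]
    by (subst Bochner_Integration.integral_sum) (use int mean in auto)
  have "(\<integral>\<^sup>+\<omega>. ennreal ((norm (sample_noise t i w r y \<omega>))\<^sup>2) \<partial>P)
      \<le> (\<integral>\<^sup>+\<omega>. (\<Sum>k\<in>UNIV. ennreal (w $ k) * ennreal ((norm (?e k \<omega>))\<^sup>2)) \<partial>P)"
  proof (rule nn_integral_mono)
    fix \<omega>
    have "ennreal ((norm (sample_noise t i w r y \<omega>))\<^sup>2) \<le> ennreal (\<Sum>k\<in>UNIV. w $ k * (norm (?e k \<omega>))\<^sup>2)"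
      unfolding sample_noise_def by (intro ennreal_leI norm_simplex_sum_sq_le w)
    also have "\<dots> = (\<Sum>k\<in>UNIV. ennreal (w $ k) * ennreal ((norm (?e k \<omega>))\<^sup>2))"
      using prob_simplexD(1)[OF w] by (simp add: sum_ennreal[symmetric] ennreal_mult)
    finally show "ennreal ((norm (sample_noise t i w r y \<omega>))\<^sup>2)
        \<le> (\<Sum>k\<in>UNIV. ennreal (w $ k) * ennreal ((norm (?e k \<omega>))\<^sup>2))" .
  qed
  also have "\<dots> = (\<Sum>k\<in>UNIV. ennreal (w $ k) * (\<integral>\<^sup>+\<omega>. ennreal ((norm (?e k \<omega>))\<^sup>2) \<partial>P))"
    by (simp add: nn_integral_sum nn_integral_cmult)
  also have "\<dots> \<le> (\<Sum>k\<in>UNIV. ennreal (w $ k) * ennreal (\<sigma>\<^sup>2))"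
    by (intro sum_mono mult_left_mono sg_variance[OF smp]) auto
  also have "\<dots> = ennreal (\<sigma>\<^sup>2)"
    using prob_simplexD[OF w] by (simp add: sum_distrib_right[symmetric] sum_ennreal)
  finally show "(\<integral>\<^sup>+\<omega>. ennreal ((norm (sample_noise t i w r y \<omega>))\<^sup>2) \<partial>P) \<le> ennreal (\<sigma>\<^sup>2)" .
qed

text \<open>One step of a martingale: given the earlier samples the new error has mean zero and
  variance at most \<sigma>^2, so it is orthogonal to whatever they determine.\<close>

lemma nn_integral_noise_shift_le:
  assumes t: "t < T" "r < \<tau>" and w: "w \<in> prob_simplex"
    and p: "p \<in> borel_measurable (alg (local_draws t i r))"
  shows "(\<integral>\<^sup>+\<omega>. ennreal ((norm (p \<omega> + noise \<eta> t i x w r \<omega>))\<^sup>2) \<partial>P)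
    \<le> (\<integral>\<^sup>+\<omega>. ennreal ((norm (p \<omega>))\<^sup>2) \<partial>P) + ennreal (\<sigma>\<^sup>2)"
proof -
  let ?K = "local_draws t i r" and ?K' = "{Local_Sample t i r} :: ('c, 'm) draw set"
  have K: "?K \<inter> ?K' = {}" "?K \<union> ?K' \<subseteq> {e. in_run T \<tau> e}"
    using t by (auto simp: local_draws_def)
  note [measurable] = p
  have [measurable]: "p \<in> borel_measurable P"
    using measurable_alg_imp[OF p] K by auto
  have [measurable]: "iter \<eta> t i x w r \<in> borel_measurable (alg ?K)"
    using t by (intro iter_measurable_alg) auto
  \<comment> \<open>The prefix and the iterate depend on the same earlier samples and have to be
    frozen together.\<close>
  have X: "(\<lambda>\<omega>. (p \<omega>, iter \<eta> t i x w r \<omega>)) \<in> measurable (alg ?K) (borel \<Otimes>\<^sub>M borel)"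
    by measurable
  have [measurable]: "(\<lambda>a. sample_noise t i w r (snd (fst a)) (snd a)) \<in> borel_measurable ((borel \<Otimes>\<^sub>M borel) \<Otimes>\<^sub>M alg ?K')"
    using t by (intro sample_noise_measurable[where K = ?K']) auto
  have "(\<integral>\<^sup>+\<omega>. ennreal ((norm (p \<omega> + noise \<eta> t i x w r \<omega>))\<^sup>2) \<partial>P)
     = (\<integral>\<^sup>+\<omega>. (\<integral>\<^sup>+\<omega>'. ennreal ((norm (p \<omega> + sample_noise t i w r (iter \<eta> t i x w r \<omega>) \<omega>'))\<^sup>2) \<partial>P) \<partial>P)"
    using nn_integral_freeze[OF K X,
      where h = "\<lambda>s \<omega>. ennreal ((norm (fst s + sample_noise t i w r (snd s) \<omega>))\<^sup>2)"]
    by (simp add: noise_def case_prod_beta')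
  also have "\<dots> \<le> (\<integral>\<^sup>+\<omega>. ennreal (\<sigma>\<^sup>2 + (norm (p \<omega>))\<^sup>2) \<partial>P)"
  proof (rule nn_integral_mono)
    fix \<omega>
    let ?V = "sample_noise t i w r (iter \<eta> t i x w r \<omega>)"
    have "(\<integral>\<^sup>+\<omega>'. ennreal ((norm (?V \<omega>' - (- p \<omega>)))\<^sup>2) \<partial>P) \<le> ennreal (\<sigma>\<^sup>2 + (norm (0 - (- p \<omega>)))\<^sup>2)"
      using sample_noise_variance[OF t w]
      by (intro second_moment_shift sample_noise_integrable[OF t w] sample_noise_expectation[OF t w]) auto
    then show "(\<integral>\<^sup>+\<omega>'. ennreal ((norm (p \<omega> + ?V \<omega>'))\<^sup>2) \<partial>P) \<le> ennreal (\<sigma>\<^sup>2 + (norm (p \<omega>))\<^sup>2)"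
      by (simp add: add.commute)
  qed
  also have "\<dots> = (\<integral>\<^sup>+\<omega>. ennreal ((norm (p \<omega>))\<^sup>2) \<partial>P) + ennreal (\<sigma>\<^sup>2)"
    by (simp add: nn_integral_add emeasure_space_1 add.commute)
  finally show ?thesis .
qed

lemma noise_sum_measurable:
  assumes "t < T" "r \<le> \<tau>" "local_draws t i r \<subseteq> K"
  shows "(\<lambda>\<omega>. \<Sum>s<r. noise \<eta> t i x w s \<omega>) \<in> borel_measurable (alg K)"
  using assms by (intro borel_measurable_sum noise_measurable_alg) (auto simp: local_draws_def)

text \<open>The errors along a trajectory are martingale differences, so the second moment of their
  sum grows linearly in \<open>r\<close> rather than quadratically.\<close>

lemma noise_sum_second_moment:
  assumes t: "t < T" and w: "w \<in> prob_simplex"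
  shows "r \<le> \<tau> \<Longrightarrow> (\<integral>\<^sup>+\<omega>. ennreal ((norm (\<Sum>s<r. noise \<eta> t i x w s \<omega>))\<^sup>2) \<partial>P) \<le> ennreal (real r * \<sigma>\<^sup>2)"
proof (induction r)
  case (Suc r)
  have "(\<integral>\<^sup>+\<omega>. ennreal ((norm ((\<Sum>s<r. noise \<eta> t i x w s \<omega>) + noise \<eta> t i x w r \<omega>))\<^sup>2) \<partial>P)
    \<le> (\<integral>\<^sup>+\<omega>. ennreal ((norm (\<Sum>s<r. noise \<eta> t i x w s \<omega>))\<^sup>2) \<partial>P) + ennreal (\<sigma>\<^sup>2)"
    using Suc.prems by (intro nn_integral_noise_shift_le t w noise_sum_measurable) auto
  also have "\<dots> \<le> ennreal (real r * \<sigma>\<^sup>2) + ennreal (\<sigma>\<^sup>2)"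
    using Suc by (intro add_right_mono) auto
  also have "\<dots> = ennreal (real (Suc r) * \<sigma>\<^sup>2)"
    by (simp add: ennreal_plus[symmetric] algebra_simps del: ennreal_plus)
  finally show ?case by simp
qed simp

lemma
  assumes t: "t < T" "r < \<tau>" and w: "w \<in> prob_simplex"
  shows noise_integrable: "integrable P (noise \<eta> t i x w r)"
    and noise_expectation: "expectation (noise \<eta> t i x w r) = 0"
proof -
  let ?K = "local_draws t i r" and ?K' = "{Local_Sample t i r} :: ('c, 'm) draw set"
  have K: "?K \<inter> ?K' = {}" "?K \<union> ?K' \<subseteq> {e. in_run T \<tau> e}"
    using t by (auto simp: local_draws_def)
  have "noise \<eta> t i x w r \<in> borel_measurable (alg (local_draws t i (Suc r)))"
    using t by (intro noise_measurable_alg) auto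
  then have M: "noise \<eta> t i x w r \<in> borel_measurable P"
    by (rule measurable_alg_imp) (use local_draws_in_run[OF t(1), of "Suc r" i] t(2) in simp)
  have "(\<integral>\<^sup>+\<omega>. ennreal ((norm (noise \<eta> t i x w r \<omega> - 0))\<^sup>2) \<partial>P) \<le> ennreal (\<sigma>\<^sup>2)"
    using nn_integral_noise_shift_le[OF t w, of "\<lambda>_. 0" i \<eta> x] by simp
  with M show int: "integrable P (noise \<eta> t i x w r)"
    by (rule integrable_of_sq_norm)
  have iter: "iter \<eta> t i x w r \<in> borel_measurable (alg ?K)"
    using t by (intro iter_measurable_alg) auto
  have [measurable]: "(\<lambda>(y, \<omega>). sample_noise t i w r y \<omega>) \<in> borel_measurable (borel \<Otimes>\<^sub>M alg ?K')"
    unfolding case_prod_beta' using t by (intro sample_noise_measurable[where K = ?K']) auto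
  have "expectation (\<lambda>\<omega>. sample_noise t i w r (iter \<eta> t i x w r \<omega>) \<omega>)
      = (\<integral>\<omega>. (\<integral>\<omega>'. sample_noise t i w r (iter \<eta> t i x w r \<omega>) \<omega>' \<partial>P) \<partial>P)"
    using int by (intro integral_freeze[OF K iter]) (auto simp: noise_def[abs_def])
  then show "expectation (noise \<eta> t i x w r) = 0"
    by (simp add: noise_def[abs_def] sample_noise_expectation[OF t w])
qed

text \<open>Bound on the expected displacement in a local phase per unit step size: gradients push
  by at most \<open>B\<close> per step, whereas the noise accumulates only like the square root of
  the number of steps.\<close>

definition drift :: real where
  "drift = real \<tau> * B + sqrt (real \<tau>) * \<bar>\<sigma>\<bar>"

text \<open>A first moment suffices, since the displacement enters through the Lipschitz bound on
  the bias of the update.\<close>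

lemma
  assumes t: "t < T" "r \<le> \<tau>" and w: "w \<in> prob_simplex" and \<eta>: "\<eta> \<ge> 0"
  shows iter_diff_integrable: "integrable P (\<lambda>\<omega>. norm (iter \<eta> t i x w r \<omega> - x))"
    and iter_diff_expectation: "expectation (\<lambda>\<omega>. norm (iter \<eta> t i x w r \<omega> - x)) \<le> \<eta> * drift"
proof -
  let ?N = "\<lambda>\<omega>. \<Sum>s<r. noise \<eta> t i x w s \<omega>"
  have int: "integrable P ?N"
    using t w by (intro Bochner_Integration.integrable_sum noise_integrable) auto
  have [measurable]: "iter \<eta> t i x w r \<in> borel_measurable P"
    using iter_measurable_alg[of t r i "local_draws t i r"] t
    by (intro measurable_alg_imp[OF _ local_draws_in_run]) auto
  have le: "norm (iter \<eta> t i x w r \<omega> - x) \<le> \<eta> * (real \<tau> * B + norm (?N \<omega>))" for \<omega>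
  proof -
    have "norm (iter \<eta> t i x w r \<omega> - x)
        = \<eta> * norm ((\<Sum>s<r. local_grad i w (iter \<eta> t i x w s \<omega>)) + ?N \<omega>)"
      using \<eta> by (subst iter_eq) (simp add: sum.distrib)
    also have "\<dots> \<le> \<eta> * (norm (\<Sum>s<r. local_grad i w (iter \<eta> t i x w s \<omega>)) + norm (?N \<omega>))"
      using \<eta> by (intro mult_left_mono norm_triangle_ineq)
    also have "norm (\<Sum>s<r. local_grad i w (iter \<eta> t i x w s \<omega>)) \<le> real r * B"
      using sum_norm_le[of "{..<r}" "\<lambda>s. local_grad i w (iter \<eta> t i x w s \<omega>)" "\<lambda>_. B"]
        norm_local_grad_le[OF w] by simp
    also have "\<dots> \<le> real \<tau> * B"
      using t B_pos by (intro mult_right_mono) auto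
    finally show ?thesis using \<eta> by (simp add: mult_left_mono)
  qed
  have int': "integrable P (\<lambda>\<omega>. \<eta> * (real \<tau> * B + norm (?N \<omega>)))"
    using int by auto
  then show I: "integrable P (\<lambda>\<omega>. norm (iter \<eta> t i x w r \<omega> - x))"
    by (rule Bochner_Integration.integrable_bound) (auto intro: order_trans[OF le abs_ge_self])
  have "expectation (\<lambda>\<omega>. norm (iter \<eta> t i x w r \<omega> - x)) \<le> \<eta> * (real \<tau> * B + expectation (\<lambda>\<omega>. norm (?N \<omega>)))"
    using integral_mono[OF I int' le] int by (simp add: prob_space)
  also have "expectation (\<lambda>\<omega>. norm (?N \<omega>)) \<le> sqrt (real r * \<sigma>\<^sup>2)"
    using int t w by (intro expectation_norm_le_sqrt noise_sum_second_moment) auto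
  also have "sqrt (real r * \<sigma>\<^sup>2) \<le> sqrt (real \<tau>) * \<bar>\<sigma>\<bar>"
    using t by (simp add: real_sqrt_mult mult_right_mono)
  finally show "expectation (\<lambda>\<omega>. norm (iter \<eta> t i x w r \<omega> - x)) \<le> \<eta> * drift"
    using \<eta> by (simp add: drift_def mult_left_mono)
qed

section \<open>The averaged client update\<close>

definition update :: "real \<Rightarrow> nat \<Rightarrow> real^'d \<Rightarrow> real^'m \<Rightarrow> 'w \<Rightarrow> 'c \<Rightarrow> real^'d" where
  "update \<eta> t x w \<omega> i = local_update \<eta> \<tau> (\<lambda>r k y. sg i k (local_sample R t i r \<omega>) y) w x"

definition mean_update :: "real \<Rightarrow> nat \<Rightarrow> real^'d \<Rightarrow> real^'m \<Rightarrow> 'w \<Rightarrow> real^'d" where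
  "mean_update \<eta> t x w \<omega> = (1 / real n) *\<^sub>R (\<Sum>i\<in>round_clients R t \<omega>. update \<eta> t x w \<omega> i)"

lemma update_eq:
  assumes "\<eta> > 0"
  shows "update \<eta> t x w \<omega> i = (1 / real \<tau>) *\<^sub>R (\<Sum>s<\<tau>. local_grad i w (iter \<eta> t i x w s \<omega>))
    + (1 / real \<tau>) *\<^sub>R (\<Sum>s<\<tau>. noise \<eta> t i x w s \<omega>)"
proof -
  have "update \<eta> t x w \<omega> i = (1 / (real \<tau> * \<eta>)) *\<^sub>R (x - iter \<eta> t i x w \<tau> \<omega>)"
    by (simp add: update_def local_update_def iter_def)
  also have "\<dots> = (1 / real \<tau>) *\<^sub>R (\<Sum>s<\<tau>. local_grad i w (iter \<eta> t i x w s \<omega>) + noise \<eta> t i x w s \<omega>)"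
    using assms by (subst iter_eq) simp
  finally show ?thesis by (simp add: sum.distrib scaleR_add_right)
qed

definition all_local_draws :: "nat \<Rightarrow> ('c, 'm) draw set" where
  "all_local_draws t = (\<Union>i. local_draws t i \<tau>)"

lemma update_measurable:
  assumes t: "t < T" and X: "X \<in> borel_measurable N" and W: "W \<in> borel_measurable N"
    and U: "U \<in> measurable N (alg K)" and K: "local_draws t i \<tau> \<subseteq> K"
  shows "(\<lambda>a. update \<eta> t (X a) (W a) (U a) i) \<in> borel_measurable N"
proof -
  have [measurable]: "(\<lambda>a. iter \<eta> t i (X a) (W a) \<tau> (U a)) \<in> borel_measurable N"
    by (rule iter_measurable[OF t X W U order_refl K])
  note X [measurable]
  have "(\<lambda>a. update \<eta> t (X a) (W a) (U a) i)
      = (\<lambda>a. (1 / (real \<tau> * \<eta>)) *\<^sub>R (X a - iter \<eta> t i (X a) (W a) \<tau> (U a)))"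
    by (simp add: update_def local_update_def iter_def fun_eq_iff)
  then show ?thesis by simp
qed

lemma mean_update_measurable:
  assumes t: "t < T" and X: "X \<in> borel_measurable N" and W: "W \<in> borel_measurable N"
    and U: "U \<in> measurable N (alg K)" and K: "insert (Round_Clients t) (all_local_draws t) \<subseteq> K"
  shows "(\<lambda>a. mean_update \<eta> t (X a) (W a) (U a)) \<in> borel_measurable N"
proof -
  have A: "(\<lambda>a. round_clients R t (U a)) \<in> measurable N (count_space UNIV)"
    using K by (intro measurable_compose[OF U] round_clients_measurable) auto
  have "(\<lambda>a. \<Sum>i\<in>S. update \<eta> t (X a) (W a) (U a) i) \<in> borel_measurable N" for S
    using K by (intro borel_measurable_sum update_measurable[OF t X W U]) (auto simp: all_local_draws_def)
  then have "(\<lambda>a. \<Sum>i\<in>round_clients R t (U a). update \<eta> t (X a) (W a) (U a) i) \<in> borel_measurable N"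
    by (rule measurable_compose_countable'[OF _ A]) simp
  then show ?thesis
    unfolding mean_update_def by measurable
qed

lemma AE_card_round_clients:
  assumes "t < T"
  shows "AE \<omega> in P. card (round_clients R t \<omega>) = n"
proof -
  note law = round_clients_law[OF assms]
  have "AE S in distr P (count_space UNIV) (round_clients R t). card S = n"
    unfolding has_law_uniform_clients[OF law] by (rule AE_card_uniform_clients[OF n(2)])
  moreover have "round_clients R t \<in> measurable P (count_space UNIV)"
    using has_law_measurable[OF law] by (simp add: uniform_clients_def measurable_def)
  ultimately show ?thesis
    by (subst (asm) AE_distr_iff) auto
qed

text \<open>Each update splits into an average \<open>G\<close> of true gradients along the
  trajectory, bounded by \<open>B\<close>, and an average \<open>V\<close> of noise with mean zero.
  The bias is caused by \<open>G\<close> alone. In the second moment the two parts are correlated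
  through the iterates, hence the factors 2; the variance of \<open>V\<close> shrinks with both the
  number of clients and the number of local steps.\<close>

lemma
  assumes t: "t < T" and w: "w \<in> prob_simplex" and \<eta>: "\<eta> > 0"
  shows mean_update_integrable: "integrable P (mean_update \<eta> t x w)"
    and mean_update_bias: "norm (expectation (mean_update \<eta> t x w) - global_grad w x) \<le> L * (\<eta> * drift)"
    and mean_update_sq_integrable: "integrable P (\<lambda>\<omega>. (norm (mean_update \<eta> t x w \<omega>))\<^sup>2)"
    and mean_update_second_moment:
      "expectation (\<lambda>\<omega>. (norm (mean_update \<eta> t x w \<omega>))\<^sup>2) \<le> 2 * B\<^sup>2 + 2 * (\<sigma>\<^sup>2 / (real n * real \<tau>))"
proof -
  let ?K = "{Round_Clients t} :: ('c, 'm) draw set" and ?K' = "\<lambda>i. local_draws t i \<tau>"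
  have K: "?K \<inter> (\<Union>i. ?K' i) = {}" "?K \<union> (\<Union>i. ?K' i) \<subseteq> {e. in_run T \<tau> e}" "disjoint_family ?K'"
    using t by (auto simp: local_draws_def disjoint_family_on_def)
  note A = round_clients_measurable[of t ?K, OF insertI1] has_law_uniform_clients[OF round_clients_law[OF t]]
  have iterM [measurable]: "iter \<eta> t i x w s \<in> borel_measurable (alg (?K' i))" if "s \<le> \<tau>" for s i
    using t that by (intro iter_measurable_alg) (auto simp: local_draws_def)
  have iterP [measurable]: "iter \<eta> t i x w s \<in> borel_measurable P" if "s \<le> \<tau>" for s i
    using measurable_alg_imp[OF iterM[OF that] local_draws_in_run[OF t order_refl]] .
  define G where "G i \<omega> = (1 / real \<tau>) *\<^sub>R (\<Sum>s<\<tau>. local_grad i w (iter \<eta> t i x w s \<omega>))" for i \<omega>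
  define V where "V i \<omega> = (1 / real \<tau>) *\<^sub>R (\<Sum>s<\<tau>. noise \<eta> t i x w s \<omega>)" for i \<omega>
  have upd: "update \<eta> t x w \<omega> i = G i \<omega> + V i \<omega>" for i \<omega>
    unfolding G_def V_def by (rule update_eq[OF \<eta>])
  have G_le: "norm (G i \<omega>) \<le> B" for i \<omega>
  proof -
    have "norm (\<Sum>s<\<tau>. local_grad i w (iter \<eta> t i x w s \<omega>)) \<le> real \<tau> * B"
      using sum_norm_le[of "{..<\<tau>}" "\<lambda>s. local_grad i w (iter \<eta> t i x w s \<omega>)" "\<lambda>_. B"]
        norm_local_grad_le[OF w] by simp
    then show ?thesis using \<tau>_pos by (simp add: G_def field_simps)
  qed
  have hM: "(\<lambda>\<omega>. local_grad i w (iter \<eta> t i x w s \<omega>)) \<in> borel_measurable P" if "s < \<tau>" for i s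
    using that by (intro measurable_compose[OF iterP local_grad_measurable]) auto
  have h_int: "integrable P (\<lambda>\<omega>. local_grad i w (iter \<eta> t i x w s \<omega>))" if "s < \<tau>" for i s
    using norm_local_grad_le[OF w] by (intro integrable_const_bound[where B = B] hM that) auto
  have G_int: "integrable P (G i)" for i
    unfolding G_def by (intro integrable_scaleR_right Bochner_Integration.integrable_sum h_int) auto
  have V_alg: "V i \<in> borel_measurable (alg (?K' i))" for i
    unfolding V_def using noise_sum_measurable[OF t order_refl order_refl] by measurable
  have V_int: "integrable P (V i)" for i
    unfolding V_def using t w
    by (intro integrable_scaleR_right Bochner_Integration.integrable_sum noise_integrable) auto
  have V_mean: "expectation (V i) = 0" for i
    unfolding V_def using noise_integrable[OF t _ w] noise_expectation[OF t _ w]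
    by (simp add: Bochner_Integration.integral_sum)
  have upd_int: "integrable P (\<lambda>\<omega>. update \<eta> t x w \<omega> i)" for i
    unfolding upd using G_int V_int by auto
  have upd_alg: "(\<lambda>\<omega>. update \<eta> t x w \<omega> i) \<in> borel_measurable (alg (?K' i))" for i
    using update_measurable[of t "\<lambda>_. x" "alg (?K' i)" "\<lambda>_. w" "\<lambda>\<omega>. \<omega>" "?K' i" i \<eta>] t by simp
  have upd_alg': "(\<lambda>\<omega>. update \<eta> t x w \<omega> i) \<in> borel_measurable (alg (\<Union>i. ?K' i))" for i
    using upd_alg by (rule measurable_alg_mono) auto
  have mu: "mean_update \<eta> t x w = (\<lambda>\<omega>. (1 / real n) *\<^sub>R (\<Sum>i\<in>round_clients R t \<omega>. update \<eta> t x w \<omega> i))"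
    by (simp add: mean_update_def fun_eq_iff)
  show mu_int: "integrable P (mean_update \<eta> t x w)"
    unfolding mu by (rule integrable_sample_mean[OF n K(1,2) A upd_alg' upd_int])
  \<comment> \<open>Gradients are evaluated at the iterates instead of at \<open>x\<close>;
    smoothness turns the expected displacement into a bound on this error, uniformly in the local
    step.\<close>
  have bias: "norm (expectation (\<lambda>\<omega>. update \<eta> t x w \<omega> i) - local_grad i w x) \<le> L * (\<eta> * drift)" for i
  proof -
    have d: "norm (expectation (\<lambda>\<omega>. local_grad i w (iter \<eta> t i x w s \<omega>)) - local_grad i w x) \<le> L * (\<eta> * drift)"
      if s: "s < \<tau>" for s
    proof -
      have "expectation (\<lambda>\<omega>. local_grad i w (iter \<eta> t i x w s \<omega>)) - local_grad i w x
          = expectation (\<lambda>\<omega>. local_grad i w (iter \<eta> t i x w s \<omega>) - local_grad i w x)"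
        using h_int[OF s] by (simp add: prob_space)
      also have "norm \<dots> \<le> expectation (\<lambda>\<omega>. norm (local_grad i w (iter \<eta> t i x w s \<omega>) - local_grad i w x))"
        by (rule integral_norm_bound)
      also have "\<dots> \<le> expectation (\<lambda>\<omega>. L * norm (iter \<eta> t i x w s \<omega> - x))"
        using s \<eta> h_int[OF s]
        by (intro integral_mono integrable_mult_right iter_diff_integrable t w local_grad_lipschitz[OF w]) auto
      also have "\<dots> \<le> L * (\<eta> * drift)"
        using s \<eta> L_pos by (simp, intro mult_left_mono iter_diff_expectation t w) auto
      finally show ?thesis .
    qed
    have "expectation (\<lambda>\<omega>. update \<eta> t x w \<omega> i) = expectation (G i)"
      using G_int[of i] V_int[of i] V_mean[of i] by (simp add: upd)
    also have "\<dots> = (1 / real \<tau>) *\<^sub>R (\<Sum>s<\<tau>. expectation (\<lambda>\<omega>. local_grad i w (iter \<eta> t i x w s \<omega>)))"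
      unfolding G_def[abs_def] using h_int by (simp add: Bochner_Integration.integral_sum)
    finally have "expectation (\<lambda>\<omega>. update \<eta> t x w \<omega> i) - local_grad i w x
        = (1 / real \<tau>) *\<^sub>R (\<Sum>s<\<tau>. expectation (\<lambda>\<omega>. local_grad i w (iter \<eta> t i x w s \<omega>)) - local_grad i w x)"
      using \<tau>_pos by (simp add: sum_subtractf scaleR_diff_right sum_constant_scaleR del: sum_constant)
    also have "norm \<dots> \<le> (1 / real \<tau>) * (\<Sum>s<\<tau>. L * (\<eta> * drift))"
      using d by (simp only: norm_scaleR, intro mult_mono sum_norm_le) auto
    also have "\<dots> = L * (\<eta> * drift)"
      using \<tau>_pos by simp
    finally show ?thesis .
  qed
  have "expectation (mean_update \<eta> t x w)
      = (1 / real CARD('c)) *\<^sub>R (\<Sum>i\<in>UNIV. expectation (\<lambda>\<omega>. update \<eta> t x w \<omega> i))"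
    unfolding mu by (rule expectation_sample_mean[OF n K(1,2) A upd_alg' upd_int])
  then have "expectation (mean_update \<eta> t x w) - global_grad w x
      = (1 / real CARD('c)) *\<^sub>R (\<Sum>i\<in>UNIV. expectation (\<lambda>\<omega>. update \<eta> t x w \<omega> i) - local_grad i w x)"
    by (simp only: mean_local_grad[symmetric] sum_subtractf scaleR_diff_right)
  also have "norm \<dots> \<le> (1 / real CARD('c)) * (\<Sum>i\<in>(UNIV::'c set). L * (\<eta> * drift))"
    using bias by (simp only: norm_scaleR, intro mult_mono sum_norm_le) auto
  also have "\<dots> = L * (\<eta> * drift)" by simp
  finally show "norm (expectation (mean_update \<eta> t x w) - global_grad w x) \<le> L * (\<eta> * drift)" .

  have V_var: "(\<integral>\<^sup>+\<omega>. ennreal ((norm (V i \<omega> - 0))\<^sup>2) \<partial>P) \<le> ennreal (\<sigma>\<^sup>2 / real \<tau>)" for i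
  proof -
    have [measurable]: "(\<lambda>\<omega>. \<Sum>s<\<tau>. noise \<eta> t i x w s \<omega>) \<in> borel_measurable P"
      using measurable_alg_imp[OF noise_sum_measurable[OF t order_refl order_refl]
          local_draws_in_run[OF t order_refl]] .
    have "(\<integral>\<^sup>+\<omega>. ennreal ((norm (V i \<omega> - 0))\<^sup>2) \<partial>P)
      = (\<integral>\<^sup>+\<omega>. ennreal ((1 / real \<tau>)\<^sup>2) * ennreal ((norm (\<Sum>s<\<tau>. noise \<eta> t i x w s \<omega>))\<^sup>2) \<partial>P)"
      by (simp add: V_def power_mult_distrib ennreal_mult'[symmetric] power_divide)
    also have "\<dots> = ennreal ((1 / real \<tau>)\<^sup>2) * (\<integral>\<^sup>+\<omega>. ennreal ((norm (\<Sum>s<\<tau>. noise \<eta> t i x w s \<omega>))\<^sup>2) \<partial>P)"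
      by (intro nn_integral_cmult) measurable
    also have "\<dots> \<le> ennreal ((1 / real \<tau>)\<^sup>2) * ennreal (real \<tau> * \<sigma>\<^sup>2)"
      by (intro mult_left_mono noise_sum_second_moment t w) auto
    also have "\<dots> = ennreal (\<sigma>\<^sup>2 / real \<tau>)"
      by (simp add: ennreal_mult'[symmetric] power2_eq_square)
    finally show ?thesis .
  qed
  \<comment> \<open>The averaged noise. Its client means vanish, so the sample-mean bound is used
    with \<open>b = 0\<close> and leaves only \<open>\<sigma>^2 / (n \<tau>)\<close>.\<close>
  let ?V = "\<lambda>\<omega>. (1 / real n) *\<^sub>R (\<Sum>i\<in>round_clients R t \<omega>. V i \<omega>)"
  have V_alg': "V i \<in> borel_measurable (alg (\<Union>i. ?K' i))" for i
    using V_alg by (rule measurable_alg_mono) auto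
  have VM: "?V \<in> borel_measurable P"
    using integrable_sample_mean[OF n K(1,2) A V_alg' V_int] by auto
  have "(\<integral>\<^sup>+\<omega>. ennreal ((norm (?V \<omega>))\<^sup>2) \<partial>P) \<le> ennreal (\<sigma>\<^sup>2 / real \<tau> / real n + 0\<^sup>2)"
    by (rule second_moment_sample_mean[OF n K A V_alg V_mean _ V_var]) auto
  then have nnV: "(\<integral>\<^sup>+\<omega>. ennreal ((norm (?V \<omega> - 0))\<^sup>2) \<partial>P) \<le> ennreal (\<sigma>\<^sup>2 / (real n * real \<tau>))"
    by (simp add: mult.commute)
  have Vsq: "integrable P (\<lambda>\<omega>. (norm (?V \<omega>))\<^sup>2)"
    using integrable_sq_norm_diff[OF VM nnV] by simp
  have EV: "expectation (\<lambda>\<omega>. (norm (?V \<omega>))\<^sup>2) \<le> \<sigma>\<^sup>2 / (real n * real \<tau>)"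
  proof -
    have "ennreal (expectation (\<lambda>\<omega>. (norm (?V \<omega>))\<^sup>2)) \<le> ennreal (\<sigma>\<^sup>2 / (real n * real \<tau>))"
      using nnV Vsq by (subst nn_integral_eq_integral[symmetric]) auto
    then show ?thesis by simp
  qed
  \<comment> \<open>Only almost everywhere, because the selected set is known to have
    \<open>n\<close> elements only almost surely.\<close>
  have bound: "AE \<omega> in P. (norm (mean_update \<eta> t x w \<omega>))\<^sup>2 \<le> 2 * B\<^sup>2 + 2 * (norm (?V \<omega>))\<^sup>2"
    using AE_card_round_clients[OF t]
  proof eventually_elim
    case (elim \<omega>)
    let ?G = "(1 / real n) *\<^sub>R (\<Sum>i\<in>round_clients R t \<omega>. G i \<omega>)"
    have "norm (\<Sum>i\<in>round_clients R t \<omega>. G i \<omega>) \<le> real n * B"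
      using sum_norm_le[of "round_clients R t \<omega>" "\<lambda>i. G i \<omega>" "\<lambda>_. B"] G_le elim by simp
    then have "norm ?G \<le> B" using n by (simp add: field_simps)
    then have "(norm ?G)\<^sup>2 \<le> B\<^sup>2" by (intro power_mono) auto
    moreover have "mean_update \<eta> t x w \<omega> = ?G + ?V \<omega>"
      by (simp add: mean_update_def upd sum.distrib scaleR_add_right)
    ultimately show ?case
      using norm_add_sq_le[of ?G "?V \<omega>"] by simp
  qed
  have I: "integrable P (\<lambda>\<omega>. 2 * B\<^sup>2 + 2 * (norm (?V \<omega>))\<^sup>2)"
    using Vsq by auto
  then show sq: "integrable P (\<lambda>\<omega>. (norm (mean_update \<eta> t x w \<omega>))\<^sup>2)"
  proof (rule Bochner_Integration.integrable_bound)
    show "(\<lambda>\<omega>. (norm (mean_update \<eta> t x w \<omega>))\<^sup>2) \<in> borel_measurable P"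
      using mu_int by auto
    show "AE \<omega> in P. norm ((norm (mean_update \<eta> t x w \<omega>))\<^sup>2) \<le> norm (2 * B\<^sup>2 + 2 * (norm (?V \<omega>))\<^sup>2)"
      using bound by eventually_elim simp
  qed
  have "expectation (\<lambda>\<omega>. (norm (mean_update \<eta> t x w \<omega>))\<^sup>2) \<le> expectation (\<lambda>\<omega>. 2 * B\<^sup>2 + 2 * (norm (?V \<omega>))\<^sup>2)"
    using sq I bound by (rule integral_mono_AE)
  also have "\<dots> \<le> 2 * B\<^sup>2 + 2 * (\<sigma>\<^sup>2 / (real n * real \<tau>))"
    using Vsq EV by (simp add: prob_space)
  finally show "expectation (\<lambda>\<omega>. (norm (mean_update \<eta> t x w \<omega>))\<^sup>2)
      \<le> 2 * B\<^sup>2 + 2 * (\<sigma>\<^sup>2 / (real n * real \<tau>))" .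
qed

end

section \<open>The average objective and its expected descent\<close>

lemma GDERIV_isCont: "GDERIV \<phi> x :> g \<Longrightarrow> isCont \<phi> x"
  unfolding gderiv_def by (rule has_derivative_continuous)

context fedcmoo_run
begin

definition mean_obj :: "real^'d \<Rightarrow> real" where
  "mean_obj x = (\<Sum>k\<in>UNIV. avg_obj f k x) / real CARD('m)"

text \<open>The average of the separate infima, a lower bound for the average objective that need
  not be attained. It makes the initial potential equal to \<delta>.\<close>

definition min_obj :: real where
  "min_obj = (\<Sum>k\<in>UNIV. (INF x. avg_obj f k x)) / real CARD('m)"

lemma initial_gap_eq: "initial_gap f x0 = mean_obj x0 - min_obj"
  by (simp add: initial_gap_def mean_obj_def min_obj_def sum_subtractf diff_divide_distrib)

lemma min_obj_le: "min_obj \<le> mean_obj x"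
  unfolding min_obj_def mean_obj_def
  by (intro divide_right_mono sum_mono cINF_lower bounded_below) auto

lemma GDERIV_mean_obj: "GDERIV mean_obj x :> global_grad uniform_weights x"
proof -
  have "GDERIV (avg_obj f k) x :> grad (avg_obj f k) x" for k
    unfolding grad_avg_obj by (rule GDERIV_avg_obj)
  then have "GDERIV (\<lambda>x. (\<Sum>k\<in>UNIV. avg_obj f k x) / real CARD('m)) x
      :> (1 / real CARD('m)) *\<^sub>R (\<Sum>k\<in>UNIV. grad (avg_obj f k) x)"
    by (rule GDERIV_mean)
  then show ?thesis
    by (simp add: mean_obj_def[abs_def] global_grad_def uniform_weights_def scaleR_sum_right)
qed

lemma mean_obj_measurable [measurable]: "mean_obj \<in> borel_measurable borel"
  using GDERIV_isCont[OF GDERIV_mean_obj]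
  by (intro borel_measurable_continuous_onI continuous_at_imp_continuous_on) auto

lemma global_grad_measurable:
  assumes X: "X \<in> borel_measurable N" and W: "W \<in> borel_measurable N"
  shows "(\<lambda>a. global_grad (W a) (X a)) \<in> borel_measurable N"
proof -
  note X [measurable] W [measurable]
  have [measurable]: "(\<lambda>a. grad (avg_obj f k) (X a)) \<in> borel_measurable N" for k
    by (rule measurable_compose[OF X grad_avg_measurable])
  show ?thesis unfolding global_grad_def by measurable
qed

lemma global_grad_lipschitz:
  assumes "w \<in> prob_simplex"
  shows "norm (global_grad w y - global_grad w y') \<le> L * norm (y - y')"
proof -
  have "norm (global_grad w y - global_grad w y')
      = (1 / real CARD('c)) * norm (\<Sum>i\<in>UNIV. local_grad i w y - local_grad i w y')"
    by (simp add: mean_local_grad[symmetric] sum_subtractf flip: scaleR_diff_right)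
  also have "\<dots> \<le> (1 / real CARD('c)) * (\<Sum>i\<in>(UNIV::'c set). L * norm (y - y'))"
    by (intro mult_left_mono sum_norm_le local_grad_lipschitz assms) auto
  finally show ?thesis by simp
qed

lemma global_grad_diff: "global_grad w x - global_grad w' x = (\<Sum>k\<in>UNIV. (w - w') $ k *\<^sub>R grad (avg_obj f k) x)"
  by (simp add: global_grad_def sum_subtractf scaleR_diff_left)

text \<open>The errors of the descent step per unit of \<gamma>: first the bias of the update paired
  with a gradient of norm at most \<open>B\<close>, then half of \<open>L * \<gamma>\<close> times
  the second moment of the update.\<close>

definition local_error :: "real \<Rightarrow> real \<Rightarrow> real" where
  "local_error \<eta> \<gamma> = B * (L * (\<eta> * drift)) + L * \<gamma> * (B\<^sup>2 + \<sigma>\<^sup>2 / (real n * real \<tau>))"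

text \<open>Here \<open>w\<close> stands for the weights already updated in the round, held fixed.
  Nonnegativity of the bound is stated as well because \<open>ennreal\<close> truncates negative
  reals; it holds as the bound dominates the mean of a nonnegative variable.\<close>

lemma
  fixes x :: "real^'d"
  assumes t: "t < T" and w: "w \<in> prob_simplex" and \<eta>: "\<eta> > 0" and \<gamma>: "\<gamma> > 0"
  defines "r \<equiv> mean_obj x - min_obj - \<gamma> * (global_grad uniform_weights x \<bullet> global_grad w x)
      + \<gamma> * local_error \<eta> \<gamma>"
  shows local_descent_nonneg: "0 \<le> r"
    and local_descent: "(\<integral>\<^sup>+\<omega>. ennreal (mean_obj (x - \<gamma> *\<^sub>R mean_update \<eta> t x w \<omega>) - min_obj) \<partial>P) \<le> ennreal r"
proof -
  let ?g = "global_grad uniform_weights x"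
  let ?D = "mean_update \<eta> t x w"
  let ?F = "\<lambda>\<omega>. mean_obj (x - \<gamma> *\<^sub>R ?D \<omega>) - min_obj"
  let ?U = "\<lambda>\<omega>. mean_obj x - min_obj - \<gamma> * (?g \<bullet> ?D \<omega>) + L / 2 * \<gamma>\<^sup>2 * (norm (?D \<omega>))\<^sup>2"
  note D_int = mean_update_integrable[OF t w \<eta>, of x] and D_sq = mean_update_sq_integrable[OF t w \<eta>, of x]
  have [measurable]: "?D \<in> borel_measurable P" using D_int by auto
  have le: "?F \<omega> \<le> ?U \<omega>" for \<omega>
    using smooth_descent[OF GDERIV_mean_obj global_grad_lipschitz[OF uniform_weights_in_simplex],
        of "x - \<gamma> *\<^sub>R ?D \<omega>" x]
    by (simp add: power_mult_distrib)
  have U_int: "integrable P ?U"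
    using D_int D_sq by auto
  \<comment> \<open>The objective at the new point lies between its lower bound and the integrable
    quadratic model.\<close>
  have F_int: "integrable P ?F"
  proof (rule Bochner_Integration.integrable_bound[OF U_int])
    show "AE \<omega> in P. norm (?F \<omega>) \<le> norm (?U \<omega>)"
    proof (intro AE_I2)
      fix \<omega>
      have "0 \<le> ?F \<omega>" using min_obj_le by simp
      then show "norm (?F \<omega>) \<le> norm (?U \<omega>)" using le[of \<omega>] by simp
    qed
  qed measurable
  have "expectation ?F \<le> expectation ?U"
    using F_int U_int le by (rule integral_mono)
  also have "\<dots> = mean_obj x - min_obj - \<gamma> * (?g \<bullet> expectation ?D)
      + L / 2 * \<gamma>\<^sup>2 * expectation (\<lambda>\<omega>. (norm (?D \<omega>))\<^sup>2)"
    using D_int D_sq by (simp add: prob_space)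
  also have "\<dots> \<le> r"
  proof -
    have "?g \<bullet> (global_grad w x - expectation ?D) \<le> norm ?g * norm (global_grad w x - expectation ?D)"
      by (rule norm_cauchy_schwarz)
    also have "\<dots> \<le> B * (L * (\<eta> * drift))"
      using norm_global_grad_le[OF uniform_weights_in_simplex] mean_update_bias[OF t w \<eta>, of x] B_pos
      by (intro mult_mono) (auto simp: norm_minus_commute)
    finally have "\<gamma> * (?g \<bullet> global_grad w x) - \<gamma> * (?g \<bullet> expectation ?D) \<le> \<gamma> * (B * (L * (\<eta> * drift)))"
      using \<gamma> by (simp add: inner_diff_right flip: right_diff_distrib)
    moreover have "L / 2 * \<gamma>\<^sup>2 * expectation (\<lambda>\<omega>. (norm (?D \<omega>))\<^sup>2)
        \<le> L / 2 * \<gamma>\<^sup>2 * (2 * B\<^sup>2 + 2 * (\<sigma>\<^sup>2 / (real n * real \<tau>)))"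
      using mean_update_second_moment[OF t w \<eta>, of x] L_pos by (intro mult_left_mono) auto
    moreover have "L / 2 * \<gamma>\<^sup>2 * (2 * B\<^sup>2 + 2 * (\<sigma>\<^sup>2 / (real n * real \<tau>)))
        = \<gamma> * (L * \<gamma> * (B\<^sup>2 + \<sigma>\<^sup>2 / (real n * real \<tau>)))"
      by (simp add: power2_eq_square distrib_left)
    moreover have "\<gamma> * local_error \<eta> \<gamma> = \<gamma> * (B * (L * (\<eta> * drift)))
        + \<gamma> * (L * \<gamma> * (B\<^sup>2 + \<sigma>\<^sup>2 / (real n * real \<tau>)))"
      by (simp add: local_error_def distrib_left)
    ultimately show ?thesis
      unfolding r_def by linarith
  qed
  finally have le_r: "expectation ?F \<le> r" .
  have "0 \<le> expectation ?F"
    using min_obj_le by (intro Bochner_Integration.integral_nonneg) auto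
  then show "0 \<le> r" using le_r by simp
  show "(\<integral>\<^sup>+\<omega>. ennreal (?F \<omega>) \<partial>P) \<le> ennreal r"
    using le_r F_int min_obj_le by (subst nn_integral_eq_integral) (auto intro: ennreal_leI)
qed

subsection \<open>One round\<close>

definition next_weights :: "real \<Rightarrow> nat \<Rightarrow> real^'d \<Rightarrow> real^'m \<Rightarrow> 'w \<Rightarrow> real^'m" where
  "next_weights \<beta> t x w \<omega> = closest_point prob_simplex (w - \<beta> *\<^sub>R gram_vec t x w \<omega>)"

definition next_point :: "real \<Rightarrow> real \<Rightarrow> real \<Rightarrow> nat \<Rightarrow> real^'d \<Rightarrow> real^'m \<Rightarrow> 'w \<Rightarrow> real^'d" where
  "next_point \<eta> \<gamma> \<beta> t x w \<omega> = x - \<gamma> *\<^sub>R mean_update \<eta> t x (next_weights \<beta> t x w \<omega>) \<omega>"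

definition gram_matrix :: "nat \<Rightarrow> real^'d \<Rightarrow> 'w \<Rightarrow> real^'m^'m" where
  "gram_matrix t x \<omega> = transpose (gram_factor n' (gram_clients R t Gram1 \<omega>) (msg t Gram1 x \<omega>))
    ** gram_factor n' (gram_clients R t Gram2 \<omega>) (msg t Gram2 x \<omega>)"

lemma gram_matrix_mult: "gram_matrix t x \<omega> *v w = gram_vec t x w \<omega>"
  unfolding gram_matrix_def gram_mult_vec gram_vec_def col_def ..

lemma next_weights_eq: "next_weights \<beta> t x w \<omega> = weight_step \<beta> (gram_matrix t x \<omega>) w"
  by (simp add: next_weights_def weight_step_def gram_matrix_mult)

lemma fedcmoo_round_eq:
  "fedcmoo_round \<eta>l \<eta>g \<beta> \<tau> n n' sg Q R \<omega> t (x, w)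
    = (next_point \<eta>l (\<eta>g * \<eta>l * real \<tau>) \<beta> t x w \<omega>, next_weights \<beta> t x w \<omega>)"
  by (simp add: fedcmoo_round_def Let_def next_point_def next_weights_eq gram_matrix_def
      mean_update_def update_def[abs_def] msg_def[abs_def])

lemma next_weights_in_simplex: "next_weights \<beta> t x w \<omega> \<in> prob_simplex"
  unfolding next_weights_eq by (rule weight_step_in_simplex)

lemma vec_lambda_measurable:
  assumes "\<And>k. (\<lambda>a. v a k) \<in> borel_measurable N"
  shows "(\<lambda>a. (\<chi> k. v a k) :: real^'m) \<in> borel_measurable N"
  using assms by (intro borel_measurable_euclidean_space[THEN iffD2]) (auto simp: Basis_vec_def inner_axis)

lemma gram_vec_measurable:
  assumes t: "t < T" and X: "X \<in> borel_measurable N" and W: "W \<in> borel_measurable N"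
    and U: "U \<in> measurable N (alg K)" and K: "gram_draws t Gram1 \<union> gram_draws t Gram2 \<subseteq> K"
  shows "(\<lambda>a. gram_vec t (X a) (W a) (U a)) \<in> borel_measurable N"
proof -
  have [measurable]: "(\<lambda>a. col t j k (X a) (U a)) \<in> borel_measurable N" for j k
    using K by (cases j) (auto intro!: col_measurable[OF t X U])
  note W [measurable]
  show ?thesis
    unfolding gram_vec_def by (rule vec_lambda_measurable) measurable
qed

lemma next_weights_measurable:
  assumes "t < T" "X \<in> borel_measurable N" and W [measurable]: "W \<in> borel_measurable N"
    and "U \<in> measurable N (alg K)" "gram_draws t Gram1 \<union> gram_draws t Gram2 \<subseteq> K"
  shows "(\<lambda>a. next_weights \<beta> t (X a) (W a) (U a)) \<in> borel_measurable N"
proof -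
  have [measurable]: "(\<lambda>a. gram_vec t (X a) (W a) (U a)) \<in> borel_measurable N"
    by (rule gram_vec_measurable) fact+
  show ?thesis unfolding next_weights_def by measurable
qed

definition round_draws :: "nat \<Rightarrow> ('c, 'm) draw set" where
  "round_draws t = gram_draws t Gram1 \<union> gram_draws t Gram2 \<union> insert (Round_Clients t) (all_local_draws t)"

lemma next_point_measurable:
  assumes t: "t < T" and X [measurable]: "X \<in> borel_measurable N" and W: "W \<in> borel_measurable N"
    and U: "U \<in> measurable N (alg K)" and K: "round_draws t \<subseteq> K"
  shows "(\<lambda>a. next_point \<eta> \<gamma> \<beta> t (X a) (W a) (U a)) \<in> borel_measurable N"
proof -
  have "(\<lambda>a. next_weights \<beta> t (X a) (W a) (U a)) \<in> borel_measurable N"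
    using K by (intro next_weights_measurable[OF t X W U]) (auto simp: round_draws_def)
  then have [measurable]: "(\<lambda>a. mean_update \<eta> t (X a) (next_weights \<beta> t (X a) (W a) (U a)) (U a)) \<in> borel_measurable N"
    using K by (intro mean_update_measurable[OF t X _ U]) (auto simp: round_draws_def)
  show ?thesis unfolding next_point_def by measurable
qed

definition potential :: "real \<Rightarrow> real \<Rightarrow> real^'d \<Rightarrow> real^'m \<Rightarrow> real" where
  "potential \<gamma> \<beta> x w = (mean_obj x - min_obj) + \<gamma> / (2 * \<beta>) * (norm (w - uniform_weights))\<^sup>2"

text \<open>The first summand proportional to \<beta> is the lag between old and new weights in the
  descent term; the second is the quadratic term of the projected step.\<close>

definition round_error :: "real \<Rightarrow> real \<Rightarrow> real \<Rightarrow> real" where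
  "round_error \<eta> \<gamma> \<beta> = local_error \<eta> \<gamma> + \<beta> * real CARD('m) * (B\<^sup>2 * gram_bound + gram_bound\<^sup>2 / 2)"

text \<open>The round has two independent stages: the Gram draws fix the new weights, and the local
  phase then runs with these weights frozen. The squared gradient stands on the left because
  subtraction in \<open>ennreal\<close> truncates.\<close>

lemma potential_round_le:
  assumes t: "t < T" and w: "w \<in> prob_simplex" and \<eta>: "\<eta> > 0" and \<gamma>: "\<gamma> > 0" and \<beta>: "\<beta> > 0"
  shows "(\<integral>\<^sup>+\<omega>. ennreal (potential \<gamma> \<beta> (next_point \<eta> \<gamma> \<beta> t x w \<omega>) (next_weights \<beta> t x w \<omega>)) \<partial>P)
      + ennreal (\<gamma> * (norm (global_grad w x))\<^sup>2)
    \<le> ennreal (potential \<gamma> \<beta> x w + \<gamma> * round_error \<eta> \<gamma> \<beta>)"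
proof -
  let ?K = "gram_draws t Gram1 \<union> gram_draws t Gram2"
  let ?K' = "insert (Round_Clients t) (all_local_draws t)"
  have K: "?K \<inter> ?K' = {}" "?K \<union> ?K' \<subseteq> {e. in_run T \<tau> e}"
    using t by (auto simp: gram_draws_def msg_draws_def all_local_draws_def local_draws_def)
  define u where "u = (uniform_weights :: real^'m)"
  define g where "g = global_grad u x"
  \<comment> \<open>With this coefficient the cross term \<open>2 * \<beta>\<close> of the projected
    step gets weight exactly \<gamma>, the weight of the descent term it has to cancel.\<close>
  define c where "c = \<gamma> / (2 * \<beta>)"
  define w' where "w' = next_weights \<beta> t x w"
  define v where "v = gram_vec t x w"
  \<comment> \<open>\<open>a\<close> bounds the expected objective gap once the new weights are
    known. \<open>b\<close> replaces those weights by \<open>w\<close> and depends on the Gram draws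
    only through the inner product with \<open>v\<close>, its norm and its squared norm, whose means
    are controlled.\<close>
  define a where "a \<omega> = mean_obj x - min_obj - \<gamma> * (g \<bullet> global_grad (w' \<omega>) x) + \<gamma> * local_error \<eta> \<gamma>" for \<omega>
  define b where "b \<omega> = mean_obj x - min_obj - \<gamma> * (g \<bullet> global_grad w x)
      + \<gamma> * (B * (B * (sqrt (real CARD('m)) * (\<beta> * norm (v \<omega>))))) + \<gamma> * local_error \<eta> \<gamma>
      + c * (norm (w - u))\<^sup>2 - \<gamma> * ((w - u) \<bullet> v \<omega>) + \<gamma> * \<beta> / 2 * (norm (v \<omega>))\<^sup>2" for \<omega>
  have u: "u \<in> prob_simplex" unfolding u_def by (rule uniform_weights_in_simplex)
  have c: "c \<ge> 0" "c * (2 * \<beta>) = \<gamma>" "c * \<beta>\<^sup>2 = \<gamma> * \<beta> / 2"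
    using \<gamma> \<beta> by (auto simp: c_def power2_eq_square)
  \<comment> \<open>The new weights are determined by the Gram draws, hence independent of the
    client selection and the local samples in \<open>?K'\<close>.\<close>
  have w'_alg: "w' \<in> borel_measurable (alg ?K)"
    using next_weights_measurable[OF t, of "\<lambda>_. x" "alg ?K" "\<lambda>_. w" "\<lambda>\<omega>. \<omega>" ?K \<beta>] by (simp add: w'_def)
  have w'M [measurable]: "w' \<in> borel_measurable P"
    using measurable_alg_imp[OF w'_alg] K by auto
  have w'_simplex: "w' \<omega> \<in> prob_simplex" for \<omega>
    unfolding w'_def by (rule next_weights_in_simplex)
  have muM: "(\<lambda>(w, \<omega>). mean_update \<eta> t x w \<omega>) \<in> borel_measurable (borel \<Otimes>\<^sub>M alg ?K')"
    unfolding case_prod_beta' by (rule mean_update_measurable[OF t, where K = ?K']) auto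
  have hM: "(\<lambda>(w, \<omega>). ennreal (mean_obj (x - \<gamma> *\<^sub>R mean_update \<eta> t x w \<omega>) - min_obj))
      \<in> borel_measurable (borel \<Otimes>\<^sub>M alg ?K')"
    using muM by measurable
  have next_eq: "next_point \<eta> \<gamma> \<beta> t x w \<omega> = x - \<gamma> *\<^sub>R mean_update \<eta> t x (w' \<omega>) \<omega>" for \<omega>
    by (simp add: next_point_def w'_def)
  have [measurable]: "next_point \<eta> \<gamma> \<beta> t x w \<in> borel_measurable P"
    using next_point_measurable[OF t, of "\<lambda>_. x" P "\<lambda>_. w" "\<lambda>\<omega>. \<omega>" "round_draws t" \<eta> \<gamma> \<beta>] measurable_id_alg[of "round_draws t"] K by (simp add: round_draws_def)
  have a_nonneg: "0 \<le> a \<omega>" for \<omega>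
    unfolding a_def g_def u_def by (rule local_descent_nonneg[OF t w'_simplex \<eta> \<gamma>])
  have "(\<integral>\<^sup>+\<omega>. ennreal (mean_obj (next_point \<eta> \<gamma> \<beta> t x w \<omega>) - min_obj) \<partial>P)
      = (\<integral>\<^sup>+\<omega>. (\<integral>\<^sup>+\<omega>'. ennreal (mean_obj (x - \<gamma> *\<^sub>R mean_update \<eta> t x (w' \<omega>) \<omega>') - min_obj) \<partial>P) \<partial>P)"
    unfolding next_eq by (rule nn_integral_freeze[OF K w'_alg hM])
  also have "\<dots> \<le> (\<integral>\<^sup>+\<omega>. ennreal (a \<omega>) \<partial>P)"
    unfolding a_def g_def u_def by (intro nn_integral_mono local_descent[OF t w'_simplex \<eta> \<gamma>])
  finally have obj: "(\<integral>\<^sup>+\<omega>. ennreal (mean_obj (next_point \<eta> \<gamma> \<beta> t x w \<omega>) - min_obj) \<partial>P)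
      \<le> (\<integral>\<^sup>+\<omega>. ennreal (a \<omega>) \<partial>P)" .
  have aM [measurable]: "a \<in> borel_measurable P"
    using global_grad_measurable[of "\<lambda>_. x" P w'] unfolding a_def[abs_def] by measurable
  \<comment> \<open>Two uses of the projected step: its short length moves the descent term from the
    new weights back to \<open>w\<close>, and its squared-distance inequality treats the weight part
    of the potential.\<close>
  have a_le_b: "a \<omega> + c * (norm (w' \<omega> - u))\<^sup>2 \<le> b \<omega>" for \<omega>
  proof -
    have "g \<bullet> (global_grad w x - global_grad (w' \<omega>) x) \<le> norm g * norm (global_grad w x - global_grad (w' \<omega>) x)"
      by (rule norm_cauchy_schwarz)
    also have "\<dots> \<le> B * (B * (sqrt (real CARD('m)) * norm (w - w' \<omega>)))"
      using norm_global_grad_le[OF u] B_pos unfolding global_grad_diff g_def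
      by (intro mult_mono norm_vec_sum_le norm_grad_avg_le) auto
    also have "\<dots> \<le> B * (B * (sqrt (real CARD('m)) * (\<beta> * norm (v \<omega>))))"
      using norm_weight_step_move_le[OF w, of \<beta> "gram_matrix t x \<omega>"] \<beta> B_pos
      by (intro mult_left_mono)
        (auto simp: w'_def v_def next_weights_eq gram_matrix_mult norm_minus_commute)
    finally have "\<gamma> * (g \<bullet> global_grad w x) - \<gamma> * (g \<bullet> global_grad (w' \<omega>) x)
        \<le> \<gamma> * (B * (B * (sqrt (real CARD('m)) * (\<beta> * norm (v \<omega>)))))"
      using \<gamma> by (simp add: inner_diff_right flip: right_diff_distrib)
    moreover have "c * (norm (w' \<omega> - u))\<^sup>2
        \<le> c * ((norm (w - u))\<^sup>2 - 2 * \<beta> * ((w - u) \<bullet> v \<omega>) + \<beta>\<^sup>2 * (norm (v \<omega>))\<^sup>2)"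
      using norm_weight_step_sq_le[OF u, of \<beta> "gram_matrix t x \<omega>" w] c(1)
      by (intro mult_left_mono) (auto simp: w'_def v_def next_weights_eq gram_matrix_mult)
    moreover have "\<dots> = c * (norm (w - u))\<^sup>2 - c * (2 * \<beta>) * ((w - u) \<bullet> v \<omega>) + c * \<beta>\<^sup>2 * (norm (v \<omega>))\<^sup>2"
      by (simp add: algebra_simps)
    ultimately show "a \<omega> + c * (norm (w' \<omega> - u))\<^sup>2 \<le> b \<omega>"
      unfolding a_def b_def c(2,3) by linarith
  qed
  have "(\<integral>\<^sup>+\<omega>. ennreal (potential \<gamma> \<beta> (next_point \<eta> \<gamma> \<beta> t x w \<omega>) (w' \<omega>)) \<partial>P)
      = (\<integral>\<^sup>+\<omega>. ennreal (mean_obj (next_point \<eta> \<gamma> \<beta> t x w \<omega>) - min_obj) + ennreal (c * (norm (w' \<omega> - u))\<^sup>2) \<partial>P)"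
  proof (rule nn_integral_cong)
    fix \<omega>
    have "0 \<le> mean_obj (next_point \<eta> \<gamma> \<beta> t x w \<omega>) - min_obj" "0 \<le> c * (norm (w' \<omega> - u))\<^sup>2"
      using c(1) min_obj_le by simp_all
    then show "ennreal (potential \<gamma> \<beta> (next_point \<eta> \<gamma> \<beta> t x w \<omega>) (w' \<omega>))
        = ennreal (mean_obj (next_point \<eta> \<gamma> \<beta> t x w \<omega>) - min_obj) + ennreal (c * (norm (w' \<omega> - u))\<^sup>2)"
      unfolding potential_def c_def u_def by (rule ennreal_plus)
  qed
  also have "\<dots> = (\<integral>\<^sup>+\<omega>. ennreal (mean_obj (next_point \<eta> \<gamma> \<beta> t x w \<omega>) - min_obj) \<partial>P)
      + (\<integral>\<^sup>+\<omega>. ennreal (c * (norm (w' \<omega> - u))\<^sup>2) \<partial>P)"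
    by (intro nn_integral_add) measurable
  also have "\<dots> \<le> (\<integral>\<^sup>+\<omega>. ennreal (a \<omega>) \<partial>P) + (\<integral>\<^sup>+\<omega>. ennreal (c * (norm (w' \<omega> - u))\<^sup>2) \<partial>P)"
    by (intro add_right_mono obj)
  also have "\<dots> = (\<integral>\<^sup>+\<omega>. ennreal (a \<omega> + c * (norm (w' \<omega> - u))\<^sup>2) \<partial>P)"
    using a_nonneg c(1) by (simp add: nn_integral_add)
  also have "\<dots> \<le> (\<integral>\<^sup>+\<omega>. ennreal (b \<omega>) \<partial>P)"
    by (intro nn_integral_mono ennreal_leI a_le_b)
  finally have le_b: "(\<integral>\<^sup>+\<omega>. ennreal (potential \<gamma> \<beta> (next_point \<eta> \<gamma> \<beta> t x w \<omega>) (w' \<omega>)) \<partial>P)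
      \<le> (\<integral>\<^sup>+\<omega>. ennreal (b \<omega>) \<partial>P)" .

  have vM [measurable]: "v \<in> borel_measurable P"
    using gram_vec_measurable[OF t, of "\<lambda>_. x" P "\<lambda>_. w" "\<lambda>\<omega>. \<omega>" ?K] measurable_id_alg[of ?K] K
    by (simp add: v_def)
  have v_sq: "integrable P (\<lambda>\<omega>. (norm (v \<omega>))\<^sup>2)"
    and v_sq_le: "expectation (\<lambda>\<omega>. (norm (v \<omega>))\<^sup>2) \<le> real CARD('m) * gram_bound\<^sup>2"
    unfolding v_def using gram_vec_sq_integrable[OF t w] gram_vec_second_moment[OF t w] by auto
  have nn_v: "(\<integral>\<^sup>+\<omega>. ennreal ((norm (v \<omega>))\<^sup>2) \<partial>P) \<le> ennreal (real CARD('m) * gram_bound\<^sup>2)"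
    using v_sq v_sq_le by (subst nn_integral_eq_integral) (auto intro: ennreal_leI)
  have v_norm: "integrable P (\<lambda>\<omega>. norm (v \<omega>))"
    using integrable_of_sq_norm[OF vM, of 0] nn_v by auto
  have "expectation (\<lambda>\<omega>. norm (v \<omega>)) \<le> sqrt (real CARD('m) * gram_bound\<^sup>2)"
    using vM nn_v by (intro expectation_norm_le_sqrt) auto
  then have v_le: "expectation (\<lambda>\<omega>. norm (v \<omega>)) \<le> sqrt (real CARD('m)) * gram_bound"
    using gram_bound_nonneg by (simp add: real_sqrt_mult)
  have wv: "integrable P (\<lambda>\<omega>. (w - u) \<bullet> v \<omega>)"
    and "expectation (\<lambda>\<omega>. (w - u) \<bullet> v \<omega>) = (global_grad w x - g) \<bullet> global_grad w x"
    unfolding v_def g_def global_grad_diff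
    using inner_gram_vec_integrable[OF t] inner_gram_vec_expectation[OF t, of "w - u" x w]
    by (simp_all add: global_grad_def)
  \<comment> \<open>The cancellation: minus \<gamma> times this mean supplies minus the squared
    gradient, and its \<open>g\<close>-term removes the inner product left by the descent
    step.\<close>
  then have wv_mean: "expectation (\<lambda>\<omega>. (w - u) \<bullet> v \<omega>)
      = (norm (global_grad w x))\<^sup>2 - g \<bullet> global_grad w x"
    by (simp add: inner_diff_left power2_norm_eq_inner)
  have b_int: "integrable P b"
    unfolding b_def[abs_def] using v_sq v_norm wv by (intro Bochner_Integration.integrable_add
        Bochner_Integration.integrable_diff integrable_mult_right) auto
  have "expectation b = mean_obj x - min_obj - \<gamma> * (g \<bullet> global_grad w x)
      + \<gamma> * (B * (B * (sqrt (real CARD('m)) * (\<beta> * expectation (\<lambda>\<omega>. norm (v \<omega>)))))) + \<gamma> * local_error \<eta> \<gamma>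
      + c * (norm (w - u))\<^sup>2 - \<gamma> * expectation (\<lambda>\<omega>. (w - u) \<bullet> v \<omega>)
      + \<gamma> * \<beta> / 2 * expectation (\<lambda>\<omega>. (norm (v \<omega>))\<^sup>2)"
    unfolding b_def[abs_def] using v_sq v_norm wv by (simp add: prob_space del: inner_diff_left)
  also have "\<dots> \<le> potential \<gamma> \<beta> x w - \<gamma> * (norm (global_grad w x))\<^sup>2 + \<gamma> * round_error \<eta> \<gamma> \<beta>"
  proof -
    have "\<gamma> * (B * (B * (sqrt (real CARD('m)) * (\<beta> * expectation (\<lambda>\<omega>. norm (v \<omega>))))))
      \<le> \<gamma> * (B * (B * (sqrt (real CARD('m)) * (\<beta> * (sqrt (real CARD('m)) * gram_bound)))))"
      using \<gamma> \<beta> B_pos v_le by (intro mult_left_mono) auto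
    also have "\<dots> = \<gamma> * (\<beta> * real CARD('m) * (B\<^sup>2 * gram_bound))"
      by (simp add: power2_eq_square)
    finally have 1: "\<gamma> * (B * (B * (sqrt (real CARD('m)) * (\<beta> * expectation (\<lambda>\<omega>. norm (v \<omega>))))))
      \<le> \<gamma> * (\<beta> * real CARD('m) * (B\<^sup>2 * gram_bound))" .
    have 2: "\<gamma> * \<beta> / 2 * expectation (\<lambda>\<omega>. (norm (v \<omega>))\<^sup>2) \<le> \<gamma> * \<beta> / 2 * (real CARD('m) * gram_bound\<^sup>2)"
      using \<gamma> \<beta> v_sq_le by (intro mult_left_mono) auto
    show ?thesis
      using 1 2 unfolding wv_mean unfolding potential_def round_error_def c_def u_def by (simp add: algebra_simps)
  qed
  finally have Eb: "expectation b + \<gamma> * (norm (global_grad w x))\<^sup>2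
      \<le> potential \<gamma> \<beta> x w + \<gamma> * round_error \<eta> \<gamma> \<beta>" by simp
  \<comment> \<open>Needed to identify the Lebesgue integral of \<open>b\<close> with its
    expectation.\<close>
  have b_nonneg: "0 \<le> b \<omega>" for \<omega>
    using a_le_b[of \<omega>] a_nonneg[of \<omega>] c(1) by (smt (verit) mult_nonneg_nonneg zero_le_power2)
  have "(\<integral>\<^sup>+\<omega>. ennreal (b \<omega>) \<partial>P) + ennreal (\<gamma> * (norm (global_grad w x))\<^sup>2)
      = ennreal (expectation b + \<gamma> * (norm (global_grad w x))\<^sup>2)"
    using b_int b_nonneg \<gamma> by (simp add: nn_integral_eq_integral Bochner_Integration.integral_nonneg)
  also have "\<dots> \<le> ennreal (potential \<gamma> \<beta> x w + \<gamma> * round_error \<eta> \<gamma> \<beta>)"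
    by (intro ennreal_leI Eb)
  finally show ?thesis
    using add_right_mono[OF le_b] unfolding w'_def by (rule order_trans[rotated])
qed

subsection \<open>The whole run\<close>

text \<open>The predicate for a whole run with its horizon shortened to \<open>t\<close>: the draws
  of the rounds strictly before \<open>t\<close>, which determine the state entering round
  \<open>t\<close>.\<close>

definition past_draws :: "nat \<Rightarrow> ('c, 'm) draw set" where
  "past_draws t = {e. in_run t \<tau> e}"

lemma past_draws_mono: "t \<le> t' \<Longrightarrow> past_draws t \<subseteq> past_draws t'"
proof
  fix e assume "t \<le> t'" "e \<in> past_draws t"
  then show "e \<in> past_draws t'" by (cases e) (auto simp: past_draws_def)
qed

lemma round_draws_subset: "round_draws t \<subseteq> past_draws (Suc t)"
  by (auto simp: round_draws_def past_draws_def gram_draws_def msg_draws_def all_local_draws_def local_draws_def)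

lemma past_draws_disjoint: "past_draws t \<inter> round_draws t = {}"
  by (auto simp: round_draws_def past_draws_def gram_draws_def msg_draws_def all_local_draws_def local_draws_def)

context
  fixes \<eta>l \<eta>g \<beta> \<gamma> :: real and x0 :: "real^'d"
  assumes \<eta>l: "\<eta>l > 0" and \<beta>: "\<beta> > 0" and \<gamma>: "\<gamma> > 0" and \<gamma>_eq: "\<gamma> = \<eta>g * \<eta>l * real \<tau>"
begin

definition point :: "nat \<Rightarrow> 'w \<Rightarrow> real^'d" where
  "point t \<omega> = fst (fedcmoo \<eta>l \<eta>g \<beta> \<tau> n n' sg Q R x0 \<omega> t)"

definition weights :: "nat \<Rightarrow> 'w \<Rightarrow> real^'m" where
  "weights t \<omega> = snd (fedcmoo \<eta>l \<eta>g \<beta> \<tau> n n' sg Q R x0 \<omega> t)"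

lemma point_0: "point 0 \<omega> = x0" and weights_0: "weights 0 \<omega> = uniform_weights"
  by (simp_all add: point_def weights_def uniform_weights_def)

lemma
  shows point_Suc: "point (Suc t) \<omega> = next_point \<eta>l \<gamma> \<beta> t (point t \<omega>) (weights t \<omega>) \<omega>"
    and weights_Suc: "weights (Suc t) \<omega> = next_weights \<beta> t (point t \<omega>) (weights t \<omega>) \<omega>"
  using fedcmoo_round_eq[of \<eta>l \<eta>g \<beta> \<omega> t "point t \<omega>" "weights t \<omega>"]
  by (simp_all add: point_def weights_def \<gamma>_eq)

lemma weights_in_simplex: "weights t \<omega> \<in> prob_simplex"
  by (cases t) (simp_all add: weights_0 weights_Suc uniform_weights_in_simplex next_weights_in_simplex)

lemma state_measurable:
  "t \<le> T \<Longrightarrow> point t \<in> borel_measurable (alg (past_draws t)) \<and> weights t \<in> borel_measurable (alg (past_draws t))"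
proof (induction t)
  case 0
  have "point 0 = (\<lambda>_. x0)" "weights 0 = (\<lambda>_. uniform_weights)"
    by (simp_all add: point_0 weights_0 fun_eq_iff)
  then show ?case by simp
next
  case (Suc t)
  let ?N = "alg (past_draws (Suc t))"
  have *: "point t \<in> borel_measurable ?N" "weights t \<in> borel_measurable ?N"
    using Suc measurable_alg_mono[OF _ past_draws_mono[of t "Suc t"]] by auto
  have t: "t < T" and id: "(\<lambda>\<omega>. \<omega>) \<in> measurable ?N ?N"
    using Suc.prems by auto
  have "(\<lambda>\<omega>. next_point \<eta>l \<gamma> \<beta> t (point t \<omega>) (weights t \<omega>) \<omega>) \<in> borel_measurable ?N"
    by (rule next_point_measurable[OF t * id round_draws_subset])
  moreover have "(\<lambda>\<omega>. next_weights \<beta> t (point t \<omega>) (weights t \<omega>) \<omega>) \<in> borel_measurable ?N"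
    using round_draws_subset[of t] by (intro next_weights_measurable[OF t * id]) (auto simp: round_draws_def)
  ultimately show ?case
    by (simp add: point_Suc[abs_def] weights_Suc[abs_def])
qed

lemma
  assumes "t \<le> T"
  shows point_measurable: "point t \<in> borel_measurable P"
    and weights_measurable: "weights t \<in> borel_measurable P"
  using state_measurable[OF assms] past_draws_mono[OF assms]
  by (auto intro!: measurable_alg_imp[where K = "past_draws t"] simp: past_draws_def)

lemma potential_measurable:
  assumes [measurable]: "X \<in> borel_measurable N" "W \<in> borel_measurable N"
  shows "(\<lambda>a. potential \<gamma> \<beta> (X a) (W a)) \<in> borel_measurable N"
  unfolding potential_def by measurable

lemma potential_nonneg: "0 \<le> potential \<gamma> \<beta> x w"
  using min_obj_le[of x] \<beta> \<gamma> by (simp add: potential_def)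

lemma round_error_nonneg: "0 \<le> round_error \<eta>l \<gamma> \<beta>"
  using \<eta>l \<beta> \<gamma> B_pos L_pos gram_bound_nonneg
  by (simp add: round_error_def local_error_def drift_def)

lemma expected_potential_Suc:
  assumes t: "t < T"
  shows "(\<integral>\<^sup>+\<omega>. ennreal (potential \<gamma> \<beta> (point (Suc t) \<omega>) (weights (Suc t) \<omega>)) \<partial>P)
      + (\<integral>\<^sup>+\<omega>. ennreal (\<gamma> * (norm (global_grad (weights t \<omega>) (point t \<omega>)))\<^sup>2) \<partial>P)
    \<le> (\<integral>\<^sup>+\<omega>. ennreal (potential \<gamma> \<beta> (point t \<omega>) (weights t \<omega>)) \<partial>P) + ennreal (\<gamma> * round_error \<eta>l \<gamma> \<beta>)"
proof -
  let ?K = "past_draws t" and ?K' = "round_draws t"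
  have "past_draws (Suc t) \<subseteq> past_draws T"
    using t by (intro past_draws_mono) simp
  then have K: "?K \<inter> ?K' = {}" "?K \<union> ?K' \<subseteq> {e. in_run T \<tau> e}"
    using past_draws_disjoint round_draws_subset[of t] past_draws_mono[of t "Suc t"]
    by (auto simp: past_draws_def)
  have pM [measurable]: "point t \<in> borel_measurable P" and wM [measurable]: "weights t \<in> borel_measurable P"
    using t by (auto intro: point_measurable weights_measurable)
  have gM [measurable]: "(\<lambda>\<omega>. global_grad (weights t \<omega>) (point t \<omega>)) \<in> borel_measurable P"
    by (rule global_grad_measurable[OF pM wM])
  have potM [measurable]: "(\<lambda>\<omega>. potential \<gamma> \<beta> (point t \<omega>) (weights t \<omega>)) \<in> borel_measurable P"
    by (rule potential_measurable[OF pM wM])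
  have X: "(\<lambda>\<omega>. (point t \<omega>, weights t \<omega>)) \<in> measurable (alg ?K) (borel \<Otimes>\<^sub>M borel)"
    using state_measurable[of t] t by (intro measurable_Pair) auto
  let ?N = "(borel \<Otimes>\<^sub>M borel) \<Otimes>\<^sub>M alg ?K' :: (((real^'d) \<times> (real^'m)) \<times> 'w) measure"
  have arg: "(\<lambda>a. fst (fst a)) \<in> borel_measurable ?N" "(\<lambda>a. snd (fst a)) \<in> borel_measurable ?N"
      "snd \<in> measurable ?N (alg ?K')"
    by measurable
  let ?h = "\<lambda>s \<omega>. ennreal (potential \<gamma> \<beta> (next_point \<eta>l \<gamma> \<beta> t (fst s) (snd s) \<omega>) (next_weights \<beta> t (fst s) (snd s) \<omega>))"
  have hM: "(\<lambda>(s, \<omega>). ?h s \<omega>) \<in> borel_measurable ?N"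
    unfolding case_prod_beta'
    by (intro measurable_compose[OF _ measurable_ennreal] potential_measurable
        next_point_measurable[OF t arg] next_weights_measurable[OF t arg]) (auto simp: round_draws_def)
  let ?c = "\<lambda>s :: (real^'d) \<times> (real^'m). ennreal (\<gamma> * (norm (global_grad (snd s) (fst s)))\<^sup>2)"
  have cM: "(\<lambda>(s, \<omega>). ?h s \<omega> + ?c s) \<in> borel_measurable ?N"
  proof -
    have [measurable]: "(\<lambda>a. global_grad (snd (fst a)) (fst (fst a))) \<in> borel_measurable ?N"
      by (rule global_grad_measurable[OF arg(1,2)])
    have "(\<lambda>a. ?c (fst a)) \<in> borel_measurable ?N" by measurable
    from borel_measurable_add[OF hM this] show ?thesis by (simp add: case_prod_beta')
  qed
  have id: "(\<lambda>\<omega>. \<omega>) \<in> measurable P (alg ?K')"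
    using K by (intro measurable_id_alg) auto
  have hP: "?h s \<in> borel_measurable P" for s
    by (intro measurable_compose[OF _ measurable_ennreal] potential_measurable
        next_point_measurable[OF t _ _ id] next_weights_measurable[OF t _ _ id]) (auto simp: round_draws_def)
  have hX: "(\<lambda>\<omega>. ?h (point t \<omega>, weights t \<omega>) \<omega>) \<in> borel_measurable P"
    using pM wM by (intro measurable_compose[OF _ measurable_ennreal] potential_measurable
        next_point_measurable[OF t _ _ id] next_weights_measurable[OF t _ _ id]) (auto simp: round_draws_def)
  have "(\<integral>\<^sup>+\<omega>. ennreal (potential \<gamma> \<beta> (point (Suc t) \<omega>) (weights (Suc t) \<omega>)) \<partial>P)
      + (\<integral>\<^sup>+\<omega>. ennreal (\<gamma> * (norm (global_grad (weights t \<omega>) (point t \<omega>)))\<^sup>2) \<partial>P)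
      = (\<integral>\<^sup>+\<omega>. ?h (point t \<omega>, weights t \<omega>) \<omega> + ?c (point t \<omega>, weights t \<omega>) \<partial>P)"
    unfolding point_Suc weights_Suc using hX by (subst nn_integral_add) simp_all
  also have "\<dots> = (\<integral>\<^sup>+\<omega>. (\<integral>\<^sup>+\<omega>'. ?h (point t \<omega>, weights t \<omega>) \<omega>' + ?c (point t \<omega>, weights t \<omega>) \<partial>P) \<partial>P)"
    by (rule nn_integral_freeze[OF K X cM])
  also have "\<dots> = (\<integral>\<^sup>+\<omega>. (\<integral>\<^sup>+\<omega>'. ?h (point t \<omega>, weights t \<omega>) \<omega>' \<partial>P) + ?c (point t \<omega>, weights t \<omega>) \<partial>P)"
    by (intro nn_integral_cong, subst nn_integral_add[OF hP]) (auto simp: emeasure_space_1)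
  also have "\<dots> \<le> (\<integral>\<^sup>+\<omega>. ennreal (potential \<gamma> \<beta> (point t \<omega>) (weights t \<omega>) + \<gamma> * round_error \<eta>l \<gamma> \<beta>) \<partial>P)"
    unfolding fst_conv snd_conv
    by (intro nn_integral_mono potential_round_le[OF t weights_in_simplex \<eta>l \<gamma> \<beta>])
  also have "\<dots> = (\<integral>\<^sup>+\<omega>. ennreal (potential \<gamma> \<beta> (point t \<omega>) (weights t \<omega>)) \<partial>P) + ennreal (\<gamma> * round_error \<eta>l \<gamma> \<beta>)"
    using potential_nonneg round_error_nonneg \<gamma> by (simp add: nn_integral_add emeasure_space_1)
  finally show ?thesis .
qed

text \<open>Telescoping without subtraction: the gradient terms of past rounds accumulate on the
  left, next to the current potential.\<close>

lemma expected_potential_le: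
  "t \<le> T \<Longrightarrow> (\<integral>\<^sup>+\<omega>. ennreal (potential \<gamma> \<beta> (point t \<omega>) (weights t \<omega>)) \<partial>P)
      + (\<Sum>s<t. \<integral>\<^sup>+\<omega>. ennreal (\<gamma> * (norm (global_grad (weights s \<omega>) (point s \<omega>)))\<^sup>2) \<partial>P)
    \<le> ennreal (initial_gap f x0 + real t * (\<gamma> * round_error \<eta>l \<gamma> \<beta>))"
proof (induction t)
  case 0
  then show ?case
    by (simp add: point_0 weights_0 potential_def initial_gap_eq emeasure_space_1)
next
  case (Suc t)
  let ?G = "\<lambda>s. \<integral>\<^sup>+\<omega>. ennreal (\<gamma> * (norm (global_grad (weights s \<omega>) (point s \<omega>)))\<^sup>2) \<partial>P"
  let ?E = "\<lambda>t. \<integral>\<^sup>+\<omega>. ennreal (potential \<gamma> \<beta> (point t \<omega>) (weights t \<omega>)) \<partial>P"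
  have "?E (Suc t) + (\<Sum>s<Suc t. ?G s) = (?E (Suc t) + ?G t) + (\<Sum>s<t. ?G s)"
    by (simp add: ac_simps)
  also have "\<dots> \<le> (?E t + ennreal (\<gamma> * round_error \<eta>l \<gamma> \<beta>)) + (\<Sum>s<t. ?G s)"
    using Suc.prems by (intro add_right_mono expected_potential_Suc) simp
  also have "\<dots> = (?E t + (\<Sum>s<t. ?G s)) + ennreal (\<gamma> * round_error \<eta>l \<gamma> \<beta>)"
    by (simp add: ac_simps)
  also have "\<dots> \<le> ennreal (initial_gap f x0 + real t * (\<gamma> * round_error \<eta>l \<gamma> \<beta>)) + ennreal (\<gamma> * round_error \<eta>l \<gamma> \<beta>)"
    using Suc by (intro add_right_mono) simp
  also have "\<dots> = ennreal (initial_gap f x0 + real (Suc t) * (\<gamma> * round_error \<eta>l \<gamma> \<beta>))"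
  proof -
    have "0 \<le> initial_gap f x0 + real t * (\<gamma> * round_error \<eta>l \<gamma> \<beta>)" "0 \<le> \<gamma> * round_error \<eta>l \<gamma> \<beta>"
      using min_obj_le[of x0] round_error_nonneg \<gamma> by (simp_all add: initial_gap_eq)
    then show ?thesis
      by (subst ennreal_plus[symmetric]) (auto simp: algebra_simps)
  qed
  finally show ?case .
qed

lemma sum_expected_sq_norm_le:
  "(\<Sum>t<T. expectation (\<lambda>\<omega>. (norm (global_grad (weights t \<omega>) (point t \<omega>)))\<^sup>2))
    \<le> initial_gap f x0 / \<gamma> + real T * round_error \<eta>l \<gamma> \<beta>"
proof -
  let ?g = "\<lambda>t \<omega>. (norm (global_grad (weights t \<omega>) (point t \<omega>)))\<^sup>2"
  have int: "integrable P (?g t)" if "t < T" for t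
  proof (rule integrable_const_bound[where B = "B\<^sup>2"])
    show "AE \<omega> in P. norm (?g t \<omega>) \<le> B\<^sup>2"
      using norm_global_grad_le[OF weights_in_simplex] by (intro AE_I2) (simp add: power_mono)
    have "(\<lambda>\<omega>. global_grad (weights t \<omega>) (point t \<omega>)) \<in> borel_measurable P"
      using that by (intro global_grad_measurable point_measurable weights_measurable) auto
    then show "?g t \<in> borel_measurable P" by measurable
  qed
  have "ennreal (\<gamma> * (\<Sum>t<T. expectation (?g t))) = (\<Sum>t<T. \<integral>\<^sup>+\<omega>. ennreal (\<gamma> * ?g t \<omega>) \<partial>P)"
  proof -
    have "ennreal (\<gamma> * expectation (?g t)) = (\<integral>\<^sup>+\<omega>. ennreal (\<gamma> * ?g t \<omega>) \<partial>P)" if "t < T" for t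
      using int[OF that] \<gamma> by (subst nn_integral_eq_integral) auto
    then have "(\<Sum>t<T. \<integral>\<^sup>+\<omega>. ennreal (\<gamma> * ?g t \<omega>) \<partial>P) = (\<Sum>t<T. ennreal (\<gamma> * expectation (?g t)))"
      by simp
    also have "\<dots> = ennreal (\<gamma> * (\<Sum>t<T. expectation (?g t)))"
      using \<gamma> by (subst sum_ennreal) (auto simp: sum_distrib_left intro!: mult_nonneg_nonneg)
    finally show ?thesis by simp
  qed
  \<comment> \<open>The final potential is nonnegative, so it may be added freely to match the
    telescoped inequality.\<close>
  also have "\<dots> \<le> (\<integral>\<^sup>+\<omega>. ennreal (potential \<gamma> \<beta> (point T \<omega>) (weights T \<omega>)) \<partial>P)
      + (\<Sum>t<T. \<integral>\<^sup>+\<omega>. ennreal (\<gamma> * ?g t \<omega>) \<partial>P)"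
    by simp
  also have "\<dots> \<le> ennreal (initial_gap f x0 + real T * (\<gamma> * round_error \<eta>l \<gamma> \<beta>))"
    by (rule expected_potential_le) simp
  finally have "\<gamma> * (\<Sum>t<T. expectation (?g t)) \<le> initial_gap f x0 + real T * (\<gamma> * round_error \<eta>l \<gamma> \<beta>)"
    using min_obj_le[of x0] round_error_nonneg \<gamma> by (subst (asm) ennreal_le_iff) (auto simp: initial_gap_eq)
  then have "(\<Sum>t<T. expectation (?g t)) \<le> (initial_gap f x0 + real T * (\<gamma> * round_error \<eta>l \<gamma> \<beta>)) / \<gamma>"
    using \<gamma> by (simp add: field_simps)
  then show ?thesis
    using \<gamma> by (simp add: add_divide_distrib)
qed

end

end

section \<open>Step sizes and numerical constants\<close>

theorem corollary1:
  fixes f :: "'c::finite \<Rightarrow> 'm::finite \<Rightarrow> real^'d \<Rightarrow> real"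
    and L B q \<sigma> \<sigma>g \<eta>l \<eta>g \<beta> C1 \<delta> :: real
    and T \<tau> n n' :: nat
    and P :: "'w measure" and D :: "'c \<Rightarrow> 's measure" and Z :: "'z measure"
    and sg :: "'c \<Rightarrow> 'm \<Rightarrow> 's \<Rightarrow> real^'d \<Rightarrow> real^'d" and Q :: "'z \<Rightarrow> real^'d \<Rightarrow> real^'d"
    and R :: "('w, 'c, 'm, 's, 'z) draws"
    and x0 :: "real^'d"
  assumes "CARD('c) \<ge> 2"
    and "L > 0" and "B > 0" and "q > 0"
    and "T \<ge> 1" and "\<tau> \<ge> 1"
    and "1 \<le> n" and "n \<le> CARD('c)"
    and "1 \<le> n'" and "n' \<le> CARD('c)"
    and differentiable: "\<forall>i k x. f i k differentiable (at x)"
    and bounded_below: "\<forall>k. bdd_below (range (avg_obj f k))"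
    and A1: "\<forall>i k x x'. norm (grad (f i k) x - grad (f i k) x') \<le> L * norm (x - x')"
    and A2: "stochastic_gradients D sg f \<sigma>"
    and A3: "\<forall>k x. (\<Sum>i\<in>UNIV. (norm (grad (f i k) x - grad (avg_obj f k) x))\<^sup>2) / real CARD('c)
               \<le> \<sigma>g\<^sup>2"
    and A4: "\<forall>i k x. norm (grad (f i k) x) \<le> B"
    and A5: "compressor Z Q q"
    and draws: "run_draws P D Z T \<tau> n n' R"
    and \<eta>l: "\<eta>l = 1 / (L * real \<tau> * sqrt (real \<tau> * real T))"
    and \<eta>g: "\<eta>g = sqrt (real \<tau>)"
    and \<beta>: "\<beta> = 1 / (real CARD('m) * sqrt (real T))"
    and "\<eta>l \<le> 1 / (2 * L * real \<tau>)"
    and C1: "C1 = (q + 1) / real n' * \<sigma>\<^sup>2 + q * B\<^sup>2 / real n'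
               + (real CARD('c) - real n') / (real n' * (real CARD('c) - 1)) * \<sigma>g\<^sup>2 + B\<^sup>2"
    and \<delta>: "\<delta> = initial_gap f x0"
  shows "(1 / real T) * (\<Sum>t<T. \<integral>\<omega>.
             (let (x, w) = fedcmoo \<eta>l \<eta>g \<beta> \<tau> n n' sg Q R x0 \<omega> t
              in (norm (\<Sum>k\<in>UNIV. w $ k *\<^sub>R grad (avg_obj f k) x))\<^sup>2) \<partial>P)
         \<le> 10 * ((B\<^sup>2 + C1\<^sup>2 + L * \<delta>) / sqrt (real T))
           + 10 * (\<sigma>\<^sup>2 / (real \<tau> * sqrt (real T)) * (1 / real n + 1 / real \<tau>))"
proof -
  interpret run: fedcmoo_run f L B q \<sigma> T \<tau> n n' P D Z sg Q R
    by unfold_locales (use assms in auto)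
  define \<gamma> where "\<gamma> = \<eta>g * \<eta>l * real \<tau>"
  define S where "S = sqrt (real T)"
  have S: "S > 0" "S * S = real T" and sqrt_\<tau>: "sqrt (real \<tau>) \<ge> 1" "sqrt (real \<tau>) * sqrt (real \<tau>) = real \<tau>"
    using \<open>T \<ge> 1\<close> \<open>\<tau> \<ge> 1\<close> by (simp_all add: S_def)
  have \<gamma>_eq: "\<gamma> = 1 / (L * S)"
    using \<open>L > 0\<close> S(1) sqrt_\<tau>(1) \<open>\<tau> \<ge> 1\<close> by (simp add: \<gamma>_def \<eta>g \<eta>l S_def real_sqrt_mult)
  have L\<eta>: "L * \<eta>l = 1 / (real \<tau> * sqrt (real \<tau>) * S)"
    using \<open>L > 0\<close> by (simp add: \<eta>l S_def real_sqrt_mult)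
  have pos: "\<eta>l > 0" "\<beta> > 0" "\<gamma> > 0"
    using \<open>L > 0\<close> \<open>T \<ge> 1\<close> \<open>\<tau> \<ge> 1\<close> S(1) by (simp_all add: \<eta>l \<beta> \<gamma>_eq)
  \<comment> \<open>\<open>C1\<close> is \<open>gram_bound\<close> plus a nonnegative heterogeneity
    term.\<close>
  have gram: "run.gram_bound \<le> C1" and C1_ge: "B\<^sup>2 \<le> C1"
  proof -
    have "0 \<le> (real CARD('c) - real n') / (real n' * (real CARD('c) - 1)) * \<sigma>g\<^sup>2"
      using \<open>CARD('c) \<ge> 2\<close> \<open>n' \<le> CARD('c)\<close> by (intro mult_nonneg_nonneg divide_nonneg_nonneg) auto
    moreover have "run.gram_bound = (q + 1) / real n' * \<sigma>\<^sup>2 + q * B\<^sup>2 / real n' + B\<^sup>2"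
      by (simp add: run.gram_bound_def add_divide_distrib[of "(q + 1) * \<sigma>\<^sup>2"])
    ultimately show "run.gram_bound \<le> C1"
      unfolding C1 by linarith
    with run.B_sq_le_gram_bound show "B\<^sup>2 \<le> C1" by simp
  qed
  have gap: "0 \<le> \<delta>"
    using run.min_obj_le[of x0] by (simp add: \<delta> run.initial_gap_eq)
  \<comment> \<open>After insertion of the step size the noise part is the mixed term
    \<open>B * \<bar>\<sigma>\<bar> / \<tau>\<close>. Splitting it into halves of the two squares
    produces \<open>\<sigma>^2 / \<tau>^2\<close>, the origin of the summand
    \<open>1 / \<tau>\<close> in the final bound.\<close>
  have drift_le: "B * (L * (\<eta>l * run.drift)) \<le> (3 / 2 * B\<^sup>2 + \<sigma>\<^sup>2 / (2 * (real \<tau>)\<^sup>2)) / S"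
  proof -
    have "B * (L * (\<eta>l * run.drift)) = B * run.drift * (L * \<eta>l)"
      by simp
    also have "\<dots> = (B\<^sup>2 / sqrt (real \<tau>) + B * (\<bar>\<sigma>\<bar> / real \<tau>)) / S"
      unfolding L\<eta> run.drift_def using sqrt_\<tau> S(1) \<open>\<tau> \<ge> 1\<close>
      by (simp add: field_simps power2_eq_square)
    also have "\<dots> \<le> (3 / 2 * B\<^sup>2 + \<sigma>\<^sup>2 / (2 * (real \<tau>)\<^sup>2)) / S"
    proof (intro divide_right_mono)
      have "B\<^sup>2 / sqrt (real \<tau>) \<le> B\<^sup>2 / 1"
        using sqrt_\<tau>(1) by (intro divide_left_mono) auto
      moreover have "2 * B * (\<bar>\<sigma>\<bar> / real \<tau>) \<le> B\<^sup>2 + (\<bar>\<sigma>\<bar> / real \<tau>)\<^sup>2"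
        by (rule sum_squares_bound)
      ultimately show "B\<^sup>2 / sqrt (real \<tau>) + B * (\<bar>\<sigma>\<bar> / real \<tau>) \<le> 3 / 2 * B\<^sup>2 + \<sigma>\<^sup>2 / (2 * (real \<tau>)\<^sup>2)"
        by (simp add: power_divide)
    qed (use S in simp)
    finally show ?thesis .
  qed
  \<comment> \<open>Both \<open>B^2\<close> and \<open>gram_bound\<close> are at most
    \<open>C1\<close>, so the two errors proportional to \<beta> give \<open>1 + 1/2\<close> times
    \<open>C1^2\<close>; the factor M cancels against the one in \<beta>.\<close>
  have error_le: "run.round_error \<eta>l \<gamma> \<beta>
      \<le> (5 / 2 * B\<^sup>2 + \<sigma>\<^sup>2 / (2 * (real \<tau>)\<^sup>2) + \<sigma>\<^sup>2 / (real n * real \<tau>) + 3 / 2 * C1\<^sup>2) / S"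
  proof -
    have "B\<^sup>2 * run.gram_bound \<le> C1 * C1" "run.gram_bound\<^sup>2 \<le> C1\<^sup>2"
      using gram C1_ge run.gram_bound_nonneg by (auto intro!: mult_mono power_mono)
    then have "B\<^sup>2 * run.gram_bound + run.gram_bound\<^sup>2 / 2 \<le> 3 / 2 * C1\<^sup>2"
      by (simp add: power2_eq_square)
    moreover have "\<beta> * real CARD('m) = 1 / S" "L * \<gamma> = 1 / S"
      using \<open>L > 0\<close> by (simp_all add: \<beta> S_def[symmetric] \<gamma>_eq)
    ultimately show ?thesis
      using drift_le S(1) divide_right_mono[of "B\<^sup>2 * run.gram_bound + run.gram_bound\<^sup>2 / 2" "3 / 2 * C1\<^sup>2" S]
      by (simp add: run.round_error_def run.local_error_def add_divide_distrib)
  qed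
  have "(1 / real T) * (\<Sum>t<T. \<integral>\<omega>.
             (let (x, w) = fedcmoo \<eta>l \<eta>g \<beta> \<tau> n n' sg Q R x0 \<omega> t
              in (norm (\<Sum>k\<in>UNIV. w $ k *\<^sub>R grad (avg_obj f k) x))\<^sup>2) \<partial>P)
      = (1 / real T) * (\<Sum>t<T. \<integral>\<omega>. (norm (run.global_grad (run.weights \<eta>l \<eta>g \<beta> x0 t \<omega>) (run.point \<eta>l \<eta>g \<beta> x0 t \<omega>)))\<^sup>2 \<partial>P)"
    by (simp add: run.global_grad_def run.weights_def[OF pos \<gamma>_def] run.point_def[OF pos \<gamma>_def]
        case_prod_beta' Let_def)
  also have "\<dots> \<le> (1 / real T) * (\<delta> / \<gamma> + real T * run.round_error \<eta>l \<gamma> \<beta>)"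
    unfolding \<delta> by (intro mult_left_mono run.sum_expected_sq_norm_le pos \<gamma>_def) simp
  also have "\<dots> = L * \<delta> / S + run.round_error \<eta>l \<gamma> \<beta>"
    using S \<open>T \<ge> 1\<close> by (simp add: \<gamma>_eq field_simps flip: S(2))
  also have "\<dots> \<le> (L * \<delta> + 5 / 2 * B\<^sup>2 + \<sigma>\<^sup>2 / (2 * (real \<tau>)\<^sup>2) + \<sigma>\<^sup>2 / (real n * real \<tau>) + 3 / 2 * C1\<^sup>2) / S"
    using error_le by (simp add: add_divide_distrib)
  \<comment> \<open>The numeral 10 is generous: the coefficients reached so far are at most
    \<open>5/2\<close>. The factor \<open>* 2\<close> undoes the half in
    \<open>\<sigma>^2 / (2 * \<tau>^2)\<close>, in preparation for factoring the noise term.\<close>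
  also have "\<dots> \<le> (10 * (B\<^sup>2 + C1\<^sup>2 + L * \<delta>) + 10 * (\<sigma>\<^sup>2 / (2 * (real \<tau>)\<^sup>2) * 2 + \<sigma>\<^sup>2 / (real n * real \<tau>))) / S"
  proof (intro divide_right_mono)
    have "x + 5 / 2 * y + a + b + 3 / 2 * z \<le> 10 * (y + z + x) + 10 * (a * 2 + b)"
      if "0 \<le> a" "0 \<le> b" "0 \<le> x" "0 \<le> y" "0 \<le> z" for a b x y z :: real
      using that by simp
    then show "L * \<delta> + 5 / 2 * B\<^sup>2 + \<sigma>\<^sup>2 / (2 * (real \<tau>)\<^sup>2) + \<sigma>\<^sup>2 / (real n * real \<tau>) + 3 / 2 * C1\<^sup>2
      \<le> 10 * (B\<^sup>2 + C1\<^sup>2 + L * \<delta>) + 10 * (\<sigma>\<^sup>2 / (2 * (real \<tau>)\<^sup>2) * 2 + \<sigma>\<^sup>2 / (real n * real \<tau>))"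
      using gap \<open>L > 0\<close> by (meson divide_nonneg_nonneg mult_nonneg_nonneg of_nat_0_le_iff
          zero_le_numeral zero_le_power2 less_imp_le)
  qed (use S in simp)
  also have "\<dots> = 10 * ((B\<^sup>2 + C1\<^sup>2 + L * \<delta>) / sqrt (real T))
           + 10 * (\<sigma>\<^sup>2 / (real \<tau> * sqrt (real T)) * (1 / real n + 1 / real \<tau>))"
    unfolding S_def[symmetric] using S(1) \<open>\<tau> \<ge> 1\<close> \<open>1 \<le> n\<close> by (simp add: field_simps power2_eq_square)
  finally show ?thesis .
qed

end
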